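(* For every category $\mathcal C$ and every symmetric multicategory $\mathcal N$ there are isomorphisms of symmetric multicategories $$[\mathcal C^-,\mathcal N]\cong\mathcal N^{\mathcal C_\blacktriangleright},\qquad \mathcal C^-\otimes\mathcal N\cong\mathcal C_\blacktriangleright\times\mathcal N .$$ In particular, $\mathcal C^-\otimes 1_\blacktriangleright\cong\mathcal C_\blacktriangleright$ and $\mathcal C^-\otimes\mathcal D^-\cong(\mathcal C\times\mathcal D)^-$ for all categories $\mathcal C,\mathcal D$.
   Context: $\mathbf{sMlt}$ is the category of (small) symmetric multicategories and symmetric functors. An arrow $f:A_1,\dots,A_n\to A$ and a permutation $\sigma$ of its domain give an arrow $\sigma f$. For a category $\mathcal C$: $\mathcal C^-$ is the symmetric multicategory with the objects of $\mathcal C$, $\mathcal C^-(X;Y)=\mathcal C(X;Y)$ and no $n$-ary arrows for $n\neq1$. $\mathcal C_\blacktriangleright$ is the symmetric multicategory with the objects of $\mathcal C$ and $\mathcal C_\blacktriangleright(X_1,\dots,X_n;X)=\mathcal C(X_1;X)\times\cdots\times\mathcal C(X_n;X)$, composition $\langle f_1,\dots,f_n\rangle(\langle g_{11},\dots,g_{1m_1}\rangle,\dots,\langle g_{n1},\dots,g_{nm_n}\rangle)=\langle f_1g_{11},\dots,f_1g_{1m_1},\dots,f_ng_{n1},\dots,f_ng_{nm_n}\rangle$, and symmetric structure given by permuting sequences. $1$ is the terminal category; $1_\blacktriangleright$ is terminal in $\mathbf{sMlt}$. $\times$ and $\mathcal N^{\mathcal C_\blacktriangleright}$ denote the cartesian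 product and the exponential (for the cartesian structure) in $\mathbf{sMlt}$; multicategories $\mathcal C_\blacktriangleright$ are exponentiable in $\mathbf{sMlt}$. $(\mathbf{sMlt},1^-,\otimes)$ is the Boardman–Vogt symmetric monoidal closed structure. The objects of $\mathcal M\otimes\mathcal N$ are pairs $\langle A,X\rangle$ with $A\in\mathcal M$, $X\in\mathcal N$; its arrows are generated by $f_X:\langle A_1,X\rangle,\dots,\langle A_n,X\rangle\to\langle A,X\rangle$ for $f:A_1,\dots,A_n\to A$ in $\mathcal M$ and $h_A:\langle A,X_1\rangle,\dots,\langle A,X_m\rangle\to\langle A,X\rangle$ for $h:X_1,\dots,X_m\to X$ in $\mathcal N$, subject to the relations making $(-)_X:\mathcal M\to\mathcal M\otimes\mathcal N$ and $(-)_A:\mathcal N\to\mathcal M\otimes\mathcal N$ symmetric functors and to $f_X(h_{A_1},\dots,h_{A_n})=\sigma\,h_A(f_{X_1},\dots,f_{X_m})$, with $\sigma$ the evident permutation matching the domains. The internal hom $[\mathcal M,\mathcal N]$ has as objects the symmetric functors $\mathcal M\to\mathcal N$; an arrow $\alpha:F_1,\dots,F_n\to F$ is a family of arrows $\alpha_A:F_1A,\dots,F_nA\to FA$ in $\mathcal N$ ($A\in\mathcal M$) such that $Ff(\alpha_{A_1},\dots,\alpha_{A_m})=\sigma\,\alpha_A(F_1f,\dots,F_nf)$ for every $f:A_1,\dots,A_m\to A$ in $\mathcal M$, with $\sigma$ the evident permutation; composition and symmetric structure are pointwise. *)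

theory Defs
  imports "HOL-Library.FuncSet" "HOL-Combinatorics.Combinatorics"
begin

section \<open>Permutations of lists\<close>

text \<open>
  A permutation of a list of length \<open>n\<close> is a function \<open>s\<close> with \<open>s permutes {..<n}\<close>, acting by
  \<open>permute_list s xs = [xs ! s 0, \<dots>, xs ! s (n - 1)]\<close>.  This is a right action:
  \<open>permute_list (s \<circ> t) xs = permute_list t (permute_list s xs)\<close>.
  The permutations below are given by listing the indices in the order in which they
  occur in the result.
\<close>

definition perm_of_list :: "nat list \<Rightarrow> nat \<Rightarrow> nat" where
  "perm_of_list ks i = (if i < length ks then ks ! i else i)"

text \<open>\<open>blocks [m1, \<dots>, mn]\<close> cuts \<open>[0..<m1 + \<dots> + mn]\<close> into consecutive intervals of these lengths.\<close>

definition blocks :: "nat list \<Rightarrow> nat list list" where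
  "blocks ms = map (\<lambda>k. [sum_list (take k ms)..<sum_list (take (Suc k) ms)]) [0..<length ms]"

text \<open>If \<open>map length xss = ms\<close>, then
  \<open>permute_list (block_perm s ms) (concat xss) = concat (permute_list s xss)\<close> and
  \<open>permute_list (sum_perm ss ms) (concat xss) = concat (map2 permute_list ss xss)\<close>.\<close>

definition block_perm :: "(nat \<Rightarrow> nat) \<Rightarrow> nat list \<Rightarrow> nat \<Rightarrow> nat" where
  "block_perm s ms = perm_of_list (concat (permute_list s (blocks ms)))"

definition sum_perm :: "(nat \<Rightarrow> nat) list \<Rightarrow> nat list \<Rightarrow> nat \<Rightarrow> nat" where
  "sum_perm ss ms = perm_of_list (concat (map2 permute_list ss (blocks ms)))"

text \<open>The concatenation of the \<open>r\<close> rows (of length \<open>c\<close>) of a matrix is turned by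
  \<open>transpose_perm r c\<close> into the concatenation of its \<open>c\<close> columns.\<close>

definition transpose_perm :: "nat \<Rightarrow> nat \<Rightarrow> nat \<Rightarrow> nat" where
  "transpose_perm r c = perm_of_list (concat (map (\<lambda>j. map (\<lambda>i. i * c + j) [0..<r]) [0..<c]))"


section \<open>Categories\<close>

record ('o, 'a) cat =
  cob :: "'o set"
  car :: "'a set"
  cdom :: "'a \<Rightarrow> 'o"
  ccod :: "'a \<Rightarrow> 'o"
  cid :: "'o \<Rightarrow> 'a"
  ccomp :: "'a \<Rightarrow> 'a \<Rightarrow> 'a"

locale category =
  fixes C :: "('o, 'a) cat"
  assumes dom_ob: "f \<in> car C \<Longrightarrow> cdom C f \<in> cob C"
    and cod_ob: "f \<in> car C \<Longrightarrow> ccod C f \<in> cob C"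
    and id_ar: "X \<in> cob C \<Longrightarrow> cid C X \<in> car C \<and> cdom C (cid C X) = X \<and> ccod C (cid C X) = X"
    and comp_ar: "\<lbrakk>f \<in> car C; g \<in> car C; ccod C g = cdom C f\<rbrakk> \<Longrightarrow>
      ccomp C f g \<in> car C \<and> cdom C (ccomp C f g) = cdom C g \<and> ccod C (ccomp C f g) = ccod C f"
    and id_left: "f \<in> car C \<Longrightarrow> ccomp C (cid C (ccod C f)) f = f"
    and id_right: "f \<in> car C \<Longrightarrow> ccomp C f (cid C (cdom C f)) = f"
    and assoc: "\<lbrakk>f \<in> car C; g \<in> car C; h \<in> car C; ccod C g = cdom C f; ccod C h = cdom C g\<rbrakk> \<Longrightarrow>
      ccomp C (ccomp C f g) h = ccomp C f (ccomp C g h)"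

definition terminal_cat :: "(unit, unit) cat" where
  "terminal_cat = \<lparr>cob = UNIV, car = UNIV, cdom = (\<lambda>_. ()), ccod = (\<lambda>_. ()),
    cid = (\<lambda>_. ()), ccomp = (\<lambda>_ _. ())\<rparr>"

definition cat_prod :: "('o, 'a) cat \<Rightarrow> ('p, 'b) cat \<Rightarrow> ('o \<times> 'p, 'a \<times> 'b) cat" where
  "cat_prod C D = \<lparr>cob = cob C \<times> cob D, car = car C \<times> car D,
    cdom = map_prod (cdom C) (cdom D), ccod = map_prod (ccod C) (ccod D),
    cid = map_prod (cid C) (cid D),
    ccomp = (\<lambda>(f, g) (f', g'). (ccomp C f f', ccomp D g g'))\<rparr>"


section \<open>Symmetric multicategories\<close>

text \<open>\<open>mcomp M f [g1, \<dots>, gn]\<close> is the composite \<open>f(g1, \<dots>, gn)\<close>, and \<open>mact M s f\<close> is \<open>s f\<close>, with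
  domain \<open>permute_list s (mdom M f)\<close>.\<close>

record ('o, 'a) smcat =
  mob :: "'o set"
  mar :: "'a set"
  mdom :: "'a \<Rightarrow> 'o list"
  mcod :: "'a \<Rightarrow> 'o"
  mid :: "'o \<Rightarrow> 'a"
  mcomp :: "'a \<Rightarrow> 'a list \<Rightarrow> 'a"
  mact :: "(nat \<Rightarrow> nat) \<Rightarrow> 'a \<Rightarrow> 'a"

abbreviation arity :: "('o, 'a) smcat \<Rightarrow> 'a \<Rightarrow> nat" where
  "arity M f \<equiv> length (mdom M f)"

definition composable :: "('o, 'a) smcat \<Rightarrow> 'a \<Rightarrow> 'a list \<Rightarrow> bool" where
  "composable M f gs \<longleftrightarrow> f \<in> mar M \<and> set gs \<subseteq> mar M \<and> map (mcod M) gs = mdom M f"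

locale symmetric_multicategory =
  fixes M :: "('o, 'a) smcat"
  assumes dom_ob: "f \<in> mar M \<Longrightarrow> set (mdom M f) \<subseteq> mob M"
    and cod_ob: "f \<in> mar M \<Longrightarrow> mcod M f \<in> mob M"
    and id_ar: "A \<in> mob M \<Longrightarrow> mid M A \<in> mar M \<and> mdom M (mid M A) = [A] \<and> mcod M (mid M A) = A"
    and comp_ar: "composable M f gs \<Longrightarrow>
      mcomp M f gs \<in> mar M \<and> mdom M (mcomp M f gs) = concat (map (mdom M) gs) \<and>
      mcod M (mcomp M f gs) = mcod M f"
    and id_left: "f \<in> mar M \<Longrightarrow> mcomp M (mid M (mcod M f)) [f] = f"
    and id_right: "f \<in> mar M \<Longrightarrow> mcomp M f (map (mid M) (mdom M f)) = f"
    and assoc: "\<lbrakk>composable M f gs; list_all2 (composable M) gs hss\<rbrakk> \<Longrightarrow>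
      mcomp M (mcomp M f gs) (concat hss) = mcomp M f (map2 (mcomp M) gs hss)"
    and act_ar: "\<lbrakk>f \<in> mar M; s permutes {..<arity M f}\<rbrakk> \<Longrightarrow>
      mact M s f \<in> mar M \<and> mdom M (mact M s f) = permute_list s (mdom M f) \<and>
      mcod M (mact M s f) = mcod M f"
    and act_id: "f \<in> mar M \<Longrightarrow> mact M id f = f"
    and act_comp: "\<lbrakk>f \<in> mar M; s permutes {..<arity M f}; t permutes {..<arity M f}\<rbrakk> \<Longrightarrow>
      mact M (s \<circ> t) f = mact M t (mact M s f)"
    and equivariant_outer: "\<lbrakk>composable M f gs; s permutes {..<length gs}\<rbrakk> \<Longrightarrow>
      mcomp M (mact M s f) (permute_list s gs) =
      mact M (block_perm s (map (arity M) gs)) (mcomp M f gs)"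
    and equivariant_inner:
      "\<lbrakk>composable M f gs; list_all2 (\<lambda>s g. s permutes {..<arity M g}) ss gs\<rbrakk> \<Longrightarrow>
      mcomp M f (map2 (mact M) ss gs) = mact M (sum_perm ss (map (arity M) gs)) (mcomp M f gs)"


section \<open>Symmetric functors\<close>

text \<open>Both components are required to be \<open>undefined\<close> outside the objects (arrows) of the source,
  so that equality of records is equality of functors.\<close>

record ('o, 'a, 'p, 'b) mfunctor =
  fob :: "'o \<Rightarrow> 'p"
  far :: "'a \<Rightarrow> 'b"

definition symmetric_functors ::
    "('o, 'a) smcat \<Rightarrow> ('p, 'b) smcat \<Rightarrow> ('o, 'a, 'p, 'b) mfunctor set" where
  "symmetric_functors M N = {F.
     fob F \<in> mob M \<rightarrow>\<^sub>E mob N \<and>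
     far F \<in> mar M \<rightarrow>\<^sub>E mar N \<and>
     (\<forall>f \<in> mar M. mdom N (far F f) = map (fob F) (mdom M f) \<and> mcod N (far F f) = fob F (mcod M f)) \<and>
     (\<forall>A \<in> mob M. far F (mid M A) = mid N (fob F A)) \<and>
     (\<forall>f gs. composable M f gs \<longrightarrow> far F (mcomp M f gs) = mcomp N (far F f) (map (far F) gs)) \<and>
     (\<forall>f \<in> mar M. \<forall>s. s permutes {..<arity M f} \<longrightarrow> far F (mact M s f) = mact N s (far F f))}"

definition functor_id :: "('o, 'a) smcat \<Rightarrow> ('o, 'a, 'o, 'a) mfunctor" where
  "functor_id M = \<lparr>fob = restrict (\<lambda>A. A) (mob M), far = restrict (\<lambda>f. f) (mar M)\<rparr>"

text \<open>\<open>functor_comp M G F\<close> is \<open>G \<circ> F\<close>, where \<open>M\<close> is the source of \<open>F\<close>.\<close>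

definition functor_comp :: "('o, 'a) smcat \<Rightarrow> ('p, 'b, 'q, 'c) mfunctor \<Rightarrow>
    ('o, 'a, 'p, 'b) mfunctor \<Rightarrow> ('o, 'a, 'q, 'c) mfunctor" where
  "functor_comp M G F =
    \<lparr>fob = restrict (\<lambda>A. fob G (fob F A)) (mob M), far = restrict (\<lambda>f. far G (far F f)) (mar M)\<rparr>"

definition isomorphic :: "('o, 'a) smcat \<Rightarrow> ('p, 'b) smcat \<Rightarrow> bool" (infix "\<cong>\<^sub>m" 50) where
  "M \<cong>\<^sub>m N \<longleftrightarrow> symmetric_multicategory M \<and> symmetric_multicategory N \<and>
    (\<exists>F \<in> symmetric_functors M N. \<exists>G \<in> symmetric_functors N M.
      functor_comp M G F = functor_id M \<and> functor_comp N F G = functor_id N)"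


section \<open>The symmetric multicategories associated to a category\<close>

definition unary_mcat :: "('o, 'a) cat \<Rightarrow> ('o, 'a) smcat" ("_\<^sup>-" [1000] 999) where
  "C\<^sup>- = \<lparr>mob = cob C, mar = car C, mdom = (\<lambda>f. [cdom C f]), mcod = ccod C, mid = cid C,
    mcomp = (\<lambda>f gs. ccomp C f (hd gs)), mact = (\<lambda>s f. f)\<rparr>"

text \<open>An arrow of \<open>C\<^sub>\<triangleright>\<close> is a pair \<open>(X, [f1, \<dots>, fn])\<close>; the codomain \<open>X\<close> is recorded because it
  cannot be recovered from the empty sequence.\<close>

definition sequence_mcat :: "('o, 'a) cat \<Rightarrow> ('o, 'o \<times> 'a list) smcat" ("_\<^sub>\<triangleright>" [1000] 999) where
  "C\<^sub>\<triangleright> = \<lparr>mob = cob C,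
    mar = {(X, fs). X \<in> cob C \<and> set fs \<subseteq> car C \<and> (\<forall>f \<in> set fs. ccod C f = X)},
    mdom = (\<lambda>(X, fs). map (cdom C) fs),
    mcod = fst,
    mid = (\<lambda>X. (X, [cid C X])),
    mcomp = (\<lambda>(X, fs) gss. (X, concat (map2 (\<lambda>f (Y, gs). map (ccomp C f) gs) fs gss))),
    mact = (\<lambda>s (X, fs). (X, permute_list s fs))\<rparr>"


section \<open>Cartesian products and exponentials\<close>

definition smcat_prod :: "('o, 'a) smcat \<Rightarrow> ('p, 'b) smcat \<Rightarrow> ('o \<times> 'p, 'a \<times> 'b) smcat"
    (infixr "\<times>\<^sub>m" 75) where
  "M \<times>\<^sub>m N = \<lparr>mob = mob M \<times> mob N,
    mar = {(f, g). f \<in> mar M \<and> g \<in> mar N \<and> arity M f = arity N g},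
    mdom = (\<lambda>(f, g). zip (mdom M f) (mdom N g)),
    mcod = map_prod (mcod M) (mcod N),
    mid = map_prod (mid M) (mid N),
    mcomp = (\<lambda>(f, g) hs. (mcomp M f (map fst hs), mcomp N g (map snd hs))),
    mact = (\<lambda>s. map_prod (mact M s) (mact N s))\<rparr>"

definition functor_prod :: "('o, 'a) smcat \<Rightarrow> ('p, 'b) smcat \<Rightarrow>
    ('o, 'a, 'q, 'c) mfunctor \<Rightarrow> ('p, 'b, 'r, 'd) mfunctor \<Rightarrow>
    ('o \<times> 'p, 'a \<times> 'b, 'q \<times> 'r, 'c \<times> 'd) mfunctor" where
  "functor_prod L M H K =
    \<lparr>fob = restrict (map_prod (fob H) (fob K)) (mob (L \<times>\<^sub>m M)),
     far = restrict (map_prod (far H) (far K)) (mar (L \<times>\<^sub>m M))\<rparr>"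

text \<open>\<open>E\<close> with \<open>ev : E \<times> M \<rightarrow> N\<close> is an exponential \<open>N\<^sup>M\<close>: every \<open>G : L \<times> M \<rightarrow> N\<close> is
  \<open>ev \<circ> (H \<times> M)\<close> for a unique \<open>H : L \<rightarrow> E\<close>.  A formula cannot quantify over types, so the types of
  objects and arrows of the test multicategories \<open>L\<close> are a parameter; \<open>(E, ev)\<close> is an exponential
  if this holds for all instances of the parameter.\<close>

definition is_exponential :: "('l \<times> 'k) itself \<Rightarrow> ('o, 'a) smcat \<Rightarrow> ('p, 'b) smcat \<Rightarrow>
    ('e, 'f) smcat \<Rightarrow> ('e \<times> 'o, 'f \<times> 'a, 'p, 'b) mfunctor \<Rightarrow> bool" where
  "is_exponential T M N E ev \<longleftrightarrow>
    symmetric_multicategory E \<and> ev \<in> symmetric_functors (E \<times>\<^sub>m M) N \<and>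
    (\<forall>L :: ('l, 'k) smcat. symmetric_multicategory L \<longrightarrow>
      (\<forall>G \<in> symmetric_functors (L \<times>\<^sub>m M) N.
        \<exists>!H. H \<in> symmetric_functors L E \<and>
          functor_comp (L \<times>\<^sub>m M) ev (functor_prod L M H (functor_id M)) = G))"


section \<open>The internal hom\<close>

text \<open>An arrow \<open>F1, \<dots>, Fn \<rightarrow> F\<close> is a triple \<open>([F1, \<dots>, Fn], F, \<alpha>)\<close>, the family \<open>\<alpha>\<close> being \<open>undefined\<close>
  outside the objects of \<open>M\<close>.\<close>

type_synonym ('o, 'a, 'p, 'b) hom_arrow =
  "('o, 'a, 'p, 'b) mfunctor list \<times> ('o, 'a, 'p, 'b) mfunctor \<times> ('o \<Rightarrow> 'b)"

definition natural_family :: "('o, 'a) smcat \<Rightarrow> ('p, 'b) smcat \<Rightarrow>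
    ('o, 'a, 'p, 'b) mfunctor list \<Rightarrow> ('o, 'a, 'p, 'b) mfunctor \<Rightarrow> ('o \<Rightarrow> 'b) \<Rightarrow> bool" where
  "natural_family M N Fs F \<alpha> \<longleftrightarrow>
    \<alpha> \<in> mob M \<rightarrow>\<^sub>E mar N \<and>
    (\<forall>A \<in> mob M. mdom N (\<alpha> A) = map (\<lambda>G. fob G A) Fs \<and> mcod N (\<alpha> A) = fob F A) \<and>
    (\<forall>f \<in> mar M. mcomp N (far F f) (map \<alpha> (mdom M f)) =
      mact N (transpose_perm (length Fs) (arity M f))
        (mcomp N (\<alpha> (mcod M f)) (map (\<lambda>G. far G f) Fs)))"

definition internal_hom :: "('o, 'a) smcat \<Rightarrow> ('p, 'b) smcat \<Rightarrow>
    (('o, 'a, 'p, 'b) mfunctor, ('o, 'a, 'p, 'b) hom_arrow) smcat" where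
  "internal_hom M N = \<lparr>mob = symmetric_functors M N,
    mar = {(Fs, F, \<alpha>). set Fs \<subseteq> symmetric_functors M N \<and> F \<in> symmetric_functors M N \<and>
             natural_family M N Fs F \<alpha>},
    mdom = (\<lambda>(Fs, F, \<alpha>). Fs),
    mcod = (\<lambda>(Fs, F, \<alpha>). F),
    mid = (\<lambda>F. ([F], F, \<lambda>A \<in> mob M. mid N (fob F A))),
    mcomp = (\<lambda>(Fs, F, \<alpha>) \<beta>s. (concat (map fst \<beta>s), F,
               \<lambda>A \<in> mob M. mcomp N (\<alpha> A) (map (\<lambda>(Gs, G, \<beta>). \<beta> A) \<beta>s))),
    mact = (\<lambda>s (Fs, F, \<alpha>). (permute_list s Fs, F, \<lambda>A \<in> mob M. mact N s (\<alpha> A)))\<rparr>"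

text \<open>The canonical evaluation \<open>[C\<^sup>-, N] \<times> C\<^sub>\<triangleright> \<rightarrow> N\<close>, which sends an arrow
  \<open>\<alpha> : F1, \<dots>, Fn \<rightarrow> F\<close> and a sequence \<open>fi : Xi \<rightarrow> X\<close> to \<open>\<alpha>\<^sub>X(F1 f1, \<dots>, Fn fn)\<close>.\<close>

definition evaluation :: "('o, 'a) cat \<Rightarrow> ('p, 'b) smcat \<Rightarrow>
    (('o, 'a, 'p, 'b) mfunctor \<times> 'o, ('o, 'a, 'p, 'b) hom_arrow \<times> ('o \<times> 'a list), 'p, 'b) mfunctor" where
  "evaluation C N =
    \<lparr>fob = restrict (\<lambda>(F, X). fob F X) (mob (internal_hom (C\<^sup>-) N \<times>\<^sub>m C\<^sub>\<triangleright>)),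
     far = restrict (\<lambda>((Fs, F, \<alpha>), (X, fs)). mcomp N (\<alpha> X) (map2 far Fs fs))
             (mar (internal_hom (C\<^sup>-) N \<times>\<^sub>m C\<^sub>\<triangleright>))\<rparr>"


section \<open>Symmetric multicategories presented by generators and relations\<close>

record ('o, 'g) multigraph =
  gob :: "'o set"
  gar :: "'g set"
  gdom :: "'g \<Rightarrow> 'o list"
  gcod :: "'g \<Rightarrow> 'o"

datatype ('o, 'g) mterm =
    Gen 'g
  | Ident 'o
  | Comp "('o, 'g) mterm" "('o, 'g) mterm list"
  | Perm "nat \<Rightarrow> nat" "('o, 'g) mterm"

primrec tdom :: "('o, 'g) multigraph \<Rightarrow> ('o, 'g) mterm \<Rightarrow> 'o list" where
  "tdom S (Gen g) = gdom S g"
| "tdom S (Ident A) = [A]"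
| "tdom S (Comp t us) = concat (map (tdom S) us)"
| "tdom S (Perm s t) = permute_list s (tdom S t)"

primrec tcod :: "('o, 'g) multigraph \<Rightarrow> ('o, 'g) mterm \<Rightarrow> 'o" where
  "tcod S (Gen g) = gcod S g"
| "tcod S (Ident A) = A"
| "tcod S (Comp t us) = tcod S t"
| "tcod S (Perm s t) = tcod S t"

inductive_set mterms :: "('o, 'g) multigraph \<Rightarrow> ('o, 'g) mterm set" for S where
  Gen: "g \<in> gar S \<Longrightarrow> Gen g \<in> mterms S"
| Ident: "A \<in> gob S \<Longrightarrow> Ident A \<in> mterms S"
| Comp: "\<lbrakk>t \<in> mterms S; \<forall>u \<in> set us. u \<in> mterms S; map (tcod S) us = tdom S t\<rbrakk> \<Longrightarrow>
    Comp t us \<in> mterms S"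
| Perm: "\<lbrakk>t \<in> mterms S; s permutes {..<length (tdom S t)}\<rbrakk> \<Longrightarrow> Perm s t \<in> mterms S"

text \<open>The least congruence on well-formed terms which contains the relations \<open>R\<close> and makes the
  quotient a symmetric multicategory.\<close>

inductive term_eq ::
    "('o, 'g) multigraph \<Rightarrow> (('o, 'g) mterm \<times> ('o, 'g) mterm) set \<Rightarrow>
     ('o, 'g) mterm \<Rightarrow> ('o, 'g) mterm \<Rightarrow> bool" for S R where
  rel: "\<lbrakk>(t, u) \<in> R; t \<in> mterms S; u \<in> mterms S; tdom S t = tdom S u; tcod S t = tcod S u\<rbrakk> \<Longrightarrow>
    term_eq S R t u"
| refl: "t \<in> mterms S \<Longrightarrow> term_eq S R t t"
| sym: "term_eq S R t u \<Longrightarrow> term_eq S R u t"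
| trans: "\<lbrakk>term_eq S R t u; term_eq S R u v\<rbrakk> \<Longrightarrow> term_eq S R t v"
| cong_Comp: "\<lbrakk>term_eq S R t t'; list_all2 (term_eq S R) us us'; Comp t us \<in> mterms S\<rbrakk> \<Longrightarrow>
    term_eq S R (Comp t us) (Comp t' us')"
| cong_Perm: "\<lbrakk>term_eq S R t t'; Perm s t \<in> mterms S\<rbrakk> \<Longrightarrow> term_eq S R (Perm s t) (Perm s t')"
| id_left: "t \<in> mterms S \<Longrightarrow> term_eq S R (Comp (Ident (tcod S t)) [t]) t"
| id_right: "t \<in> mterms S \<Longrightarrow> term_eq S R (Comp t (map Ident (tdom S t))) t"
| assoc: "\<lbrakk>Comp t us \<in> mterms S; list_all2 (\<lambda>u vs. Comp u vs \<in> mterms S) us vss\<rbrakk> \<Longrightarrow>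
    term_eq S R (Comp (Comp t us) (concat vss)) (Comp t (map2 Comp us vss))"
| act_id: "t \<in> mterms S \<Longrightarrow> term_eq S R (Perm id t) t"
| act_comp: "\<lbrakk>t \<in> mterms S; s permutes {..<length (tdom S t)}; s' permutes {..<length (tdom S t)}\<rbrakk> \<Longrightarrow>
    term_eq S R (Perm (s \<circ> s') t) (Perm s' (Perm s t))"
| equivariant_outer: "\<lbrakk>Comp t us \<in> mterms S; s permutes {..<length us}\<rbrakk> \<Longrightarrow>
    term_eq S R (Comp (Perm s t) (permute_list s us))
      (Perm (block_perm s (map (\<lambda>u. length (tdom S u)) us)) (Comp t us))"
| equivariant_inner:
    "\<lbrakk>Comp t us \<in> mterms S; list_all2 (\<lambda>s u. s permutes {..<length (tdom S u)}) ss us\<rbrakk> \<Longrightarrow>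
    term_eq S R (Comp t (map2 Perm ss us))
      (Perm (sum_perm ss (map (\<lambda>u. length (tdom S u)) us)) (Comp t us))"

definition term_class :: "('o, 'g) multigraph \<Rightarrow> (('o, 'g) mterm \<times> ('o, 'g) mterm) set \<Rightarrow>
    ('o, 'g) mterm \<Rightarrow> ('o, 'g) mterm set" where
  "term_class S R t = {u. term_eq S R t u}"

abbreviation representative :: "'t set \<Rightarrow> 't" where
  "representative c \<equiv> SOME t. t \<in> c"

definition presented_smcat :: "('o, 'g) multigraph \<Rightarrow> (('o, 'g) mterm \<times> ('o, 'g) mterm) set \<Rightarrow>
    ('o, ('o, 'g) mterm set) smcat" where
  "presented_smcat S R = \<lparr>mob = gob S,
    mar = term_class S R ` mterms S,
    mdom = (\<lambda>c. tdom S (representative c)),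
    mcod = (\<lambda>c. tcod S (representative c)),
    mid = (\<lambda>A. term_class S R (Ident A)),
    mcomp = (\<lambda>c ds. term_class S R (Comp (representative c) (map representative ds))),
    mact = (\<lambda>s c. term_class S R (Perm s (representative c)))\<rparr>"


section \<open>The Boardman--Vogt tensor product\<close>

text \<open>\<open>Lgen f X\<close> is \<open>f\<^sub>X\<close> and \<open>Rgen h A\<close> is \<open>h\<^sub>A\<close>.\<close>

datatype ('o, 'a, 'p, 'b) bv_gen = Lgen 'a 'p | Rgen 'b 'o

definition bv_graph :: "('o, 'a) smcat \<Rightarrow> ('p, 'b) smcat \<Rightarrow>
    ('o \<times> 'p, ('o, 'a, 'p, 'b) bv_gen) multigraph" where
  "bv_graph M N = \<lparr>gob = mob M \<times> mob N,
    gar = {Lgen f X | f X. f \<in> mar M \<and> X \<in> mob N} \<union> {Rgen h A | h A. h \<in> mar N \<and> A \<in> mob M},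
    gdom = case_bv_gen (\<lambda>f X. map (\<lambda>A. (A, X)) (mdom M f)) (\<lambda>h A. map (\<lambda>X. (A, X)) (mdom N h)),
    gcod = case_bv_gen (\<lambda>f X. (mcod M f, X)) (\<lambda>h A. (A, mcod N h))\<rparr>"

inductive_set bv_rel :: "('o, 'a) smcat \<Rightarrow> ('p, 'b) smcat \<Rightarrow>
    (('o \<times> 'p, ('o, 'a, 'p, 'b) bv_gen) mterm \<times> ('o \<times> 'p, ('o, 'a, 'p, 'b) bv_gen) mterm) set"
  for M N where
  left_id: "\<lbrakk>A \<in> mob M; X \<in> mob N\<rbrakk> \<Longrightarrow> (Gen (Lgen (mid M A) X), Ident (A, X)) \<in> bv_rel M N"
| left_comp: "\<lbrakk>composable M f gs; X \<in> mob N\<rbrakk> \<Longrightarrow>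
    (Gen (Lgen (mcomp M f gs) X), Comp (Gen (Lgen f X)) (map (\<lambda>g. Gen (Lgen g X)) gs)) \<in> bv_rel M N"
| left_act: "\<lbrakk>f \<in> mar M; s permutes {..<arity M f}; X \<in> mob N\<rbrakk> \<Longrightarrow>
    (Gen (Lgen (mact M s f) X), Perm s (Gen (Lgen f X))) \<in> bv_rel M N"
| right_id: "\<lbrakk>A \<in> mob M; X \<in> mob N\<rbrakk> \<Longrightarrow> (Gen (Rgen (mid N X) A), Ident (A, X)) \<in> bv_rel M N"
| right_comp: "\<lbrakk>composable N h ks; A \<in> mob M\<rbrakk> \<Longrightarrow>
    (Gen (Rgen (mcomp N h ks) A), Comp (Gen (Rgen h A)) (map (\<lambda>k. Gen (Rgen k A)) ks)) \<in> bv_rel M N"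
| right_act: "\<lbrakk>h \<in> mar N; s permutes {..<arity N h}; A \<in> mob M\<rbrakk> \<Longrightarrow>
    (Gen (Rgen (mact N s h) A), Perm s (Gen (Rgen h A))) \<in> bv_rel M N"
| interchange: "\<lbrakk>f \<in> mar M; h \<in> mar N\<rbrakk> \<Longrightarrow>
    (Comp (Gen (Lgen f (mcod N h))) (map (\<lambda>A. Gen (Rgen h A)) (mdom M f)),
     Perm (transpose_perm (arity N h) (arity M f))
       (Comp (Gen (Rgen h (mcod M f))) (map (\<lambda>X. Gen (Lgen f X)) (mdom N h)))) \<in> bv_rel M N"

definition bv_tensor :: "('o, 'a) smcat \<Rightarrow> ('p, 'b) smcat \<Rightarrow>
    ('o \<times> 'p, ('o \<times> 'p, ('o, 'a, 'p, 'b) bv_gen) mterm set) smcat" (infixr "\<otimes>\<^sub>m" 75) where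
  "M \<otimes>\<^sub>m N = presented_smcat (bv_graph M N) (bv_rel M N)"

end

(*
  A functor out of C^- \<otimes> N is a "bimorphism": it is functorial in C and in N separately and satisfies
  the interchange law.  Since the arrows of C^- are unary, interchange involves no permutation and lets
  every arrow of C be moved to the right: an arrow (X, [f1, ..., fn]) of C_|> together with an n-ary h
  of N corresponds to the composite h_X (f1_{A1}, ..., fn_{An}), and any composite of generators can be
  brought to this form.  Hence bimorphisms are the same as functors out of C_|> \<times> N.  Read for the
  tensor product this gives C^- \<otimes> N \<cong> C_|> \<times> N; read for the pair (application of a functor F to f,
  component of a transformation at X), it shows that evaluation is a functor, and decomposing
  (p, (X, fs)) as the composite of (p, (X, identities)) with the (id_{Ai}, (X, [fi])) gives its universal
  property.
*)

theory Submission
  imports Defs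
begin


section \<open>Permutations\<close>

text \<open>The combinatorial weight lies in \<open>block_perm\<close> and \<open>sum_perm\<close>,
  which describe how the symmetric action passes through a composite. They collapse as soon as one
  layer of the composite is unary, which is the situation that arrows of C create: over blocks of
  length one a block permutation is the original permutation, and transposing a matrix with a single
  column changes nothing. In full strength they serve to verify the laws of the constructed
  multicategories and to interpret terms.

  The two isomorphisms have different sources. An exponential is a universal property whose test
  multicategories live in types given by a parameter, so comparing two exponentials uses each of
  them at the types of both. The tensor product is a quotient of terms: functors out of it come from
  interpreting terms, and two of them are equal once they agree on generators. Hence one composite
  of the comparison functors is checked on generators only; the other one starts from C_|> \<times>
  N, which is not given by generators, and is computed on an arbitrary arrow.\<close>

lemma length_blocks [simp]: "length (blocks ms) = length ms"
  by (simp add: blocks_def)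

section \<open>Decomposition of an index interval into consecutive blocks\<close>

lemma sum_list_take_Suc:
  "k < length ms \<Longrightarrow> sum_list (take (Suc k) ms) = sum_list (take k ms) + (ms ! k :: nat)"
  by (simp add: take_Suc_conv_app_nth)

lemma map_length_blocks: "map length (blocks ms) = ms"
  by (rule nth_equalityI) (simp_all add: blocks_def sum_list_take_Suc)

lemma map_nth_interval:
  assumes "b \<le> length xs"
  shows "map ((!) xs) [a..<b] = take (b - a) (drop a xs)"
  using assms by (intro nth_equalityI) auto

text \<open>The \<open>k\<close>-th block starts at the total length of the first \<open>k\<close>
  lists, so looking its indices up in the concatenation returns the \<open>k\<close>-th list.
  Statements about \<open>blocks\<close> thereby transfer to arbitrary lists of the same
  lengths.\<close>

lemma map_map_nth_blocks:
  assumes "map length xss = ms"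
  shows "map (map ((!) (concat xss))) (blocks ms) = xss"
proof (rule nth_equalityI)
  show "length (map (map ((!) (concat xss))) (blocks ms)) = length xss"
    using assms by auto
  fix k assume "k < length (map (map ((!) (concat xss))) (blocks ms))"
  then have k: "k < length ms" "k < length xss" using assms by auto
  have split: "concat xss = concat (take k xss) @ xss ! k @ concat (drop (Suc k) xss)"
    using k(2) by (metis id_take_nth_drop concat.simps(2) concat_append)
  have len: "sum_list (take k ms) = length (concat (take k xss))"
    using assms[symmetric] by (simp add: length_concat take_map)
  have len': "sum_list (take (Suc k) ms) = length (concat (take k xss)) + length (xss ! k)"
    using k len assms sum_list_take_Suc by auto
  have "map (map ((!) (concat xss))) (blocks ms) ! k =
      map ((!) (concat xss)) [sum_list (take k ms)..<sum_list (take (Suc k) ms)]"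
    using k by (simp add: blocks_def)
  also have "\<dots> = xss ! k"
    by (subst map_nth_interval) (simp_all add: len len' split)
  finally show "map (map ((!) (concat xss))) (blocks ms) ! k = xss ! k" .
qed

lemma concat_blocks: "concat (blocks ms) = [0..<sum_list ms]"
proof -
  \<comment> \<open>The claim concerns prefixes of length \<open>n\<close> instead of
    \<open>ms\<close> itself: the induction then appends one interval at the right end and leaves
    \<open>ms\<close> fixed.\<close>
  have "concat (map (\<lambda>k. [sum_list (take k ms)..<sum_list (take (Suc k) ms)]) [0..<n]) =
      [0..<sum_list (take n ms)]" if "n \<le> length ms" for n
    using that
  proof (induction n)
    case (Suc n)
    then show ?case
      using upt_add_eq_append[of 0 "sum_list (take n ms)" "ms ! n"]
      by (simp add: sum_list_take_Suc)
  qed simp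
  from this[of "length ms"] show ?thesis by (simp add: blocks_def)
qed

text \<open>Equality of multisets packs the three facts that make a list of indices a permutation:
  its length is \<open>n\<close>, it has no repetitions, and its entries are exactly the numbers
  below \<open>n\<close>.\<close>

lemma perm_of_list_permutes:
  assumes "mset ks = mset [0..<n]"
  shows "perm_of_list ks permutes {..<n}"
proof (rule bij_imp_permutes)
  have len: "length ks = n" using mset_eq_length[OF assms] by simp
  have dist: "distinct ks" using mset_eq_imp_distinct_iff[OF assms] by simp
  have set: "set ks = {..<n}" using mset_eq_setD[OF assms] by (simp add: lessThan_atLeast0)
  have "bij_betw ((!) ks) {..<n} {..<n}"
    using bij_betw_nth[OF dist] len set by simp
  then show "bij_betw (perm_of_list ks) {..<n} {..<n}"
    by (rule iffD1[OF bij_betw_cong, rotated]) (simp add: perm_of_list_def len)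
  show "\<And>x. x \<notin> {..<n} \<Longrightarrow> perm_of_list ks x = x"
    by (simp add: perm_of_list_def len)
qed

lemma permute_list_perm_of_list:
  "length ks = length xs \<Longrightarrow> permute_list (perm_of_list ks) xs = map ((!) xs) ks"
  by (auto simp: permute_list_def perm_of_list_def intro!: nth_equalityI)

lemma mset_concat_cong: "list_all2 (\<lambda>xs ys. mset xs = mset ys) xss yss \<Longrightarrow>
    mset (concat xss) = mset (concat yss)"
  by (induction rule: list_all2_induct) auto

lemma mset_concat_permute_list:
  "s permutes {..<length xss} \<Longrightarrow> mset (concat (permute_list s xss)) = mset (concat xss)"
  by (simp add: mset_concat flip: sum_mset_sum_list)

lemma mset_concat_map2_permute_list:
  assumes "list_all2 (\<lambda>s m. s permutes {..<m}) ss (map length xss)"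
  shows "mset (concat (map2 permute_list ss xss)) = mset (concat xss)"
  using assms
  by (intro mset_concat_cong) (auto simp: list_all2_conv_all_nth intro!: mset_permute_list)

text \<open>Reordering blocks keeps the multiset of all indices, and the blocks in their original
  order concatenate to \<open>[0..<sum_list ms]\<close>.\<close>

lemma block_perm_permutes:
  assumes "s permutes {..<length ms}"
  shows "block_perm s ms permutes {..<sum_list ms}"
  unfolding block_perm_def
  using mset_concat_permute_list[of s "blocks ms"] assms
  by (intro perm_of_list_permutes) (simp add: concat_blocks)

lemma sum_perm_permutes:
  assumes "list_all2 (\<lambda>s m. s permutes {..<m}) ss ms"
  shows "sum_perm ss ms permutes {..<sum_list ms}"
  unfolding sum_perm_def
  using mset_concat_map2_permute_list[of ss "blocks ms"] assms
  by (intro perm_of_list_permutes) (simp add: concat_blocks map_length_blocks)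

text \<open>Acting by an index list is lookup, and lookup commutes with concatenation as well as
  with reordering the blocks; \<open>map_map_nth_blocks\<close> then replaces the blocks of indices
  by the lists themselves.\<close>

lemma permute_list_block_perm:
  assumes "s permutes {..<length xss}"
  shows "permute_list (block_perm s (map length xss)) (concat xss) = concat (permute_list s xss)"
proof -
  let ?ms = "map length xss"
  have "length (concat (permute_list s (blocks ?ms))) = length (concat xss)"
    using mset_eq_length[OF mset_concat_permute_list[of s "blocks ?ms"]] assms
    by (simp add: concat_blocks length_concat)
  then have "permute_list (block_perm s ?ms) (concat xss) =
      concat (map (map ((!) (concat xss))) (permute_list s (blocks ?ms)))"
    by (simp add: block_perm_def permute_list_perm_of_list map_concat)
  also have "\<dots> = concat (permute_list s (map (map ((!) (concat xss))) (blocks ?ms)))"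
    using assms by (subst permute_list_map) simp_all
  finally show ?thesis by (simp only: map_map_nth_blocks)
qed

text \<open>The same principle with permutations inside the blocks: lookup is a map, and
  \<open>permute_list\<close> is natural with respect to maps.\<close>

lemma permute_list_sum_perm:
  assumes "list_all2 (\<lambda>s xs. s permutes {..<length xs}) ss xss"
  shows "permute_list (sum_perm ss (map length xss)) (concat xss) = concat (map2 permute_list ss xss)"
proof -
  let ?ms = "map length xss" and ?f = "map ((!) (concat xss))"
  have perms_len: "list_all2 (\<lambda>s m. s permutes {..<m}) ss (map length (blocks ?ms))"
    using assms by (simp only: map_length_blocks list_all2_map2)
  then have perms: "list_all2 (\<lambda>s xs. s permutes {..<length xs}) ss (blocks ?ms)"
    by (simp only: list_all2_map2)
  have "length (concat (map2 permute_list ss (blocks ?ms))) = length (concat xss)"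
    using mset_eq_length[OF mset_concat_map2_permute_list[OF perms_len]]
    by (simp add: concat_blocks length_concat)
  then have "permute_list (sum_perm ss ?ms) (concat xss) =
      concat (map ?f (map2 permute_list ss (blocks ?ms)))"
    by (simp add: sum_perm_def permute_list_perm_of_list map_concat)
  also have "map ?f (map2 permute_list ss (blocks ?ms)) =
      map2 permute_list ss (map ?f (blocks ?ms))"
    using perms
    by (intro nth_equalityI) (auto simp: list_all2_conv_all_nth permute_list_map[symmetric])
  finally show ?thesis by (simp only: map_map_nth_blocks)
qed

text \<open>The list \<open>[0..<n]\<close> records a permutation faithfully, since its permuted
  form has \<open>s i\<close> at position \<open>i\<close>. Identities between permutations can
  therefore be checked by their action on this one list.\<close>

lemma permutes_eqI:
  assumes "s permutes {..<n}" "t permutes {..<n}"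
    and "permute_list s [0..<n] = permute_list t [0..<n]"
  shows "s = t"
proof
  fix i
  show "s i = t i"
  proof (cases "i < n")
    case True
    then have "s i < n" "t i < n" using assms(1,2) by (auto dest: permutes_in_image)
    with True show ?thesis
      using arg_cong[OF assms(3), of "\<lambda>xs. xs ! i"] assms(1,2) by (simp add: permute_list_nth)
  next
    case False
    then show ?thesis using assms(1,2) by (simp add: permutes_not_in)
  qed
qed

text \<open>For blocks of length one, moving blocks is moving entries. This is what lets a
  permutation of unary inputs pass through a composite unchanged.\<close>

lemma block_perm_replicate_1:
  assumes "s permutes {..<n}"
  shows "block_perm s (replicate n (Suc 0)) = s"
proof (rule permutes_eqI)
  show "block_perm s (replicate n (Suc 0)) permutes {..<n}"
    using block_perm_permutes[of s "replicate n (Suc 0)"] assms by (simp add: sum_list_replicate)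
  have "permute_list (block_perm s (map length (map (\<lambda>i. [i]) [0..<n]))) (concat (map (\<lambda>i. [i]) [0..<n])) =
      concat (permute_list s (map (\<lambda>i. [i]) [0..<n]))"
    by (rule permute_list_block_perm) (simp add: assms)
  also have "\<dots> = permute_list s [0..<n]"
    using assms by (simp add: permute_list_map)
  finally show "permute_list (block_perm s (replicate n (Suc 0))) [0..<n] = permute_list s [0..<n]"
    by (simp add: comp_def map_replicate_const)
qed (rule assms)

text \<open>With a single inner arrow there is only one block, the whole interval; this gives
  \<open>unary_comp_act\<close>.\<close>

lemma sum_perm_singleton:
  assumes "s permutes {..<n}"
  shows "sum_perm [s] [n] = s"
proof (rule permutes_eqI)
  show "sum_perm [s] [n] permutes {..<n}"
    using sum_perm_permutes[of "[s]" "[n]"] assms by simp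
  show "permute_list (sum_perm [s] [n]) [0..<n] = permute_list s [0..<n]"
    using permute_list_sum_perm[of "[s]" "[[0..<n]]"] assms by simp
qed (rule assms)

text \<open>A matrix with one column is read off in the same order by rows and by columns. With an
  arrow of \<open>C\<^sup>-\<close> in the role of \<open>f\<close>, naturality and interchange thus
  lose their permutation.\<close>

lemma transpose_perm_1 [simp]: "transpose_perm n (Suc 0) = id"
  by (auto simp: transpose_perm_def perm_of_list_def fun_eq_iff)

lemma permutes_lessThan_1 [simp]: "s permutes {..<Suc 0} \<longleftrightarrow> s = id"
  by (auto simp: lessThan_Suc permutes_sing)

section \<open>Permuted, zipped and concatenated lists\<close>

lemma permute_list_replicate:
  "s permutes {..<n} \<Longrightarrow> permute_list s (replicate n x) = replicate n x"
  by (auto simp: permute_list_nth permutes_in_image[of s "{..<n}", simplified] intro!: nth_equalityI)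

lemma permute_list_map2:
  assumes "s permutes {..<length xs}" "length ys = length xs"
  shows "permute_list s (map2 f xs ys) = map2 f (permute_list s xs) (permute_list s ys)"
  using assms by (simp add: permute_list_map permute_list_zip)

lemma map2_concat:
  assumes "list_all2 (\<lambda>xs ys. length xs = length ys) xss yss"
  shows "map2 f (concat xss) (concat yss) = concat (map2 (map2 f) xss yss)"
  using assms by (induction rule: list_all2_induct) auto

lemma zip_concat:
  assumes "list_all2 (\<lambda>xs ys. length xs = length ys) xss yss"
  shows "zip (concat xss) (concat yss) = concat (map2 zip xss yss)"
  using assms by (induction rule: list_all2_induct) auto

text \<open>Serves to lift a list of equivalence classes to a list of terms, with one preimage
  chosen per entry.\<close>

lemma set_subset_imageE:
  assumes "set ys \<subseteq> f ` A"
  obtains xs where "set xs \<subseteq> A" "ys = map f xs"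
proof -
  have "ys \<in> lists (f ` A)" using assms by auto
  then show ?thesis using that by (auto simp: lists_image)
qed


section \<open>Symmetric multicategories and functors\<close>

lemma composable_length: "composable M f gs \<Longrightarrow> length gs = arity M f"
  unfolding composable_def by (metis length_map)

lemma composable_arD: "composable M f gs \<Longrightarrow> f \<in> mar M"
  by (simp add: composable_def)

lemma composable_ar_nthD: "composable M f gs \<Longrightarrow> i < length gs \<Longrightarrow> gs ! i \<in> mar M"
  unfolding composable_def by (meson nth_mem subsetD)

lemma composable_cod_nthD: "composable M f gs \<Longrightarrow> i < length gs \<Longrightarrow> mcod M (gs ! i) = mdom M f ! i"
  unfolding composable_def by (metis nth_map)

lemma composable_unary:
  "composable M f [g] \<longleftrightarrow> f \<in> mar M \<and> g \<in> mar M \<and> mdom M f = [mcod M g]"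
  by (auto simp: composable_def)

section \<open>Associativity and equivariance when one layer is unary\<close>

context symmetric_multicategory
begin

lemma comp_mar: "composable M f gs \<Longrightarrow> mcomp M f gs \<in> mar M"
  and comp_mdom: "composable M f gs \<Longrightarrow> mdom M (mcomp M f gs) = concat (map (mdom M) gs)"
  and comp_mcod: "composable M f gs \<Longrightarrow> mcod M (mcomp M f gs) = mcod M f"
  using comp_ar by blast+

lemma id_mar: "A \<in> mob M \<Longrightarrow> mid M A \<in> mar M"
  and id_mdom: "A \<in> mob M \<Longrightarrow> mdom M (mid M A) = [A]"
  using id_ar by blast+

lemma act_mar: "f \<in> mar M \<Longrightarrow> s permutes {..<arity M f} \<Longrightarrow> mact M s f \<in> mar M"
  and act_mdom: "f \<in> mar M \<Longrightarrow> s permutes {..<arity M f} \<Longrightarrow>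
    mdom M (mact M s f) = permute_list s (mdom M f)"
  and act_mcod: "f \<in> mar M \<Longrightarrow> s permutes {..<arity M f} \<Longrightarrow> mcod M (mact M s f) = mcod M f"
  using act_ar by blast+

lemma dom_nth_ob: "f \<in> mar M \<Longrightarrow> i < arity M f \<Longrightarrow> mdom M f ! i \<in> mob M"
  using dom_ob nth_mem by blast

lemma composable_ids: "f \<in> mar M \<Longrightarrow> composable M f (map (mid M) (mdom M f))"
  using dom_ob by (force simp: composable_def id_ar intro!: map_idI)

lemma composable_id: "f \<in> mar M \<Longrightarrow> composable M (mid M (mcod M f)) [f]"
  by (simp add: composable_unary id_ar cod_ob)

text \<open>Associativity for an inner layer of one-element lists: their concatenation is
  \<open>hs\<close> itself, so no regrouping is visible. Naturality of composite families and the
  composition law for pairings both use this form.\<close>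

lemma comp_comp_unary:
  assumes "composable M f gs" "list_all2 (\<lambda>g h. composable M g [h]) gs hs"
  shows "mcomp M (mcomp M f gs) hs = mcomp M f (map2 (\<lambda>g h. mcomp M g [h]) gs hs)"
proof -
  have "list_all2 (composable M) gs (map (\<lambda>h. [h]) hs)"
    using assms(2) by (simp add: list_all2_map2)
  from assoc[OF assms(1) this] show ?thesis
    by (simp add: zip_map2 case_prod_unfold comp_def)
qed

lemma unary_comp_comp:
  assumes "composable M h [f]" "composable M f gs"
  shows "mcomp M (mcomp M h [f]) gs = mcomp M h [mcomp M f gs]"
  using assoc[of h "[f]" "[gs]"] assms by simp

lemma unary_comp_act:
  assumes "composable M h [f]" "s permutes {..<arity M f}"
  shows "mcomp M h [mact M s f] = mact M s (mcomp M h [f])"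
  using equivariant_inner[of h "[f]" "[s]"] assms by (simp add: sum_perm_singleton)

text \<open>All blocks have length one, so the block permutation in \<open>equivariant_outer\<close>
  is \<open>s\<close> itself by \<open>block_perm_replicate_1\<close>.\<close>

lemma act_comp_unary:
  assumes "composable M f gs" "s permutes {..<length gs}" "\<forall>g \<in> set gs. arity M g = 1"
  shows "mcomp M (mact M s f) (permute_list s gs) = mact M s (mcomp M f gs)"
proof -
  have "map (arity M) gs = replicate (length gs) (Suc 0)"
    using assms(3) by (intro replicate_eqI) auto
  then show ?thesis
    using equivariant_outer[OF assms(1,2)] assms(2) by (simp add: block_perm_replicate_1)
qed

end

section \<open>Symmetric functors, their identities and composition\<close>

lemma symmetric_functorsI:
  assumes "fob F \<in> extensional (mob M)" "far F \<in> extensional (mar M)"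
    and "\<And>A. A \<in> mob M \<Longrightarrow> fob F A \<in> mob N"
    and "\<And>f. f \<in> mar M \<Longrightarrow> far F f \<in> mar N"
    and "\<And>f. f \<in> mar M \<Longrightarrow> mdom N (far F f) = map (fob F) (mdom M f)"
    and "\<And>f. f \<in> mar M \<Longrightarrow> mcod N (far F f) = fob F (mcod M f)"
    and "\<And>A. A \<in> mob M \<Longrightarrow> far F (mid M A) = mid N (fob F A)"
    and "\<And>f gs. composable M f gs \<Longrightarrow> far F (mcomp M f gs) = mcomp N (far F f) (map (far F) gs)"
    and "\<And>f s. f \<in> mar M \<Longrightarrow> s permutes {..<arity M f} \<Longrightarrow> far F (mact M s f) = mact N s (far F f)"
  shows "F \<in> symmetric_functors M N"
  using assms by (simp add: symmetric_functors_def PiE_def)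

context
  fixes M N F
  assumes F: "F \<in> symmetric_functors M N"
begin

lemma functor_ob: "A \<in> mob M \<Longrightarrow> fob F A \<in> mob N"
  and functor_mar: "f \<in> mar M \<Longrightarrow> far F f \<in> mar N"
  and functor_mdom: "f \<in> mar M \<Longrightarrow> mdom N (far F f) = map (fob F) (mdom M f)"
  and functor_mcod: "f \<in> mar M \<Longrightarrow> mcod N (far F f) = fob F (mcod M f)"
  and functor_mid: "A \<in> mob M \<Longrightarrow> far F (mid M A) = mid N (fob F A)"
  and functor_mcomp: "composable M f gs \<Longrightarrow> far F (mcomp M f gs) = mcomp N (far F f) (map (far F) gs)"
  and functor_mact: "f \<in> mar M \<Longrightarrow> s permutes {..<arity M f} \<Longrightarrow> far F (mact M s f) = mact N s (far F f)"
  and functor_fob_ext: "fob F \<in> extensional (mob M)"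
  and functor_far_ext: "far F \<in> extensional (mar M)"
  using F by (auto simp: symmetric_functors_def PiE_def)

lemma functor_composable:
  assumes "composable M f gs"
  shows "composable N (far F f) (map (far F) gs)"
proof -
  have "set gs \<subseteq> mar M"
    using assms by (simp add: composable_def)
  then have "map (mcod N) (map (far F) gs) = map (fob F) (map (mcod M) gs)"
    by (auto simp: functor_mcod subset_iff)
  also have "\<dots> = mdom N (far F f)"
    using assms by (simp add: composable_def functor_mdom)
  finally show ?thesis
    using assms unfolding composable_def by (auto simp: functor_mar subset_iff simp del: map_map)
qed

end

text \<open>Both functors are \<open>undefined\<close> outside the source, so agreement on its
  objects and arrows already gives equality of the records.\<close>

lemma functor_eqI:
  assumes "F \<in> symmetric_functors M N" "G \<in> symmetric_functors M N'"
    and "\<And>A. A \<in> mob M \<Longrightarrow> fob F A = fob G A"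
    and "\<And>f. f \<in> mar M \<Longrightarrow> far F f = far G f"
  shows "F = G"
proof (rule mfunctor.equality)
  show "fob F = fob G"
    by (rule extensionalityI[OF functor_fob_ext[OF assms(1)] functor_fob_ext[OF assms(2)] assms(3)])
  show "far F = far G"
    by (rule extensionalityI[OF functor_far_ext[OF assms(1)] functor_far_ext[OF assms(2)] assms(4)])
qed simp

lemma functor_id_simps [simp]:
  "A \<in> mob M \<Longrightarrow> fob (functor_id M) A = A"
  "f \<in> mar M \<Longrightarrow> far (functor_id M) f = f"
  by (simp_all add: functor_id_def)

lemma functor_comp_simps [simp]:
  "A \<in> mob M \<Longrightarrow> fob (functor_comp M G F) A = fob G (fob F A)"
  "f \<in> mar M \<Longrightarrow> far (functor_comp M G F) f = far G (far F f)"
  by (simp_all add: functor_comp_def)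

lemma functor_id_in:
  assumes "symmetric_multicategory M"
  shows "functor_id M \<in> symmetric_functors M M"
proof -
  interpret symmetric_multicategory M by fact
  show ?thesis
  proof (rule symmetric_functorsI)
    fix f gs assume "composable M f gs"
    then show "far (functor_id M) (mcomp M f gs) =
        mcomp M (far (functor_id M) f) (map (far (functor_id M)) gs)"
      by (auto simp: comp_ar composable_def subset_iff intro!: arg_cong[of _ _ "mcomp M f"] map_idI[symmetric])
  qed (use dom_ob in \<open>auto simp: functor_id_def cod_ob id_ar act_ar subset_iff intro!: map_idI[symmetric]\<close>)
qed

lemma functor_comp_in:
  assumes "symmetric_multicategory M"
    and "F \<in> symmetric_functors M N" "G \<in> symmetric_functors N K"
  shows "functor_comp M G F \<in> symmetric_functors M K"
proof -
  interpret symmetric_multicategory M by fact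
  note F = functor_ob[OF assms(2)] functor_mar[OF assms(2)] functor_mdom[OF assms(2)]
    functor_mcod[OF assms(2)] functor_mid[OF assms(2)] functor_mcomp[OF assms(2)] functor_mact[OF assms(2)]
  note G = functor_ob[OF assms(3)] functor_mar[OF assms(3)] functor_mdom[OF assms(3)]
    functor_mcod[OF assms(3)] functor_mid[OF assms(3)] functor_mcomp[OF assms(3)] functor_mact[OF assms(3)]
  show ?thesis
  proof (rule symmetric_functorsI)
    fix f gs assume fgs: "composable M f gs"
    then have far_gs: "map (far (functor_comp M G F)) gs = map (far G) (map (far F) gs)"
      by (auto simp: composable_def subset_iff)
    show "far (functor_comp M G F) (mcomp M f gs) =
        mcomp K (far (functor_comp M G F) f) (map (far (functor_comp M G F)) gs)"
      unfolding far_gs using fgs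
      by (simp add: comp_mar F G functor_composable[OF assms(2)] composable_arD)
  next
    fix f assume "f \<in> mar M"
    then show "mdom K (far (functor_comp M G F) f) = map (fob (functor_comp M G F)) (mdom M f)"
      using dom_ob by (auto simp: F G subset_iff)
  qed (auto simp: functor_comp_def F G cod_ob id_ar act_ar)
qed

lemma functor_comp_id:
  assumes "F \<in> symmetric_functors M N"
  shows "functor_comp M F (functor_id M) = F" and "functor_comp M (functor_id N) F = F"
  using functor_fob_ext[OF assms] functor_far_ext[OF assms]
  by (auto intro!: mfunctor.equality extensionalityI[of _ "mob M"] extensionalityI[of _ "mar M"]
      simp: functor_ob[OF assms] functor_mar[OF assms])
    (simp_all add: functor_comp_def)

lemma functor_comp_assoc:
  assumes "F \<in> symmetric_functors M N"
  shows "functor_comp M (functor_comp N H G) F = functor_comp M H (functor_comp M G F)"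
  by (auto simp: functor_comp_def functor_ob[OF assms] functor_mar[OF assms])

section \<open>Isomorphisms of symmetric multicategories\<close>

lemma isomorphic_sym: "M \<cong>\<^sub>m N \<Longrightarrow> N \<cong>\<^sub>m M"
  unfolding isomorphic_def by blast

lemma isomorphic_trans:
  assumes "M \<cong>\<^sub>m N" "N \<cong>\<^sub>m K"
  shows "M \<cong>\<^sub>m K"
proof -
  have mcats: "symmetric_multicategory M" "symmetric_multicategory N" "symmetric_multicategory K"
    using assms by (auto simp: isomorphic_def)
  obtain F G where FG: "F \<in> symmetric_functors M N" "G \<in> symmetric_functors N M"
    "functor_comp M G F = functor_id M" "functor_comp N F G = functor_id N"
    using assms(1) by (auto simp: isomorphic_def)
  obtain F' G' where FG': "F' \<in> symmetric_functors N K" "G' \<in> symmetric_functors K N"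
    "functor_comp N G' F' = functor_id N" "functor_comp K F' G' = functor_id K"
    using assms(2) by (auto simp: isomorphic_def)
  have "functor_comp M (functor_comp K G G') (functor_comp M F' F) = functor_id M"
    using FG FG' functor_comp_in[OF mcats(1) FG(1) FG'(1)]
    by (simp add: functor_comp_assoc functor_comp_id flip: functor_comp_assoc[OF FG(1), of G'])
  moreover have "functor_comp K (functor_comp M F' F) (functor_comp K G G') = functor_id K"
    using FG FG' functor_comp_in[OF mcats(3) FG'(2) FG(2)]
    by (simp add: functor_comp_assoc functor_comp_id flip: functor_comp_assoc[OF FG'(2), of F])
  ultimately show ?thesis
    unfolding isomorphic_def
    using mcats functor_comp_in[OF mcats(1) FG(1) FG'(1)] functor_comp_in[OF mcats(3) FG'(2) FG(2)]
    by blast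
qed

text \<open>The inverse maps inherit every structural identity: apply \<open>F\<close>, use that
  \<open>F\<close> preserves the structure, and cancel by injectivity.\<close>

lemma isomorphicI_bij:
  assumes "symmetric_multicategory M" "symmetric_multicategory N" and F: "F \<in> symmetric_functors M N"
    and ob: "bij_betw (fob F) (mob M) (mob N)" and ar: "bij_betw (far F) (mar M) (mar N)"
  shows "M \<cong>\<^sub>m N"
proof -
  interpret M: symmetric_multicategory M by fact
  interpret N: symmetric_multicategory N by fact
  note F_simps = functor_ob[OF F] functor_mar[OF F] functor_mdom[OF F]
    functor_mcod[OF F] functor_mid[OF F] functor_mcomp[OF F] functor_mact[OF F]
  define go where "go = inv_into (mob M) (fob F)"
  define ga where "ga = inv_into (mar M) (far F)"
  define G where "G = \<lparr>fob = restrict go (mob N), far = restrict ga (mar N)\<rparr>"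
  have go: "go B \<in> mob M" "fob F (go B) = B" if "B \<in> mob N" for B
    using that ob unfolding go_def
    by (auto simp: bij_betw_def inv_into_into f_inv_into_f)
  have go_F: "go (fob F A) = A" if "A \<in> mob M" for A
    using that ob unfolding go_def by (simp add: bij_betw_def)
  have ga: "ga g \<in> mar M" "far F (ga g) = g" if "g \<in> mar N" for g
    using that ar unfolding ga_def
    by (auto simp: bij_betw_def inv_into_into f_inv_into_f)
  have ga_F: "ga (far F f) = f" if "f \<in> mar M" for f
    using that ar unfolding ga_def by (simp add: bij_betw_def)
  have ga_dom: "mdom M (ga g) = map go (mdom N g)" if "g \<in> mar N" for g
  proof -
    have "map go (mdom N g) = map go (map (fob F) (mdom M (ga g)))"
      using F_simps(3)[of "ga g"] ga that by simp
    also have "\<dots> = mdom M (ga g)"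
      using M.dom_ob[OF ga(1)[OF that]] by (auto intro!: map_idI simp: go_F subset_iff)
    finally show ?thesis ..
  qed
  have ga_cod: "mcod M (ga g) = go (mcod N g)" if "g \<in> mar N" for g
    using F_simps(4)[of "ga g"] ga[OF that] by (metis M.cod_ob go_F)
  have "G \<in> symmetric_functors N M"
  proof (rule symmetric_functorsI)
    fix f gs assume fgs: "composable N f gs"
    have far_gs: "far G f = ga f" "map (far G) gs = map ga gs"
      using fgs by (auto simp: composable_def G_def)
    have gs: "set gs \<subseteq> mar N"
      using fgs by (simp add: composable_def)
    then have "map (mcod M) (map ga gs) = map go (map (mcod N) gs)"
      by (auto simp: ga_cod subset_iff)
    also have "\<dots> = mdom M (ga f)"
      using fgs by (simp add: composable_def ga_dom)
    finally have comp: "composable M (ga f) (map ga gs)"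
      using gs composable_arD[OF fgs] unfolding composable_def
      by (auto simp: ga subset_iff simp del: map_map)
    have "map (far F) (map ga gs) = gs"
      using fgs by (auto simp: composable_def ga subset_iff intro!: map_idI)
    then have "far F (mcomp M (ga f) (map ga gs)) = mcomp N f gs"
      using F_simps(6)[OF comp] ga composable_arD[OF fgs] by simp
    then have "ga (mcomp N f gs) = mcomp M (ga f) (map ga gs)"
      using ga_F[OF M.comp_mar[OF comp]] by simp
    then show "far G (mcomp N f gs) = mcomp M (far G f) (map (far G) gs)"
      using N.comp_mar[OF fgs] unfolding far_gs by (simp add: G_def)
  next
    fix f s assume fs: "f \<in> mar N" "s permutes {..<arity N f}"
    then have fs': "ga f \<in> mar M" "s permutes {..<arity M (ga f)}"
      by (auto simp: ga ga_dom)
    then have "far F (mact M s (ga f)) = mact N s f"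
      using F_simps(7)[OF fs'] ga fs by simp
    then have "ga (mact N s f) = mact M s (ga f)"
      using ga_F[OF M.act_mar[OF fs']] by simp
    then show "far G (mact N s f) = mact M s (far G f)"
      using N.act_mar[OF fs] fs by (simp add: G_def)
  next
    fix A assume A: "A \<in> mob N"
    have "ga (mid N A) = mid M (go A)"
      using ga_F[OF M.id_mar[OF go(1)[OF A]]] F_simps(5)[OF go(1)[OF A]] go(2)[OF A] by simp
    then show "far G (mid N A) = mid M (fob G A)"
      using A N.id_mar[OF A] by (simp add: G_def)
  qed (use N.dom_ob in \<open>auto simp: G_def go ga ga_dom ga_cod N.cod_ob subset_iff\<close>)
  moreover have "functor_comp M G F = functor_id M"
    by (auto simp: functor_comp_def functor_id_def G_def go_F ga_F F_simps intro!: restrict_ext)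
  moreover have "functor_comp N F G = functor_id N"
    by (auto simp: functor_comp_def functor_id_def G_def go ga intro!: restrict_ext)
  ultimately show ?thesis
    using assms unfolding isomorphic_def by blast
qed


section \<open>Instances\<close>

lemma category_terminal_cat: "category terminal_cat"
  by unfold_locales (simp_all add: terminal_cat_def)

lemma category_cat_prod:
  assumes "category C" "category D"
  shows "category (cat_prod C D)"
proof -
  interpret C: category C by fact
  interpret D: category D by fact
  show ?thesis
    by unfold_locales
      (auto simp: cat_prod_def C.dom_ob C.cod_ob C.id_ar C.comp_ar C.id_left C.id_right C.assoc
        D.dom_ob D.cod_ob D.id_ar D.comp_ar D.id_left D.id_right D.assoc)
qed

section \<open>The multicategory of unary arrows\<close>

lemma unary_mcat_simps [simp]:
  "mob (C\<^sup>-) = cob C"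
  "mar (C\<^sup>-) = car C"
  "mdom (C\<^sup>-) f = [cdom C f]"
  "mcod (C\<^sup>-) f = ccod C f"
  "mid (C\<^sup>-) X = cid C X"
  "mcomp (C\<^sup>-) f gs = ccomp C f (hd gs)"
  "mact (C\<^sup>-) s f = f"
  by (simp_all add: unary_mcat_def)

lemma composable_unary_mcat:
  "composable (C\<^sup>-) f gs \<longleftrightarrow> (\<exists>g. gs = [g] \<and> f \<in> car C \<and> g \<in> car C \<and> ccod C g = cdom C f)"
  by (auto simp: composable_def map_eq_Cons_conv)

lemma symmetric_multicategory_unary_mcat:
  assumes "category C"
  shows "symmetric_multicategory (C\<^sup>-)"
proof -
  interpret category C by fact
  show ?thesis
  proof unfold_locales
    fix f gs hss
    assume "composable (C\<^sup>-) f gs" "list_all2 (composable (C\<^sup>-)) gs hss"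
    then show "mcomp (C\<^sup>-) (mcomp (C\<^sup>-) f gs) (concat hss) = mcomp (C\<^sup>-) f (map2 (mcomp (C\<^sup>-)) gs hss)"
      by (auto simp: composable_unary_mcat list_all2_Cons1 assoc)
  next
    fix f gs ss
    assume "composable (C\<^sup>-) f gs" "list_all2 (\<lambda>s g. s permutes {..<arity (C\<^sup>-) g}) ss gs"
    then show "mcomp (C\<^sup>-) f (map2 (mact (C\<^sup>-)) ss gs) =
        mact (C\<^sup>-) (sum_perm ss (map (arity (C\<^sup>-)) gs)) (mcomp (C\<^sup>-) f gs)"
      by (auto simp: composable_unary_mcat list_all2_Cons2)
  qed (auto simp: composable_unary_mcat dom_ob cod_ob id_ar comp_ar id_left id_right)
qed

section \<open>The multicategory of sequences\<close>

lemma sequence_mcat_simps [simp]: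
  "mob (C\<^sub>\<triangleright>) = cob C"
  "p \<in> mar (C\<^sub>\<triangleright>) \<longleftrightarrow> fst p \<in> cob C \<and> set (snd p) \<subseteq> car C \<and> (\<forall>f \<in> set (snd p). ccod C f = fst p)"
  "mdom (C\<^sub>\<triangleright>) p = map (cdom C) (snd p)"
  "mcod (C\<^sub>\<triangleright>) p = fst p"
  "mid (C\<^sub>\<triangleright>) X = (X, [cid C X])"
  "mcomp (C\<^sub>\<triangleright>) p qs = (fst p, concat (map2 (\<lambda>f q. map (ccomp C f) (snd q)) (snd p) qs))"
  "mact (C\<^sub>\<triangleright>) s p = (fst p, permute_list s (snd p))"
  by (auto simp: sequence_mcat_def case_prod_unfold)

lemma concat_concat: "concat (concat xsss) = concat (map concat xsss)"
  by (induction xsss) auto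

lemma composable_sequence_mcat_nthD:
  assumes "composable (C\<^sub>\<triangleright>) p qs" "i < length (snd p)"
  shows "fst (qs ! i) = cdom C (snd p ! i)" "snd p ! i \<in> car C" "ccod C (snd p ! i) = fst p"
    "\<And>g. g \<in> set (snd (qs ! i)) \<Longrightarrow> g \<in> car C \<and> ccod C g = cdom C (snd p ! i)"
proof -
  have len: "length qs = length (snd p)"
    using composable_length[OF assms(1)] by simp
  show *: "fst (qs ! i) = cdom C (snd p ! i)"
    using composable_cod_nthD[OF assms(1), of i] assms(2) len by simp
  show "snd p ! i \<in> car C" "ccod C (snd p ! i) = fst p"
    using composable_arD[OF assms(1)] assms(2) by auto
  show "g \<in> car C \<and> ccod C g = cdom C (snd p ! i)" if "g \<in> set (snd (qs ! i))" for g
    using composable_ar_nthD[OF assms(1), of i] assms(2) len that * by auto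
qed

text \<open>All laws hold row by row: the composite is the concatenation of the rows obtained by
  composing the \<open>i\<close>-th arrow with the \<open>i\<close>-th sequence. The rows have the
  lengths of the sequences in \<open>qs\<close>, so the permutation laws are those of
  \<open>permute_list\<close> on concatenations, and associativity reduces to that of
  \<open>C\<close>.\<close>

lemma symmetric_multicategory_sequence_mcat:
  assumes "category C"
  shows "symmetric_multicategory (C\<^sub>\<triangleright>)"
proof -
  interpret category C by fact
  let ?comp = "map2 (\<lambda>f q. map (ccomp C f) (snd q))"
  have comp_ar': "mcomp (C\<^sub>\<triangleright>) p qs \<in> mar (C\<^sub>\<triangleright>) \<and>
      mdom (C\<^sub>\<triangleright>) (mcomp (C\<^sub>\<triangleright>) p qs) = concat (map (mdom (C\<^sub>\<triangleright>)) qs) \<and>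
      mcod (C\<^sub>\<triangleright>) (mcomp (C\<^sub>\<triangleright>) p qs) = mcod (C\<^sub>\<triangleright>) p"
    if "composable (C\<^sub>\<triangleright>) p qs" for p qs
  proof -
    note nth = composable_sequence_mcat_nthD[OF that]
    have len: "length qs = length (snd p)"
      using composable_length[OF that] by simp
    have "fst p \<in> cob C"
      using composable_arD[OF that] by simp
    moreover have "g \<in> car C \<and> ccod C g = fst p" if g: "g \<in> set (concat (?comp (snd p) qs))" for g
    proof -
      obtain i x where i: "i < length (snd p)" "x \<in> set (snd (qs ! i))" "g = ccomp C (snd p ! i) x"
        using g by (fastforce simp: in_set_zip)
      then show ?thesis
        using nth(2,3)[OF i(1)] nth(4)[OF i(1,2)] comp_ar[of "snd p ! i" x] by simp
    qed
    moreover have "map (map (cdom C)) (?comp (snd p) qs) = map (mdom (C\<^sub>\<triangleright>)) qs"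
      by (rule nth_equalityI) (auto simp: len nth comp_ar)
    then have "map (cdom C) (concat (?comp (snd p) qs)) = concat (map (mdom (C\<^sub>\<triangleright>)) qs)"
      by (simp only: map_concat)
    ultimately show ?thesis
      unfolding sequence_mcat_simps fst_conv snd_conv by blast
  qed
  show ?thesis
  proof unfold_locales
    fix p qs assume "composable (C\<^sub>\<triangleright>) p qs"
    then show "mcomp (C\<^sub>\<triangleright>) p qs \<in> mar (C\<^sub>\<triangleright>) \<and>
        mdom (C\<^sub>\<triangleright>) (mcomp (C\<^sub>\<triangleright>) p qs) = concat (map (mdom (C\<^sub>\<triangleright>)) qs) \<and>
        mcod (C\<^sub>\<triangleright>) (mcomp (C\<^sub>\<triangleright>) p qs) = mcod (C\<^sub>\<triangleright>) p"
      by (rule comp_ar')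
  next
    fix p assume "p \<in> mar (C\<^sub>\<triangleright>)"
    then have "map (ccomp C (cid C (fst p))) (snd p) = snd p"
      by (auto intro!: map_idI simp: subset_iff) (metis id_left)
    then show "mcomp (C\<^sub>\<triangleright>) (mid (C\<^sub>\<triangleright>) (mcod (C\<^sub>\<triangleright>) p)) [p] = p"
      by simp
  next
    fix p assume "p \<in> mar (C\<^sub>\<triangleright>)"
    then have "?comp (snd p) (map (mid (C\<^sub>\<triangleright>)) (mdom (C\<^sub>\<triangleright>) p)) = map (\<lambda>f. [f]) (snd p)"
      by (intro nth_equalityI) (auto simp: id_right subset_iff)
    then have "concat (?comp (snd p) (map (mid (C\<^sub>\<triangleright>)) (mdom (C\<^sub>\<triangleright>) p))) = snd p"
      by (simp only: concat_map_singleton map_ident)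
    then show "mcomp (C\<^sub>\<triangleright>) p (map (mid (C\<^sub>\<triangleright>)) (mdom (C\<^sub>\<triangleright>) p)) = p"
      by (simp only: sequence_mcat_simps prod.collapse)
  next
    fix p qs rss
    assume pqs: "composable (C\<^sub>\<triangleright>) p qs" and qrs: "list_all2 (composable (C\<^sub>\<triangleright>)) qs rss"
    note nth = composable_sequence_mcat_nthD[OF pqs]
    have len: "length qs = length (snd p)" "length rss = length (snd p)"
      using composable_length[OF pqs] qrs by (simp_all add: list_all2_conv_all_nth)
    have qrs_nth: "composable (C\<^sub>\<triangleright>) (qs ! i) (rss ! i)" if "i < length (snd p)" for i
      using qrs that by (simp add: list_all2_conv_all_nth len)
    \<comment> \<open>Row \<open>i\<close> is as long as \<open>rss ! i\<close>, which allows
      \<open>map2\<close> to be distributed over the two concatenations.\<close>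
    have "list_all2 (\<lambda>xs ys. length xs = length ys) (?comp (snd p) qs) rss"
      by (simp add: list_all2_conv_all_nth len composable_length[OF qrs_nth])
    then have "concat (?comp (concat (?comp (snd p) qs)) (concat rss)) =
        concat (map concat (map2 ?comp (?comp (snd p) qs) rss))"
      by (simp only: map2_concat concat_concat)
    also have "map concat (map2 ?comp (?comp (snd p) qs) rss) =
        ?comp (snd p) (map2 (mcomp (C\<^sub>\<triangleright>)) qs rss)"
    proof (rule nth_equalityI)
      fix i assume "i < length (map concat (map2 ?comp (?comp (snd p) qs) rss))"
      then have i: "i < length (snd p)" by (simp add: len)
      have "?comp (map (ccomp C (snd p ! i)) (snd (qs ! i))) (rss ! i) =
          map (map (ccomp C (snd p ! i))) (?comp (snd (qs ! i)) (rss ! i))"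
      proof (rule nth_equalityI)
        fix j assume "j < length (?comp (map (ccomp C (snd p ! i)) (snd (qs ! i))) (rss ! i))"
        then have j: "j < length (snd (qs ! i))" "j < length (rss ! i)" by simp_all
        then have g: "snd (qs ! i) ! j \<in> car C" "ccod C (snd (qs ! i) ! j) = cdom C (snd p ! i)"
          using nth(4)[OF i] by simp_all
        have "ccomp C (ccomp C (snd p ! i) (snd (qs ! i) ! j)) h =
            ccomp C (snd p ! i) (ccomp C (snd (qs ! i) ! j) h)" if "h \<in> set (snd (rss ! i ! j))" for h
          using composable_sequence_mcat_nthD(4)[OF qrs_nth[OF i] j(1) that] nth(2)[OF i] g
          by (simp add: assoc)
        then show "?comp (map (ccomp C (snd p ! i)) (snd (qs ! i))) (rss ! i) ! j =
            map (map (ccomp C (snd p ! i))) (?comp (snd (qs ! i)) (rss ! i)) ! j"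
          using j by simp
      qed simp
      then show "map concat (map2 ?comp (?comp (snd p) qs) rss) ! i =
          ?comp (snd p) (map2 (mcomp (C\<^sub>\<triangleright>)) qs rss) ! i"
        using i by (simp add: len map_concat)
    qed (simp add: len)
    finally show "mcomp (C\<^sub>\<triangleright>) (mcomp (C\<^sub>\<triangleright>) p qs) (concat rss) =
        mcomp (C\<^sub>\<triangleright>) p (map2 (mcomp (C\<^sub>\<triangleright>)) qs rss)"
      by simp
  next
    fix p s assume "p \<in> mar (C\<^sub>\<triangleright>)" "s permutes {..<arity (C\<^sub>\<triangleright>) p}"
    then show "mact (C\<^sub>\<triangleright>) s p \<in> mar (C\<^sub>\<triangleright>) \<and>
        mdom (C\<^sub>\<triangleright>) (mact (C\<^sub>\<triangleright>) s p) = permute_list s (mdom (C\<^sub>\<triangleright>) p) \<and>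
        mcod (C\<^sub>\<triangleright>) (mact (C\<^sub>\<triangleright>) s p) = mcod (C\<^sub>\<triangleright>) p"
      by (simp add: permute_list_map)
  next
    fix p qs s assume pqs: "composable (C\<^sub>\<triangleright>) p qs" and s: "s permutes {..<length qs}"
    have len: "length qs = length (snd p)"
      using composable_length[OF pqs] by simp
    have "map length (?comp (snd p) qs) = map (arity (C\<^sub>\<triangleright>)) qs"
      by (rule nth_equalityI) (simp_all add: len)
    moreover have "?comp (permute_list s (snd p)) (permute_list s qs) = permute_list s (?comp (snd p) qs)"
      using s len by (simp add: permute_list_map2)
    ultimately show "mcomp (C\<^sub>\<triangleright>) (mact (C\<^sub>\<triangleright>) s p) (permute_list s qs) =
        mact (C\<^sub>\<triangleright>) (block_perm s (map (arity (C\<^sub>\<triangleright>)) qs)) (mcomp (C\<^sub>\<triangleright>) p qs)"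
      using permute_list_block_perm[of s "?comp (snd p) qs"] s len by simp
  next
    fix p qs ss
    assume pqs: "composable (C\<^sub>\<triangleright>) p qs"
      and ss: "list_all2 (\<lambda>s q. s permutes {..<arity (C\<^sub>\<triangleright>) q}) ss qs"
    have len: "length qs = length (snd p)" "length ss = length (snd p)"
      using composable_length[OF pqs] ss by (simp_all add: list_all2_conv_all_nth)
    have ss_nth: "ss ! i permutes {..<length (snd (qs ! i))}" if "i < length (snd p)" for i
      using ss that by (simp add: list_all2_conv_all_nth len)
    have "map length (?comp (snd p) qs) = map (arity (C\<^sub>\<triangleright>)) qs"
      by (rule nth_equalityI) (simp_all add: len)
    moreover have "?comp (snd p) (map2 (mact (C\<^sub>\<triangleright>)) ss qs) = map2 permute_list ss (?comp (snd p) qs)"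
      by (rule nth_equalityI) (simp_all add: len permute_list_map ss_nth)
    moreover have "list_all2 (\<lambda>s xs. s permutes {..<length xs}) ss (?comp (snd p) qs)"
      by (simp add: list_all2_conv_all_nth len ss_nth)
    ultimately show "mcomp (C\<^sub>\<triangleright>) p (map2 (mact (C\<^sub>\<triangleright>)) ss qs) =
        mact (C\<^sub>\<triangleright>) (sum_perm ss (map (arity (C\<^sub>\<triangleright>)) qs)) (mcomp (C\<^sub>\<triangleright>) p qs)"
      using permute_list_sum_perm[of ss "?comp (snd p) qs"] by simp
  qed (auto simp: dom_ob cod_ob id_ar permute_list_compose)
qed

section \<open>The cartesian product of symmetric multicategories\<close>

lemma smcat_prod_simps [simp]:
  "mob (M \<times>\<^sub>m N) = mob M \<times> mob N"
  "p \<in> mar (M \<times>\<^sub>m N) \<longleftrightarrow> fst p \<in> mar M \<and> snd p \<in> mar N \<and> arity M (fst p) = arity N (snd p)"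
  "mdom (M \<times>\<^sub>m N) p = zip (mdom M (fst p)) (mdom N (snd p))"
  "mcod (M \<times>\<^sub>m N) p = (mcod M (fst p), mcod N (snd p))"
  "mid (M \<times>\<^sub>m N) A = (mid M (fst A), mid N (snd A))"
  "mcomp (M \<times>\<^sub>m N) p qs = (mcomp M (fst p) (map fst qs), mcomp N (snd p) (map snd qs))"
  "mact (M \<times>\<^sub>m N) s p = (mact M s (fst p), mact N s (snd p))"
  by (auto simp: smcat_prod_def map_prod_def case_prod_unfold)

text \<open>The domain of a pair is a zip, and zipping truncates. Because the two components of
  \<open>p\<close> have equal arity, projecting the list of codomains of \<open>qs\<close> returns
  both domains in full.\<close>

lemma composable_smcat_prodD:
  assumes "composable (M \<times>\<^sub>m N) p qs"
  shows "composable M (fst p) (map fst qs)" "composable N (snd p) (map snd qs)"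
    "\<forall>q \<in> set qs. arity M (fst q) = arity N (snd q)"
proof -
  have *: "fst p \<in> mar M" "snd p \<in> mar N" "arity M (fst p) = arity N (snd p)"
    "set qs \<subseteq> mar (M \<times>\<^sub>m N)"
    and cod: "map (\<lambda>q. (mcod M (fst q), mcod N (snd q))) qs = zip (mdom M (fst p)) (mdom N (snd p))"
    using assms by (simp_all add: composable_def cong: map_cong)
  have "map (mcod M) (map fst qs) = mdom M (fst p)"
    using arg_cong[OF cod, of "map fst"] *(3) by (simp add: comp_def)
  moreover have "map (mcod N) (map snd qs) = mdom N (snd p)"
    using arg_cong[OF cod, of "map snd"] *(3) by (simp add: comp_def)
  ultimately show "composable M (fst p) (map fst qs)" "composable N (snd p) (map snd qs)"
    using * unfolding composable_def by (auto simp: subset_iff simp del: map_map)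
  show "\<forall>q \<in> set qs. arity M (fst q) = arity N (snd q)"
    using *(4) by auto
qed

text \<open>The laws hold in each factor; what has to be added concerns arities. Concatenating zips
  agrees with zipping concatenations because the lengths match entry by entry, and the same equality
  makes the permutations built from the arities coincide in both factors.\<close>

lemma symmetric_multicategory_smcat_prod:
  assumes "symmetric_multicategory M" "symmetric_multicategory N"
  shows "symmetric_multicategory (M \<times>\<^sub>m N)"
proof -
  interpret M: symmetric_multicategory M by fact
  interpret N: symmetric_multicategory N by fact
  show ?thesis
  proof unfold_locales
    fix p assume "p \<in> mar (M \<times>\<^sub>m N)"
    then show "set (mdom (M \<times>\<^sub>m N) p) \<subseteq> mob (M \<times>\<^sub>m N)"
      using M.dom_ob N.dom_ob by (fastforce dest: set_zip_leftD set_zip_rightD)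
  next
    fix p qs assume pqs: "composable (M \<times>\<^sub>m N) p qs"
    note MN = composable_smcat_prodD[OF pqs]
    have len: "list_all2 (\<lambda>xs ys. length xs = length ys) (map (mdom M) (map fst qs)) (map (mdom N) (map snd qs))"
      using MN(3) by (simp add: list_all2_conv_all_nth)
    have zip: "map2 zip (map (mdom M) (map fst qs)) (map (mdom N) (map snd qs)) =
        map (\<lambda>q. zip (mdom M (fst q)) (mdom N (snd q))) qs"
      by (rule nth_equalityI) simp_all
    have "length (concat (map (mdom M) (map fst qs))) = length (concat (map (mdom N) (map snd qs)))"
      using MN(3) by (simp add: length_concat comp_def cong: map_cong)
    then show "mcomp (M \<times>\<^sub>m N) p qs \<in> mar (M \<times>\<^sub>m N) \<and>
        mdom (M \<times>\<^sub>m N) (mcomp (M \<times>\<^sub>m N) p qs) = concat (map (mdom (M \<times>\<^sub>m N)) qs) \<and>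
        mcod (M \<times>\<^sub>m N) (mcomp (M \<times>\<^sub>m N) p qs) = mcod (M \<times>\<^sub>m N) p"
      using MN(1,2) zip_concat[OF len] zip
      by (simp add: M.comp_mar N.comp_mar M.comp_mdom N.comp_mdom M.comp_mcod N.comp_mcod cong: map_cong)
  next
    fix p assume p: "p \<in> mar (M \<times>\<^sub>m N)"
    then have "map (\<lambda>A. mid M (fst A)) (zip (mdom M (fst p)) (mdom N (snd p))) = map (mid M) (mdom M (fst p))"
      "map (\<lambda>A. mid N (snd A)) (zip (mdom M (fst p)) (mdom N (snd p))) = map (mid N) (mdom N (snd p))"
      by (auto intro!: nth_equalityI)
    then show "mcomp (M \<times>\<^sub>m N) p (map (mid (M \<times>\<^sub>m N)) (mdom (M \<times>\<^sub>m N) p)) = p"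
      using p by (simp add: comp_def M.id_right N.id_right)
  next
    fix p qs rss
    assume pqs: "composable (M \<times>\<^sub>m N) p qs" and qrs: "list_all2 (composable (M \<times>\<^sub>m N)) qs rss"
    note MN = composable_smcat_prodD[OF pqs]
    have len: "length rss = length qs" using qrs by (simp add: list_all2_conv_all_nth)
    have "list_all2 (composable M) (map fst qs) (map (map fst) rss)"
      "list_all2 (composable N) (map snd qs) (map (map snd) rss)"
      using qrs by (auto simp: list_all2_conv_all_nth dest: composable_smcat_prodD(1,2))
    note M.assoc[OF MN(1) this(1)] N.assoc[OF MN(2) this(2)]
    moreover have "map fst (map2 (mcomp (M \<times>\<^sub>m N)) qs rss) = map2 (mcomp M) (map fst qs) (map (map fst) rss)"
      "map snd (map2 (mcomp (M \<times>\<^sub>m N)) qs rss) = map2 (mcomp N) (map snd qs) (map (map snd) rss)"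
      by (auto intro!: nth_equalityI simp: len)
    ultimately show "mcomp (M \<times>\<^sub>m N) (mcomp (M \<times>\<^sub>m N) p qs) (concat rss) =
        mcomp (M \<times>\<^sub>m N) p (map2 (mcomp (M \<times>\<^sub>m N)) qs rss)"
      by (simp only: smcat_prod_simps fst_conv snd_conv map_concat)
  next
    fix p s assume "p \<in> mar (M \<times>\<^sub>m N)" "s permutes {..<arity (M \<times>\<^sub>m N) p}"
    then show "mact (M \<times>\<^sub>m N) s p \<in> mar (M \<times>\<^sub>m N) \<and>
        mdom (M \<times>\<^sub>m N) (mact (M \<times>\<^sub>m N) s p) = permute_list s (mdom (M \<times>\<^sub>m N) p) \<and>
        mcod (M \<times>\<^sub>m N) (mact (M \<times>\<^sub>m N) s p) = mcod (M \<times>\<^sub>m N) p"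
      by (simp add: M.act_ar N.act_ar permute_list_zip)
  next
    fix p qs s assume pqs: "composable (M \<times>\<^sub>m N) p qs" and s: "s permutes {..<length qs}"
    note MN = composable_smcat_prodD[OF pqs]
    have arity: "map (arity (M \<times>\<^sub>m N)) qs = map (arity M) (map fst qs)"
      "map (arity (M \<times>\<^sub>m N)) qs = map (arity N) (map snd qs)"
      using MN(3) by auto
    have "mcomp M (mact M s (fst p)) (map fst (permute_list s qs)) =
        mact M (block_perm s (map (arity (M \<times>\<^sub>m N)) qs)) (mcomp M (fst p) (map fst qs))"
      unfolding arity(1) using M.equivariant_outer[OF MN(1)] s by (simp add: permute_list_map)
    moreover have "mcomp N (mact N s (snd p)) (map snd (permute_list s qs)) =
        mact N (block_perm s (map (arity (M \<times>\<^sub>m N)) qs)) (mcomp N (snd p) (map snd qs))"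
      unfolding arity(2) using N.equivariant_outer[OF MN(2)] s by (simp add: permute_list_map)
    ultimately show "mcomp (M \<times>\<^sub>m N) (mact (M \<times>\<^sub>m N) s p) (permute_list s qs) =
        mact (M \<times>\<^sub>m N) (block_perm s (map (arity (M \<times>\<^sub>m N)) qs)) (mcomp (M \<times>\<^sub>m N) p qs)"
      by (simp del: map_map)
  next
    fix p qs ss
    assume pqs: "composable (M \<times>\<^sub>m N) p qs"
      and ss: "list_all2 (\<lambda>s q. s permutes {..<arity (M \<times>\<^sub>m N) q}) ss qs"
    note MN = composable_smcat_prodD[OF pqs]
    have arity: "map (arity (M \<times>\<^sub>m N)) qs = map (arity M) (map fst qs)"
      "map (arity (M \<times>\<^sub>m N)) qs = map (arity N) (map snd qs)"
      using MN(3) by auto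
    have "arity M (fst (qs ! i)) = arity N (snd (qs ! i))" if "i < length qs" for i
      using MN(3) that by simp
    then have "list_all2 (\<lambda>s q. s permutes {..<arity M q}) ss (map fst qs)"
      "list_all2 (\<lambda>s q. s permutes {..<arity N q}) ss (map snd qs)"
      using ss by (auto simp: list_all2_conv_all_nth)
    note M.equivariant_inner[OF MN(1) this(1), folded arity(1)]
      N.equivariant_inner[OF MN(2) this(2), folded arity(2)]
    moreover have "map fst (map2 (mact (M \<times>\<^sub>m N)) ss qs) = map2 (mact M) ss (map fst qs)"
      "map snd (map2 (mact (M \<times>\<^sub>m N)) ss qs) = map2 (mact N) ss (map snd qs)"
      by (auto intro!: nth_equalityI)
    ultimately show "mcomp (M \<times>\<^sub>m N) p (map2 (mact (M \<times>\<^sub>m N)) ss qs) =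
        mact (M \<times>\<^sub>m N) (sum_perm ss (map (arity (M \<times>\<^sub>m N)) qs)) (mcomp (M \<times>\<^sub>m N) p qs)"
      by (simp only: smcat_prod_simps fst_conv snd_conv)
  qed (auto simp: M.cod_ob N.cod_ob M.id_ar N.id_ar M.id_left N.id_left M.act_id N.act_id
      M.act_comp N.act_comp)
qed


section \<open>The internal hom out of a category\<close>

lemma internal_hom_simps:
  "mob (internal_hom M N) = symmetric_functors M N"
  "mdom (internal_hom M N) p = fst p"
  "mcod (internal_hom M N) p = fst (snd p)"
  "mid (internal_hom M N) F = ([F], F, \<lambda>A \<in> mob M. mid N (fob F A))"
  "mcomp (internal_hom M N) p qs = (concat (map fst qs), fst (snd p),
     \<lambda>A \<in> mob M. mcomp N (snd (snd p) A) (map (\<lambda>q. snd (snd q) A) qs))"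
  "mact (internal_hom M N) s p = (permute_list s (fst p), fst (snd p), \<lambda>A \<in> mob M. mact N s (snd (snd p) A))"
  by (simp_all add: internal_hom_def case_prod_unfold)

text \<open>The internal hom is studied for sources of the form \<open>C\<^sup>-\<close>. A functor
  then sends every arrow to a unary arrow, and naturality is an equation without
  permutation.\<close>

locale hom_from_category =
  C: category C + N: symmetric_multicategory N
  for C :: "('c, 'ca) cat" and N :: "('o, 'a) smcat"
begin

abbreviation H where "H \<equiv> internal_hom (C\<^sup>-) N"

lemma functor_simps:
  assumes "F \<in> symmetric_functors (C\<^sup>-) N"
  shows "X \<in> cob C \<Longrightarrow> fob F X \<in> mob N"
    and "f \<in> car C \<Longrightarrow> far F f \<in> mar N"
    and "f \<in> car C \<Longrightarrow> mdom N (far F f) = [fob F (cdom C f)]"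
    and "f \<in> car C \<Longrightarrow> mcod N (far F f) = fob F (ccod C f)"
    and "X \<in> cob C \<Longrightarrow> far F (cid C X) = mid N (fob F X)"
    and "\<lbrakk>f \<in> car C; g \<in> car C; ccod C g = cdom C f\<rbrakk> \<Longrightarrow>
      far F (ccomp C f g) = mcomp N (far F f) [far F g]"
  using functor_ob[OF assms] functor_mar[OF assms] functor_mdom[OF assms]
    functor_mcod[OF assms] functor_mid[OF assms] functor_mcomp[OF assms, of f "[g]"]
  by (auto simp: composable_unary)

text \<open>Both composites of the naturality square exist. Typing of the second one is what allows
  \<open>act_id\<close> to remove the trivial permutation in \<open>natural_family\<close>.\<close>

lemma natural_family_composable:
  assumes "set Fs \<subseteq> symmetric_functors (C\<^sup>-) N" "F \<in> symmetric_functors (C\<^sup>-) N"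
    and "\<And>X. X \<in> cob C \<Longrightarrow> \<alpha> X \<in> mar N \<and> mdom N (\<alpha> X) = map (\<lambda>G. fob G X) Fs \<and> mcod N (\<alpha> X) = fob F X"
    and "f \<in> car C"
  shows "composable N (far F f) [\<alpha> (cdom C f)]"
    and "composable N (\<alpha> (ccod C f)) (map (\<lambda>G. far G f) Fs)"
  using assms by (auto simp: composable_def functor_simps C.dom_ob C.cod_ob subset_iff)

text \<open>For a unary arrow \<open>transpose_perm\<close> is \<open>id\<close>, which acts
  trivially on the composite. Membership thus becomes typing of the components together with a
  naturality square free of permutations.\<close>

lemma mar_iff:
  "p \<in> mar H \<longleftrightarrow> set (fst p) \<subseteq> symmetric_functors (C\<^sup>-) N \<and> fst (snd p) \<in> symmetric_functors (C\<^sup>-) N \<and>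
    snd (snd p) \<in> extensional (cob C) \<and>
    (\<forall>X \<in> cob C. snd (snd p) X \<in> mar N \<and> mdom N (snd (snd p) X) = map (\<lambda>G. fob G X) (fst p) \<and>
      mcod N (snd (snd p) X) = fob (fst (snd p)) X) \<and>
    (\<forall>f \<in> car C. mcomp N (far (fst (snd p)) f) [snd (snd p) (cdom C f)] =
      mcomp N (snd (snd p) (ccod C f)) (map (\<lambda>G. far G f) (fst p)))" (is "_ \<longleftrightarrow> ?rhs")
proof -
  obtain Fs F \<alpha> where p: "p = (Fs, F, \<alpha>)" by (cases p)
  show ?thesis
  proof
    assume "p \<in> mar H"
    then have *: "set Fs \<subseteq> symmetric_functors (C\<^sup>-) N" "F \<in> symmetric_functors (C\<^sup>-) N"
      "\<alpha> \<in> extensional (cob C)"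
      "\<And>X. X \<in> cob C \<Longrightarrow> \<alpha> X \<in> mar N \<and> mdom N (\<alpha> X) = map (\<lambda>G. fob G X) Fs \<and> mcod N (\<alpha> X) = fob F X"
      "\<And>f. f \<in> car C \<Longrightarrow> mcomp N (far F f) [\<alpha> (cdom C f)] =
         mact N id (mcomp N (\<alpha> (ccod C f)) (map (\<lambda>G. far G f) Fs))"
      by (auto simp: p internal_hom_def natural_family_def PiE_iff)
    then show ?rhs
      using natural_family_composable(2)[OF *(1,2,4)]
      by (simp add: p N.act_id N.comp_mar)
  next
    assume ?rhs
    then have *: "set Fs \<subseteq> symmetric_functors (C\<^sup>-) N" "F \<in> symmetric_functors (C\<^sup>-) N"
      "\<alpha> \<in> extensional (cob C)"
      "\<And>X. X \<in> cob C \<Longrightarrow> \<alpha> X \<in> mar N \<and> mdom N (\<alpha> X) = map (\<lambda>G. fob G X) Fs \<and> mcod N (\<alpha> X) = fob F X"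
      "\<And>f. f \<in> car C \<Longrightarrow> mcomp N (far F f) [\<alpha> (cdom C f)] =
         mcomp N (\<alpha> (ccod C f)) (map (\<lambda>G. far G f) Fs)"
      by (simp_all add: p)
    then show "p \<in> mar H"
      using natural_family_composable(2)[OF *(1,2,4)]
      by (auto simp: p internal_hom_def natural_family_def PiE_iff N.act_id N.comp_mar)
  qed
qed

lemma component:
  assumes "p \<in> mar H" "X \<in> cob C"
  shows "snd (snd p) X \<in> mar N" "mdom N (snd (snd p) X) = map (\<lambda>G. fob G X) (fst p)"
    "mcod N (snd (snd p) X) = fob (fst (snd p)) X"
  using assms by (auto simp: mar_iff)

lemma naturality:
  assumes "p \<in> mar H" "f \<in> car C"
  shows "mcomp N (far (fst (snd p)) f) [snd (snd p) (cdom C f)] =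
    mcomp N (snd (snd p) (ccod C f)) (map (\<lambda>G. far G f) (fst p))"
    and "composable N (far (fst (snd p)) f) [snd (snd p) (cdom C f)]"
    and "composable N (snd (snd p) (ccod C f)) (map (\<lambda>G. far G f) (fst p))"
  using assms natural_family_composable[of "fst p" "fst (snd p)" "snd (snd p)" f] by (auto simp: mar_iff)

lemma mar_eqI:
  assumes "p \<in> mar H" "q \<in> mar H" "fst p = fst q" "fst (snd p) = fst (snd q)"
    and "\<And>X. X \<in> cob C \<Longrightarrow> snd (snd p) X = snd (snd q) X"
  shows "p = q"
proof -
  have "snd (snd p) = snd (snd q)"
    using assms by (intro extensionalityI[of _ "cob C"]) (auto simp: mar_iff)
  with assms(3,4) show ?thesis by (simp add: prod_eq_iff)
qed

lemma composable_component:
  assumes "composable H p qs" "X \<in> cob C"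
  shows "composable N (snd (snd p) X) (map (\<lambda>q. snd (snd q) X) qs)"
proof -
  have qs: "p \<in> mar H" "set qs \<subseteq> mar H" "map (mcod H) qs = fst p"
    using assms(1) by (simp_all add: composable_def internal_hom_simps)
  then have "mcod N (snd (snd q) X) = fob (mcod H q) X" if "q \<in> set qs" for q
    using that component(3)[of q X] assms(2) by (auto simp: internal_hom_simps)
  then have "map (mcod N) (map (\<lambda>q. snd (snd q) X) qs) = map (\<lambda>G. fob G X) (map (mcod H) qs)"
    by simp
  also have "\<dots> = mdom N (snd (snd p) X)"
    using qs component[OF qs(1) assms(2)] by simp
  finally show ?thesis
    using qs component(1)[OF _ assms(2)] unfolding composable_def by (auto simp del: map_map)
qed

text \<open>Naturality of a composite family is obtained by sliding \<open>f\<close> through two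
  layers: past the component of \<open>p\<close> by its naturality, then past each component of
  \<open>qs\<close>, with associativity regrouping in between.\<close>

lemma comp_mar:
  assumes "composable H p qs"
  shows "mcomp H p qs \<in> mar H"
proof -
  have p: "p \<in> mar H" and qs: "set qs \<subseteq> mar H" and dom: "fst p = map (\<lambda>q. fst (snd q)) qs"
    using assms by (simp_all add: composable_def internal_hom_simps cong: map_cong)
  have q: "q \<in> mar H" if "q \<in> set qs" for q using qs that by auto
  note comp = composable_component[OF assms]
  have dom': "concat (map (mdom N) (map (\<lambda>q. snd (snd q) X) qs)) = map (\<lambda>G. fob G X) (concat (map fst qs))"
    if "X \<in> cob C" for X
    using component(2)[OF q that] by (simp add: map_concat comp_def cong: map_cong)
  have nat: "mcomp N (far (fst (snd p)) f) [mcomp N (snd (snd p) (cdom C f)) (map (\<lambda>q. snd (snd q) (cdom C f)) qs)] =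
      mcomp N (mcomp N (snd (snd p) (ccod C f)) (map (\<lambda>q. snd (snd q) (ccod C f)) qs))
        (map (\<lambda>G. far G f) (concat (map fst qs)))" if f: "f \<in> car C" for f
  proof -
    have ob: "cdom C f \<in> cob C" "ccod C f \<in> cob C"
      using f by (simp_all add: C.dom_ob C.cod_ob)
    let ?Ff = "map (\<lambda>q. far (fst (snd q)) f) qs"
    have "composable N (snd (snd p) (ccod C f)) ?Ff"
      using naturality(3)[OF p f] by (simp add: dom comp_def)
    moreover have "list_all2 (\<lambda>g h. composable N g [h]) ?Ff (map (\<lambda>q. snd (snd q) (cdom C f)) qs)"
      by (simp add: list_all2_conv_all_nth naturality(2)[OF q f])
    ultimately have "mcomp N (mcomp N (snd (snd p) (ccod C f)) ?Ff) (map (\<lambda>q. snd (snd q) (cdom C f)) qs) =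
        mcomp N (snd (snd p) (ccod C f))
          (map2 (\<lambda>g h. mcomp N g [h]) ?Ff (map (\<lambda>q. snd (snd q) (cdom C f)) qs))"
      by (rule N.comp_comp_unary)
    \<comment> \<open>Entrywise naturality of the members of \<open>qs\<close>: \<open>f\<close>
      passes from their targets to their sources.\<close>
    also have "map2 (\<lambda>g h. mcomp N g [h]) ?Ff (map (\<lambda>q. snd (snd q) (cdom C f)) qs) =
        map2 (mcomp N) (map (\<lambda>q. snd (snd q) (ccod C f)) qs) (map (\<lambda>q. map (\<lambda>G. far G f) (fst q)) qs)"
      by (rule nth_equalityI) (simp_all add: naturality(1)[OF q f])
    also have "mcomp N (snd (snd p) (ccod C f)) \<dots> =
        mcomp N (mcomp N (snd (snd p) (ccod C f)) (map (\<lambda>q. snd (snd q) (ccod C f)) qs))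
          (concat (map (\<lambda>q. map (\<lambda>G. far G f) (fst q)) qs))"
      by (rule N.assoc[symmetric, OF comp[OF ob(2)]])
        (simp add: list_all2_conv_all_nth naturality(3)[OF q f])
    finally show ?thesis
      using N.unary_comp_comp[OF naturality(2)[OF p f] comp[OF ob(1)]] naturality(1)[OF p f]
      by (simp add: dom map_concat comp_def)
  qed
  have "set (fst q) \<subseteq> symmetric_functors (C\<^sup>-) N" if "q \<in> set qs" for q
    using q[OF that] by (simp add: mar_iff)
  then have "set (concat (map fst qs)) \<subseteq> symmetric_functors (C\<^sup>-) N"
    by auto
  then show ?thesis
    unfolding mar_iff
    using p comp nat dom'
    by (simp add: internal_hom_simps mar_iff[of p] N.comp_mar N.comp_mdom N.comp_mcod
        C.dom_ob C.cod_ob)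
qed

lemma id_mar:
  assumes F: "F \<in> symmetric_functors (C\<^sup>-) N"
  shows "mid H F \<in> mar H"
proof -
  have "mcomp N (far F f) [mid N (fob F (cdom C f))] = far F f"
    "mcomp N (mid N (fob F (ccod C f))) [far F f] = far F f" if f: "f \<in> car C" for f
    using N.id_right[of "far F f"] N.id_left[of "far F f"] f by (simp_all add: functor_simps[OF F])
  then show ?thesis
    unfolding mar_iff using F
    by (auto simp: internal_hom_simps functor_simps[OF F] N.id_ar C.dom_ob C.cod_ob)
qed

text \<open>On one side of the naturality square \<open>s\<close> acts beneath a unary arrow, on the
  other above a layer of unary arrows \<open>far G f\<close>. In both positions it passes through
  unchanged, by \<open>unary_comp_act\<close> and \<open>act_comp_unary\<close>.\<close>

lemma act_mar:
  assumes p: "p \<in> mar H" and s: "s permutes {..<length (fst p)}"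
  shows "mact H s p \<in> mar H"
proof -
  have s': "s permutes {..<arity N (snd (snd p) X)}" if "X \<in> cob C" for X
    using component(2)[OF p that] s by simp
  have nat: "mcomp N (far (fst (snd p)) f) [mact N s (snd (snd p) (cdom C f))] =
      mcomp N (mact N s (snd (snd p) (ccod C f))) (map (\<lambda>G. far G f) (permute_list s (fst p)))"
    if f: "f \<in> car C" for f
  proof -
    have ob: "cdom C f \<in> cob C" "ccod C f \<in> cob C"
      using f by (simp_all add: C.dom_ob C.cod_ob)
    have "mcomp N (far (fst (snd p)) f) [mact N s (snd (snd p) (cdom C f))] =
        mact N s (mcomp N (snd (snd p) (ccod C f)) (map (\<lambda>G. far G f) (fst p)))"
      using N.unary_comp_act[OF naturality(2)[OF p f] s'[OF ob(1)]] naturality(1)[OF p f] by simp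
    also have "\<dots> = mcomp N (mact N s (snd (snd p) (ccod C f))) (permute_list s (map (\<lambda>G. far G f) (fst p)))"
      using p f s by (intro N.act_comp_unary[symmetric] naturality(3))
        (auto simp: mar_iff functor_simps subset_iff)
    finally show ?thesis
      using s by (simp add: permute_list_map)
  qed
  have *: "set (permute_list s (fst p)) = set (fst p)"
    using s by simp
  show ?thesis
    unfolding mar_iff
    using p nat s s' component[OF p]
    by (auto simp: internal_hom_simps * mar_iff[of p] N.act_mar N.act_mdom N.act_mcod
        C.dom_ob C.cod_ob permute_list_map)
qed

text \<open>Every law is the law of \<open>N\<close> at each object \<open>X\<close>, together with
  a list identity for the domains. The permutations match because each component of an arrow has the
  arity of that arrow.\<close>

lemma symmetric_multicategory_hom: "symmetric_multicategory H"
proof unfold_locales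
  fix p assume "p \<in> mar H"
  then show "set (mdom H p) \<subseteq> mob H" "mcod H p \<in> mob H"
    by (simp_all add: mar_iff internal_hom_simps)
next
  fix F assume "F \<in> mob H"
  then show "mid H F \<in> mar H \<and> mdom H (mid H F) = [F] \<and> mcod H (mid H F) = F"
    using id_mar by (simp add: internal_hom_simps)
next
  fix p qs assume "composable H p qs"
  then show "mcomp H p qs \<in> mar H \<and> mdom H (mcomp H p qs) = concat (map (mdom H) qs) \<and>
      mcod H (mcomp H p qs) = mcod H p"
    using comp_mar by (simp add: internal_hom_simps cong: map_cong)
next
  fix p assume p: "p \<in> mar H"
  then have "composable H (mid H (mcod H p)) [p]"
    using id_mar by (simp add: composable_unary internal_hom_simps mar_iff)
  note comp_mar[OF this]
  moreover have "mcomp N (mid N (fob (fst (snd p)) X)) [snd (snd p) X] = snd (snd p) X" if "X \<in> cob C" for X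
    using N.id_left[OF component(1)[OF p that]] component(3)[OF p that] by simp
  ultimately show "mcomp H (mid H (mcod H p)) [p] = p"
    using p by (intro mar_eqI) (auto simp: internal_hom_simps)
next
  fix p assume p: "p \<in> mar H"
  then have "composable H p (map (mid H) (mdom H p))"
    using id_mar by (auto simp: composable_def internal_hom_simps mar_iff intro!: map_idI)
  note comp_mar[OF this]
  moreover have "mcomp N (snd (snd p) X) (map (\<lambda>F. mid N (fob F X)) (fst p)) = snd (snd p) X"
    if "X \<in> cob C" for X
    using N.id_right[OF component(1)[OF p that]] component(2)[OF p that] by (simp add: comp_def)
  ultimately show "mcomp H p (map (mid H) (mdom H p)) = p"
    using p by (intro mar_eqI) (auto simp: internal_hom_simps comp_def)
next
  fix p qs rss
  assume pqs: "composable H p qs" and qrs: "list_all2 (composable H) qs rss"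
  have len: "length rss = length qs" using qrs by (simp add: list_all2_conv_all_nth)
  have "concat (map fst (concat rss)) = concat (map fst (map2 (mcomp H) qs rss))"
    using len by (auto simp: map_concat concat_concat comp_def internal_hom_simps case_prod_unfold
        intro!: arg_cong[of _ _ concat] nth_equalityI)
  moreover have "mcomp N (mcomp N (snd (snd p) X) (map (\<lambda>q. snd (snd q) X) qs)) (map (\<lambda>q. snd (snd q) X) (concat rss)) =
      mcomp N (snd (snd p) X) (map (\<lambda>q. snd (snd q) X) (map2 (mcomp H) qs rss))" if X: "X \<in> cob C" for X
  proof -
    have "list_all2 (composable N) (map (\<lambda>q. snd (snd q) X) qs) (map (map (\<lambda>q. snd (snd q) X)) rss)"
      using qrs composable_component[OF _ X] by (simp add: list_all2_conv_all_nth)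
    from N.assoc[OF composable_component[OF pqs X] this]
    have "mcomp N (mcomp N (snd (snd p) X) (map (\<lambda>q. snd (snd q) X) qs)) (map (\<lambda>q. snd (snd q) X) (concat rss)) =
        mcomp N (snd (snd p) X)
          (map2 (mcomp N) (map (\<lambda>q. snd (snd q) X) qs) (map (map (\<lambda>q. snd (snd q) X)) rss))"
      by (simp only: map_concat)
    also have "map2 (mcomp N) (map (\<lambda>q. snd (snd q) X) qs) (map (map (\<lambda>q. snd (snd q) X)) rss) =
        map (\<lambda>q. snd (snd q) X) (map2 (mcomp H) qs rss)"
      using X by (auto intro!: nth_equalityI simp: len internal_hom_simps)
    finally show ?thesis .
  qed
  ultimately show "mcomp H (mcomp H p qs) (concat rss) = mcomp H p (map2 (mcomp H) qs rss)"
    by (auto simp: internal_hom_simps[of "C\<^sup>-"] intro!: restrict_ext)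
next
  fix p s assume p: "p \<in> mar H" and s: "s permutes {..<arity H p}"
  then show "mact H s p \<in> mar H \<and> mdom H (mact H s p) = permute_list s (mdom H p) \<and>
      mcod H (mact H s p) = mcod H p"
    using act_mar by (simp add: internal_hom_simps)
next
  fix p assume p: "p \<in> mar H"
  have "mact H id p \<in> mar H" by (rule act_mar[OF p]) simp
  then show "mact H id p = p"
    using p by (intro mar_eqI) (simp_all add: internal_hom_simps N.act_id component[OF p])
next
  fix p s t assume p: "p \<in> mar H" and s: "s permutes {..<arity H p}" and t: "t permutes {..<arity H p}"
  then show "mact H (s \<circ> t) p = mact H t (mact H s p)"
    by (auto simp: internal_hom_simps permute_list_compose N.act_comp component[OF p]
        intro!: restrict_ext)
next
  fix p qs s assume pqs: "composable H p qs" and s: "s permutes {..<length qs}"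
  have ar: "map (arity H) qs = map (\<lambda>q. length (fst q)) qs"
    by (simp add: internal_hom_simps)
  have "concat (map fst (permute_list s qs)) =
      permute_list (block_perm s (map (arity H) qs)) (concat (map fst qs))"
    using permute_list_block_perm[of s "map fst qs"] s by (simp add: permute_list_map ar comp_def)
  moreover have "mcomp N (mact N s (snd (snd p) X)) (map (\<lambda>q. snd (snd q) X) (permute_list s qs)) =
      mact N (block_perm s (map (arity H) qs)) (mcomp N (snd (snd p) X) (map (\<lambda>q. snd (snd q) X) qs))"
    if X: "X \<in> cob C" for X
  proof -
    have arity: "map (arity N) (map (\<lambda>q. snd (snd q) X) qs) = map (arity H) qs"
      using pqs component(2)[OF _ X] by (auto simp: composable_def internal_hom_simps)
    from N.equivariant_outer[OF composable_component[OF pqs X], of s, unfolded arity] s show ?thesis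
      by (simp add: permute_list_map)
  qed
  ultimately show "mcomp H (mact H s p) (permute_list s qs) =
      mact H (block_perm s (map (arity H) qs)) (mcomp H p qs)"
    by (auto simp: internal_hom_simps(3-)[of "C\<^sup>-"] intro!: restrict_ext)
next
  fix p qs ss
  assume pqs: "composable H p qs" and ss: "list_all2 (\<lambda>s q. s permutes {..<arity H q}) ss qs"
  have ar: "map (arity H) qs = map length (map fst qs)"
    by (simp add: internal_hom_simps)
  have ss': "list_all2 (\<lambda>s xs. s permutes {..<length xs}) ss (map fst qs)"
    using ss by (simp add: internal_hom_simps list_all2_map2)
  have len: "length ss = length qs" using ss by (simp add: list_all2_conv_all_nth)
  have "map fst (map2 (mact H) ss qs) = map2 permute_list ss (map fst qs)"
    using len by (auto intro!: nth_equalityI simp: internal_hom_simps)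
  then have "concat (map fst (map2 (mact H) ss qs)) =
      permute_list (sum_perm ss (map (arity H) qs)) (concat (map fst qs))"
    by (simp only: ar permute_list_sum_perm[OF ss'])
  moreover have "mcomp N (snd (snd p) X) (map (\<lambda>q. snd (snd q) X) (map2 (mact H) ss qs)) =
      mact N (sum_perm ss (map (arity H) qs)) (mcomp N (snd (snd p) X) (map (\<lambda>q. snd (snd q) X) qs))"
    if X: "X \<in> cob C" for X
  proof -
    have arity: "map (arity N) (map (\<lambda>q. snd (snd q) X) qs) = map (arity H) qs"
      using pqs component(2)[OF _ X] by (auto simp: composable_def internal_hom_simps)
    have "arity N (snd (snd (qs ! i)) X) = arity H (qs ! i)" if "i < length qs" for i
      using arg_cong[OF arity, of "\<lambda>xs. xs ! i"] that by simp
    then have "list_all2 (\<lambda>s g. s permutes {..<arity N g}) ss (map (\<lambda>q. snd (snd q) X) qs)"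
      using ss by (auto simp: list_all2_conv_all_nth)
    from N.equivariant_inner[OF composable_component[OF pqs X] this, unfolded arity]
    have "mcomp N (snd (snd p) X) (map2 (mact N) ss (map (\<lambda>q. snd (snd q) X) qs)) =
      mact N (sum_perm ss (map (arity H) qs)) (mcomp N (snd (snd p) X) (map (\<lambda>q. snd (snd q) X) qs))" .
    moreover have "map (\<lambda>q. snd (snd q) X) (map2 (mact H) ss qs) = map2 (mact N) ss (map (\<lambda>q. snd (snd q) X) qs)"
      using len X by (auto intro!: nth_equalityI simp: internal_hom_simps)
    ultimately show ?thesis by (simp only:)
  qed
  ultimately show "mcomp H p (map2 (mact H) ss qs) =
      mact H (sum_perm ss (map (arity H) qs)) (mcomp H p qs)"
    by (auto simp: internal_hom_simps(3-)[of "C\<^sup>-"] intro!: restrict_ext)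
qed

end


section \<open>Presented symmetric multicategories\<close>

locale multigraph =
  fixes S :: "('o, 'g) multigraph"
    and R :: "(('o, 'g) mterm \<times> ('o, 'g) mterm) set"
  assumes gdom_ob: "g \<in> gar S \<Longrightarrow> set (gdom S g) \<subseteq> gob S"
    and gcod_ob: "g \<in> gar S \<Longrightarrow> gcod S g \<in> gob S"
begin

abbreviation P where "P \<equiv> presented_smcat S R"
abbreviation cls where "cls \<equiv> term_class S R"

section \<open>Well-formed terms and the typing of the congruence\<close>

lemma Comp_in_mterms_iff:
  "Comp t us \<in> mterms S \<longleftrightarrow> t \<in> mterms S \<and> set us \<subseteq> mterms S \<and> map (tcod S) us = tdom S t"
  by (auto intro: mterms.Comp elim: mterms.cases)

lemma Perm_in_mterms_iff:
  "Perm s t \<in> mterms S \<longleftrightarrow> t \<in> mterms S \<and> s permutes {..<length (tdom S t)}"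
  by (auto intro: mterms.Perm elim: mterms.cases)

lemma mterms_ob: "t \<in> mterms S \<Longrightarrow> set (tdom S t) \<subseteq> gob S \<and> tcod S t \<in> gob S"
proof (induction rule: mterms.induct)
  case (Gen g)
  then show ?case using gdom_ob gcod_ob by simp
qed auto

lemma Comp_length: "Comp t us \<in> mterms S \<Longrightarrow> length us = length (tdom S t)"
  by (metis Comp_in_mterms_iff length_map)

text \<open>Typing of the associativity clause for \<open>term_eq_wf\<close>. The two domains are
  the two ways of flattening a doubly nested list.\<close>

lemma assoc_mterms:
  assumes "Comp t us \<in> mterms S" "list_all2 (\<lambda>u vs. Comp u vs \<in> mterms S) us vss"
  shows "Comp (Comp t us) (concat vss) \<in> mterms S" "Comp t (map2 Comp us vss) \<in> mterms S"
    "tdom S (Comp (Comp t us) (concat vss)) = tdom S (Comp t (map2 Comp us vss))"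
proof -
  have len: "length vss = length us" using assms(2) by (simp add: list_all2_conv_all_nth)
  have nth: "Comp (us ! i) (vss ! i) \<in> mterms S" if "i < length us" for i
    using assms(2) that by (simp add: list_all2_conv_all_nth)
  then have nth': "us ! i \<in> mterms S" "set (vss ! i) \<subseteq> mterms S" "map (tcod S) (vss ! i) = tdom S (us ! i)"
    if "i < length us" for i
    using that by (simp_all add: Comp_in_mterms_iff)
  have "map (map (tcod S)) vss = map (tdom S) us"
    by (rule nth_equalityI) (simp_all add: len nth')
  moreover have "set (concat vss) \<subseteq> mterms S"
    using nth'(2) by (force simp: len in_set_conv_nth)
  ultimately show "Comp (Comp t us) (concat vss) \<in> mterms S"
    using assms(1) unfolding Comp_in_mterms_iff[of "Comp t us"] by (simp add: map_concat)
  have "map (tcod S) (map2 Comp us vss) = map (tcod S) us"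
    by (rule nth_equalityI) (simp_all add: len)
  moreover have "set (map2 Comp us vss) \<subseteq> mterms S"
    using nth by (auto simp: set_zip len)
  ultimately show "Comp t (map2 Comp us vss) \<in> mterms S"
    using assms(1) by (simp add: Comp_in_mterms_iff)
  have "map concat (map (map (tdom S)) vss) = map (tdom S) (map2 Comp us vss)"
    by (rule nth_equalityI) (simp_all add: len)
  then show "tdom S (Comp (Comp t us) (concat vss)) = tdom S (Comp t (map2 Comp us vss))"
    by (simp add: map_concat concat_concat del: map_map)
qed

text \<open>On domains, the outer equivariance clause is \<open>permute_list_block_perm\<close> for
  the list of domains of \<open>us\<close>.\<close>

lemma equivariant_outer_mterms:
  assumes "Comp t us \<in> mterms S" "s permutes {..<length us}"
  shows "Comp (Perm s t) (permute_list s us) \<in> mterms S"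
    "Perm (block_perm s (map (\<lambda>u. length (tdom S u)) us)) (Comp t us) \<in> mterms S"
    "tdom S (Comp (Perm s t) (permute_list s us)) =
      tdom S (Perm (block_perm s (map (\<lambda>u. length (tdom S u)) us)) (Comp t us))"
proof -
  have len: "length us = length (tdom S t)" using Comp_length[OF assms(1)] .
  show "Comp (Perm s t) (permute_list s us) \<in> mterms S"
    using assms len by (simp add: Comp_in_mterms_iff Perm_in_mterms_iff flip: permute_list_map)
  have len': "map length (map (tdom S) us) = map (\<lambda>u. length (tdom S u)) us" by simp
  show "Perm (block_perm s (map (\<lambda>u. length (tdom S u)) us)) (Comp t us) \<in> mterms S"
    using block_perm_permutes[of s "map (\<lambda>u. length (tdom S u)) us"] assms
    by (simp add: Perm_in_mterms_iff length_concat comp_def)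
  show "tdom S (Comp (Perm s t) (permute_list s us)) =
      tdom S (Perm (block_perm s (map (\<lambda>u. length (tdom S u)) us)) (Comp t us))"
    using permute_list_block_perm[of s "map (tdom S) us", unfolded len'] assms
    by (simp add: permute_list_map)
qed

text \<open>On domains, the inner equivariance clause is
  \<open>permute_list_sum_perm\<close>.\<close>

lemma equivariant_inner_mterms:
  assumes "Comp t us \<in> mterms S" "list_all2 (\<lambda>s u. s permutes {..<length (tdom S u)}) ss us"
  shows "Comp t (map2 Perm ss us) \<in> mterms S"
    "Perm (sum_perm ss (map (\<lambda>u. length (tdom S u)) us)) (Comp t us) \<in> mterms S"
    "tdom S (Comp t (map2 Perm ss us)) =
      tdom S (Perm (sum_perm ss (map (\<lambda>u. length (tdom S u)) us)) (Comp t us))"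
proof -
  have len: "length ss = length us" using assms(2) by (simp add: list_all2_conv_all_nth)
  have nth: "ss ! i permutes {..<length (tdom S (us ! i))}" if "i < length us" for i
    using assms(2) that by (simp add: list_all2_conv_all_nth)
  have "map (tcod S) (map2 Perm ss us) = map (tcod S) us"
    by (rule nth_equalityI) (simp_all add: len)
  moreover have "set (map2 Perm ss us) \<subseteq> mterms S"
    using nth assms(1) by (auto simp: set_zip len Perm_in_mterms_iff Comp_in_mterms_iff subset_iff)
  ultimately show "Comp t (map2 Perm ss us) \<in> mterms S"
    using assms(1) by (simp add: Comp_in_mterms_iff)
  have len': "map length (map (tdom S) us) = map (\<lambda>u. length (tdom S u)) us" by simp
  have ss: "list_all2 (\<lambda>s m. s permutes {..<m}) ss (map (\<lambda>u. length (tdom S u)) us)"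
    "list_all2 (\<lambda>s xs. s permutes {..<length xs}) ss (map (tdom S) us)"
    using assms(2) by (simp_all add: list_all2_map2)
  show "Perm (sum_perm ss (map (\<lambda>u. length (tdom S u)) us)) (Comp t us) \<in> mterms S"
    using sum_perm_permutes[OF ss(1)] assms
    by (simp add: Perm_in_mterms_iff length_concat comp_def)
  have "map (tdom S) (map2 Perm ss us) = map2 permute_list ss (map (tdom S) us)"
    by (rule nth_equalityI) (simp_all add: len)
  then show "tdom S (Comp t (map2 Perm ss us)) =
      tdom S (Perm (sum_perm ss (map (\<lambda>u. length (tdom S u)) us)) (Comp t us))"
    using permute_list_sum_perm[OF ss(2), unfolded len'] by (simp del: map_map)
qed

text \<open>Each clause relates well-formed parallel terms, so domain and codomain descend to
  classes and do not depend on the representative chosen.\<close>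

lemma term_eq_wf:
  "term_eq S R t u \<Longrightarrow> t \<in> mterms S \<and> u \<in> mterms S \<and> tdom S t = tdom S u \<and> tcod S t = tcod S u"
proof (induction rule: term_eq.induct)
  case (cong_Comp t t' us us')
  have len: "length us' = length us" using cong_Comp.IH(2) by (simp add: list_all2_conv_all_nth)
  have nth: "us ! i \<in> mterms S" "us' ! i \<in> mterms S" "tdom S (us ! i) = tdom S (us' ! i)"
    "tcod S (us ! i) = tcod S (us' ! i)" if "i < length us" for i
    using cong_Comp.IH(2) that by (simp_all add: list_all2_conv_all_nth)
  have "map (tdom S) us = map (tdom S) us'" "map (tcod S) us = map (tcod S) us'"
    by (rule nth_equalityI; simp add: len nth)+
  moreover have "set us' \<subseteq> mterms S"
    using nth(2) len by (auto simp: in_set_conv_nth)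
  ultimately show ?case
    using cong_Comp by (simp add: Comp_in_mterms_iff)
next
  case (assoc t us vss)
  then show ?case using assoc_mterms by simp
next
  case (equivariant_outer t us s)
  then show ?case using equivariant_outer_mterms by simp
next
  case (equivariant_inner t us ss)
  then show ?case using equivariant_inner_mterms by simp
next
  case (id_right t)
  then show ?case
    using mterms_ob[of t] by (auto simp: Comp_in_mterms_iff comp_def intro: mterms.Ident)
next
  case (id_left t)
  then show ?case
    using mterms_ob[of t] by (auto simp: Comp_in_mterms_iff intro: mterms.Ident)
next
  case (act_comp t s s')
  then show ?case
    by (auto simp: Perm_in_mterms_iff permute_list_compose permutes_compose)
qed (auto simp: Perm_in_mterms_iff permutes_id)

section \<open>The quotient by the congruence\<close>

lemma cls_eq_iff: "t \<in> mterms S \<Longrightarrow> cls t = cls u \<longleftrightarrow> term_eq S R t u"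
  unfolding term_class_def
  by (auto intro: term_eq.refl term_eq.sym term_eq.trans)

lemma cls_eqI: "term_eq S R t u \<Longrightarrow> cls t = cls u"
  using cls_eq_iff term_eq_wf by blast

text \<open>The class of a well-formed term contains that term, hence \<open>representative\<close>
  picks some equivalent term; the congruence clauses then make the operations on classes independent
  of the choice.\<close>

lemma representative_cls: "t \<in> mterms S \<Longrightarrow> term_eq S R t (representative (cls t))"
  unfolding term_class_def by (metis mem_Collect_eq someI_ex term_eq.refl)

lemma mob_P [simp]: "mob P = gob S"
  and mar_P: "mar P = cls ` mterms S"
  and mid_P: "mid P A = cls (Ident A)"
  by (simp_all add: presented_smcat_def)

lemma cls_mar: "t \<in> mterms S \<Longrightarrow> cls t \<in> mar P"
  by (simp add: mar_P)

lemma mdom_cls: "t \<in> mterms S \<Longrightarrow> mdom P (cls t) = tdom S t"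
  and mcod_cls: "t \<in> mterms S \<Longrightarrow> mcod P (cls t) = tcod S t"
  using term_eq_wf[OF representative_cls] by (simp_all add: presented_smcat_def)

lemma mcomp_cls:
  assumes "Comp t us \<in> mterms S"
  shows "mcomp P (cls t) (map cls us) = cls (Comp t us)"
proof -
  have "term_eq S R t (representative (cls t))"
    "list_all2 (term_eq S R) us (map representative (map cls us))"
    using assms by (auto simp: Comp_in_mterms_iff list_all2_conv_all_nth intro!: representative_cls)
  from cls_eqI[OF term_eq.cong_Comp[OF this assms]] show ?thesis
    by (simp add: presented_smcat_def)
qed

lemma mact_cls:
  assumes "Perm s t \<in> mterms S"
  shows "mact P s (cls t) = cls (Perm s t)"
proof -
  have "t \<in> mterms S" using assms by (simp add: Perm_in_mterms_iff)
  from cls_eqI[OF term_eq.cong_Perm[OF representative_cls[OF this] assms]] show ?thesis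
    by (simp add: presented_smcat_def)
qed

lemma composable_cls_iff:
  assumes "t \<in> mterms S" "set us \<subseteq> mterms S"
  shows "composable P (cls t) (map cls us) \<longleftrightarrow> Comp t us \<in> mterms S"
proof -
  have "map (mcod P) (map cls us) = map (tcod S) us"
    using assms(2) by (auto simp: mcod_cls)
  then show ?thesis
    unfolding composable_def Comp_in_mterms_iff
    using assms by (auto simp: mdom_cls cls_mar simp del: map_map)
qed

lemma composableE:
  assumes "composable P f gs"
  obtains t us where "f = cls t" "gs = map cls us" "Comp t us \<in> mterms S"
proof -
  have "f \<in> cls ` mterms S" "set gs \<subseteq> cls ` mterms S"
    using assms by (auto simp: composable_def mar_P)
  then obtain t us where "f = cls t" "t \<in> mterms S" "gs = map cls us" "set us \<subseteq> mterms S"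
    by (metis imageE set_subset_imageE)
  then show ?thesis
    using that assms composable_cls_iff by blast
qed

text \<open>Terms must be chosen for all entries of a nested list and must fit the given terms
  \<open>us\<close>; the induction makes the choices one inner list at a time.\<close>

lemma list_all2_composableE:
  assumes "list_all2 (composable P) (map cls us) hss" "set us \<subseteq> mterms S"
  obtains vss where "hss = map (map cls) vss" "list_all2 (\<lambda>u vs. Comp u vs \<in> mterms S) us vss"
  using assms
proof (induction us arbitrary: hss thesis)
  case Nil
  then show ?case by simp
next
  case (Cons u us)
  then obtain hs hss' where hss: "hss = hs # hss'" "composable P (cls u) hs"
    "list_all2 (composable P) (map cls us) hss'"
    by (auto simp: list_all2_Cons1)
  then obtain vss where vss: "hss' = map (map cls) vss" "list_all2 (\<lambda>u vs. Comp u vs \<in> mterms S) us vss"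
    using Cons.IH[of hss'] Cons.prems(3) by auto
  obtain vs where vs: "hs = map cls vs" "set vs \<subseteq> mterms S"
    using hss(2) by (metis composable_def mar_P set_subset_imageE)
  with hss(2) Cons.prems(3) have "Comp u vs \<in> mterms S"
    by (simp add: composable_cls_iff)
  then show ?case
    using Cons.prems(1)[of "vs # vss"] vss vs hss(1) by simp
qed

text \<open>Each equational axiom is a clause of \<open>term_eq\<close>, read on classes after terms
  have been chosen for the arrows involved.\<close>

lemma symmetric_multicategory_presented: "symmetric_multicategory P"
proof unfold_locales
  fix f assume "f \<in> mar P"
  then obtain t where t: "f = cls t" "t \<in> mterms S" by (auto simp: mar_P)
  show "set (mdom P f) \<subseteq> mob P" "mcod P f \<in> mob P"
    using mterms_ob[OF t(2)] t by (simp_all add: mdom_cls mcod_cls)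
  have left: "Comp (Ident (tcod S t)) [t] \<in> mterms S"
    using t mterms_ob[OF t(2)] by (auto simp: Comp_in_mterms_iff intro: mterms.Ident)
  show "mcomp P (mid P (mcod P f)) [f] = f"
    using mcomp_cls[OF left] cls_eqI[OF term_eq.id_left[OF t(2)]] t by (simp add: mcod_cls mid_P)
  have right: "Comp t (map Ident (tdom S t)) \<in> mterms S"
    using t mterms_ob[OF t(2)] by (auto simp: Comp_in_mterms_iff comp_def intro: mterms.Ident)
  have "map (mid P) (tdom S t) = map cls (map Ident (tdom S t))"
    by (simp add: mid_P)
  then show "mcomp P f (map (mid P) (mdom P f)) = f"
    using mcomp_cls[OF right] cls_eqI[OF term_eq.id_right[OF t(2)]] t
    by (simp add: mdom_cls del: map_map)
  have "Perm id t \<in> mterms S"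
    using t by (simp add: Perm_in_mterms_iff permutes_id)
  then show "mact P id f = f"
    using cls_eqI[OF term_eq.act_id[OF t(2)]] t by (simp add: mact_cls)
next
  fix A assume "A \<in> mob P"
  then have "Ident A \<in> mterms S" by (simp add: mterms.Ident)
  then show "mid P A \<in> mar P \<and> mdom P (mid P A) = [A] \<and> mcod P (mid P A) = A"
    by (simp add: mid_P cls_mar mdom_cls mcod_cls)
next
  fix f gs assume "composable P f gs"
  then obtain t us where tus: "f = cls t" "gs = map cls us" "Comp t us \<in> mterms S"
    by (rule composableE)
  then have "map (mdom P) gs = map (tdom S) us" "mcod P f = tcod S t"
    by (auto simp: Comp_in_mterms_iff mdom_cls mcod_cls subset_iff)
  then show "mcomp P f gs \<in> mar P \<and> mdom P (mcomp P f gs) = concat (map (mdom P) gs) \<and>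
      mcod P (mcomp P f gs) = mcod P f"
    using tus by (simp add: mcomp_cls cls_mar mdom_cls mcod_cls del: map_map)
next
  fix f gs hss assume "composable P f gs" and gs: "list_all2 (composable P) gs hss"
  then obtain t us where tus: "f = cls t" "gs = map cls us" "Comp t us \<in> mterms S"
    by (metis composableE)
  obtain vss where vss: "hss = map (map cls) vss" "list_all2 (\<lambda>u vs. Comp u vs \<in> mterms S) us vss"
    using list_all2_composableE[of us hss] gs tus by (auto simp: Comp_in_mterms_iff)
  have lists: "map2 (mcomp P) gs hss = map cls (map2 Comp us vss)" "concat hss = map cls (concat vss)"
    using vss by (auto simp: tus list_all2_conv_all_nth mcomp_cls map_concat intro!: nth_equalityI)
  show "mcomp P (mcomp P f gs) (concat hss) = mcomp P f (map2 (mcomp P) gs hss)"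
    unfolding lists unfolding tus(1,2) mcomp_cls[OF tus(3)]
      mcomp_cls[OF assoc_mterms(1)[OF tus(3) vss(2)]] mcomp_cls[OF assoc_mterms(2)[OF tus(3) vss(2)]]
    by (rule cls_eqI[OF term_eq.assoc[OF tus(3) vss(2)]])
next
  fix f s assume f: "f \<in> mar P" and s: "s permutes {..<arity P f}"
  obtain t where t: "f = cls t" "t \<in> mterms S" using f by (auto simp: mar_P)
  then have st: "Perm s t \<in> mterms S"
    using s by (simp add: Perm_in_mterms_iff mdom_cls)
  then show "mact P s f \<in> mar P \<and> mdom P (mact P s f) = permute_list s (mdom P f) \<and>
      mcod P (mact P s f) = mcod P f"
    using t by (simp add: mact_cls cls_mar mdom_cls mcod_cls)
  fix s' assume s': "s' permutes {..<arity P f}"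
  have "Perm s' (Perm s t) \<in> mterms S" "Perm (s \<circ> s') t \<in> mterms S"
    using st s' t by (simp_all add: Perm_in_mterms_iff mdom_cls permutes_compose)
  then show "mact P (s \<circ> s') f = mact P s' (mact P s f)"
    using cls_eqI[OF term_eq.act_comp[OF t(2), of s s']] s s' t st by (simp add: mact_cls mdom_cls)
next
  fix f gs s assume "composable P f gs" and s: "s permutes {..<length gs}"
  then obtain t us where tus: "f = cls t" "gs = map cls us" "Comp t us \<in> mterms S"
    by (metis composableE)
  have ar: "map (arity P) gs = map (\<lambda>u. length (tdom S u)) us"
    using tus by (auto simp: Comp_in_mterms_iff mdom_cls subset_iff)
  have s': "s permutes {..<length us}" using s tus by simp
  then have st: "Perm s t \<in> mterms S"
    using tus(3) Comp_length[OF tus(3)] by (simp add: Perm_in_mterms_iff Comp_in_mterms_iff)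
  show "mcomp P (mact P s f) (permute_list s gs) =
      mact P (block_perm s (map (arity P) gs)) (mcomp P f gs)"
    using equivariant_outer_mterms[OF tus(3) s'] cls_eqI[OF term_eq.equivariant_outer[OF tus(3) s']]
      tus s' st
    by (simp add: ar[unfolded tus] mcomp_cls mact_cls permute_list_map del: map_map)
next
  fix f gs ss assume "composable P f gs" and ss: "list_all2 (\<lambda>s g. s permutes {..<arity P g}) ss gs"
  then obtain t us where tus: "f = cls t" "gs = map cls us" "Comp t us \<in> mterms S"
    by (metis composableE)
  have ar: "map (arity P) gs = map (\<lambda>u. length (tdom S u)) us"
    using tus by (auto simp: Comp_in_mterms_iff mdom_cls subset_iff)
  have us: "us ! i \<in> mterms S" if "i < length us" for i
    using tus(3) that by (auto simp: Comp_in_mterms_iff)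
  have ss': "list_all2 (\<lambda>s u. s permutes {..<length (tdom S u)}) ss us"
    using ss us by (auto simp: tus list_all2_conv_all_nth mdom_cls)
  then have "map2 (mact P) ss gs = map cls (map2 Perm ss us)"
    using us by (auto simp: tus list_all2_conv_all_nth Perm_in_mterms_iff mact_cls intro!: nth_equalityI)
  then show "mcomp P f (map2 (mact P) ss gs) =
      mact P (sum_perm ss (map (arity P) gs)) (mcomp P f gs)"
    using equivariant_inner_mterms[OF tus(3) ss'] cls_eqI[OF term_eq.equivariant_inner[OF tus(3) ss']] tus
    by (simp add: ar[unfolded tus] mcomp_cls mact_cls del: map_map)
qed

end

section \<open>The universal property of a presentation\<close>

primrec interpret_term :: "('p, 'b) smcat \<Rightarrow> ('o \<Rightarrow> 'p) \<Rightarrow> ('g \<Rightarrow> 'b) \<Rightarrow> ('o, 'g) mterm \<Rightarrow> 'b" where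
  "interpret_term K ob gen (Gen g) = gen g"
| "interpret_term K ob gen (Ident A) = mid K (ob A)"
| "interpret_term K ob gen (Comp t us) = mcomp K (interpret_term K ob gen t) (map (interpret_term K ob gen) us)"
| "interpret_term K ob gen (Perm s t) = mact K s (interpret_term K ob gen t)"

locale presentation_model = multigraph S R + K: symmetric_multicategory K
  for S :: "('o, 'g) multigraph" and R and K :: "('p, 'b) smcat" +
  fixes ob :: "'o \<Rightarrow> 'p" and gen :: "'g \<Rightarrow> 'b"
  assumes ob: "A \<in> gob S \<Longrightarrow> ob A \<in> mob K"
    and gen: "g \<in> gar S \<Longrightarrow> gen g \<in> mar K \<and> mdom K (gen g) = map ob (gdom S g) \<and> mcod K (gen g) = ob (gcod S g)"
    and relations: "\<lbrakk>(t, u) \<in> R; t \<in> mterms S; u \<in> mterms S\<rbrakk> \<Longrightarrow>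
      interpret_term K ob gen t = interpret_term K ob gen u"
begin

abbreviation eval_term where "eval_term \<equiv> interpret_term K ob gen"

lemma eval_ar:
  "t \<in> mterms S \<Longrightarrow> eval_term t \<in> mar K \<and> mdom K (eval_term t) = map ob (tdom S t) \<and>
    mcod K (eval_term t) = ob (tcod S t)"
proof (induction rule: mterms.induct)
  case (Comp t us)
  have us: "eval_term u \<in> mar K" "mdom K (eval_term u) = map ob (tdom S u)"
    "mcod K (eval_term u) = ob (tcod S u)" if "u \<in> set us" for u
    using Comp that by auto
  have "map (mcod K) (map eval_term us) = map ob (map (tcod S) us)"
    by (simp add: us)
  also have "\<dots> = mdom K (eval_term t)"
    using Comp by simp
  finally have "composable K (eval_term t) (map eval_term us)"
    using Comp by (auto simp: composable_def simp del: map_map)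
  moreover have "map (mdom K) (map eval_term us) = map (map ob) (map (tdom S) us)"
    by (simp add: us)
  ultimately show ?case
    using Comp by (simp add: K.comp_ar map_concat del: map_map)
qed (use gen ob K.id_ar K.act_ar in \<open>auto simp: permute_list_map\<close>)

lemma composable_eval:
  assumes "Comp t us \<in> mterms S"
  shows "composable K (eval_term t) (map eval_term us)"
proof -
  have *: "t \<in> mterms S" "\<And>u. u \<in> set us \<Longrightarrow> u \<in> mterms S" "map (tcod S) us = tdom S t"
    using assms by (auto simp: Comp_in_mterms_iff)
  have "map (mcod K) (map eval_term us) = map ob (map (tcod S) us)"
    using *(2) by (simp add: eval_ar)
  also have "\<dots> = mdom K (eval_term t)"
    using * by (simp add: eval_ar)
  finally show ?thesis
    using * by (auto simp: composable_def eval_ar simp del: map_map)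
qed

text \<open>Soundness of the congruence: \<open>rel\<close> is the assumption on the relations, and
  the clauses expressing multicategory laws are the axioms of \<open>K\<close> applied to evaluated
  terms.\<close>

lemma eval_term_eq: "term_eq S R t u \<Longrightarrow> eval_term t = eval_term u"
proof (induction rule: term_eq.induct)
  case (rel t u)
  then show ?case by (intro relations)
next
  case (cong_Comp t t' us us')
  then have "map eval_term us = map eval_term us'"
    by (auto simp: list_all2_conv_all_nth intro!: nth_equalityI)
  with cong_Comp show ?case by (simp del: map_eq_conv)
next
  case (id_left t)
  then show ?case using K.id_left[of "eval_term t"] by (simp add: eval_ar)
next
  case (id_right t)
  then show ?case using K.id_right[of "eval_term t"] by (simp add: eval_ar comp_def)
next
  case (assoc t us vss)
  then have "list_all2 (composable K) (map eval_term us) (map (map eval_term) vss)"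
    by (simp add: list_all2_conv_all_nth composable_eval)
  moreover have "map2 (mcomp K) (map eval_term us) (map (map eval_term) vss) = map eval_term (map2 Comp us vss)"
    using assoc by (auto simp: list_all2_conv_all_nth intro!: nth_equalityI)
  ultimately show ?case
    using K.assoc[OF composable_eval[OF assoc(1)], of "map (map eval_term) vss"]
    by (simp add: map_concat del: map_map)
next
  case (act_id t)
  then show ?case by (simp add: K.act_id eval_ar)
next
  case (act_comp t s s')
  then show ?case by (simp add: K.act_comp eval_ar)
next
  case (equivariant_outer t us s)
  then have "map (arity K) (map eval_term us) = map (\<lambda>u. length (tdom S u)) us"
    by (auto simp: Comp_in_mterms_iff eval_ar subset_iff)
  then show ?case
    using K.equivariant_outer[OF composable_eval[OF equivariant_outer(1)], of s] equivariant_outer(2)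
    by (simp add: permute_list_map del: map_map)
next
  case (equivariant_inner t us ss)
  then have ar: "map (arity K) (map eval_term us) = map (\<lambda>u. length (tdom S u)) us"
    by (auto simp: Comp_in_mterms_iff eval_ar subset_iff)
  have "us ! i \<in> mterms S" if "i < length us" for i
    using equivariant_inner(1) that by (auto simp: Comp_in_mterms_iff)
  then have "list_all2 (\<lambda>s g. s permutes {..<arity K g}) ss (map eval_term us)"
    using equivariant_inner(2) by (auto simp: list_all2_conv_all_nth eval_ar)
  moreover have "map2 (mact K) ss (map eval_term us) = map eval_term (map2 Perm ss us)"
    using equivariant_inner(2) by (auto simp: list_all2_conv_all_nth intro!: nth_equalityI)
  ultimately show ?case
    using K.equivariant_inner[OF composable_eval[OF equivariant_inner(1)], of ss] ar
    by (simp del: map_map)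
qed simp_all

text \<open>Evaluating a chosen representative is legitimate because equivalent terms have equal
  values; \<open>far_induced_functor\<close> replaces it by any term of the class.\<close>

definition induced_functor :: "('o, ('o, 'g) mterm set, 'p, 'b) mfunctor" where
  "induced_functor = \<lparr>fob = restrict ob (gob S), far = restrict (\<lambda>c. eval_term (representative c)) (mar P)\<rparr>"

lemma far_induced_functor: "t \<in> mterms S \<Longrightarrow> far induced_functor (cls t) = eval_term t"
  using eval_term_eq[OF representative_cls] by (simp add: induced_functor_def cls_mar)

lemma induced_functor_in: "induced_functor \<in> symmetric_functors P K"
proof (rule symmetric_functorsI)
  have fob: "map (fob induced_functor) (tdom S t) = map ob (tdom S t)"
      "fob induced_functor (tcod S t) = ob (tcod S t)" if "t \<in> mterms S" for t
    using mterms_ob[OF that] by (auto simp: induced_functor_def)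
  fix f assume "f \<in> mar P"
  then obtain t where t: "f = cls t" "t \<in> mterms S" by (auto simp: mar_P)
  then show "far induced_functor f \<in> mar K"
    "mdom K (far induced_functor f) = map (fob induced_functor) (mdom P f)"
    "mcod K (far induced_functor f) = fob induced_functor (mcod P f)"
    by (simp_all add: far_induced_functor eval_ar mdom_cls mcod_cls fob)
  fix s assume "s permutes {..<arity P f}"
  then have "Perm s t \<in> mterms S"
    using t by (simp add: Perm_in_mterms_iff mdom_cls)
  then show "far induced_functor (mact P s f) = mact K s (far induced_functor f)"
    using t by (simp add: mact_cls far_induced_functor)
next
  fix f gs assume "composable P f gs"
  then obtain t us where tus: "f = cls t" "gs = map cls us" "Comp t us \<in> mterms S"
    by (rule composableE)
  then have "map (far induced_functor) gs = map eval_term us"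
    by (auto simp: Comp_in_mterms_iff far_induced_functor subset_iff)
  then show "far induced_functor (mcomp P f gs) = mcomp K (far induced_functor f) (map (far induced_functor) gs)"
    using tus by (simp add: mcomp_cls far_induced_functor del: map_map)
      (simp add: Comp_in_mterms_iff far_induced_functor)
next
  fix A assume "A \<in> mob P"
  then show "far induced_functor (mid P A) = mid K (fob induced_functor A)"
    "fob induced_functor A \<in> mob K"
    using far_induced_functor[of "Ident A"] by (simp_all add: mid_P induced_functor_def mterms.Ident ob)
qed (simp_all add: induced_functor_def)

end

text \<open>Uniqueness in the universal property: classes of terms are built from classes of
  generators by identities, composition and permutations, all of which functors preserve.\<close>

lemma (in multigraph) functor_eqI_generators:
  assumes F: "F \<in> symmetric_functors P K" and G: "G \<in> symmetric_functors P K"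
    and ob: "\<And>A. A \<in> gob S \<Longrightarrow> fob F A = fob G A"
    and gen: "\<And>g. g \<in> gar S \<Longrightarrow> far F (cls (Gen g)) = far G (cls (Gen g))"
  shows "F = G"
proof (rule functor_eqI[OF F G])
  have "far F (cls t) = far G (cls t)" if "t \<in> mterms S" for t
    using that
  proof (induction rule: mterms.induct)
    case (Ident A)
    then show ?case
      using functor_mid[OF F, of A] functor_mid[OF G, of A] ob by (simp add: mid_P)
  next
    case (Comp t us)
    then have Ct: "Comp t us \<in> mterms S" by (blast intro: mterms.Comp)
    then have "composable P (cls t) (map cls us)"
      using composable_cls_iff by (simp add: Comp_in_mterms_iff)
    moreover have "map (far F) (map cls us) = map (far G) (map cls us)"
      using Comp by simp
    ultimately show ?case
      using functor_mcomp[OF F, of "cls t" "map cls us"] functor_mcomp[OF G, of "cls t" "map cls us"] Comp.IH(1)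
      by (simp add: mcomp_cls[OF Ct] del: map_map map_eq_conv)
  next
    case (Perm t s)
    then have "Perm s t \<in> mterms S" by (blast intro: mterms.Perm)
    then show ?case
      using functor_mact[OF F, of "cls t" s] functor_mact[OF G, of "cls t" s] Perm
      by (simp add: cls_mar mdom_cls mact_cls)
  qed (rule gen)
  then show "far F f = far G f" if "f \<in> mar P" for f
    using that by (auto simp: mar_P)
qed (simp add: ob)


section \<open>Functors out of \<open>C\<^sub>\<triangleright> \<times> N\<close>\<close>

lemma composable_smcat_prodI:
  assumes "composable M (fst p) (map fst qs)" "composable N (snd p) (map snd qs)"
    and "arity M (fst p) = arity N (snd p)" "\<And>q. q \<in> set qs \<Longrightarrow> arity M (fst q) = arity N (snd q)"
  shows "composable (M \<times>\<^sub>m N) p qs"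
proof -
  have "map (mcod (M \<times>\<^sub>m N)) qs = zip (map (mcod M) (map fst qs)) (map (mcod N) (map snd qs))"
    by (rule nth_equalityI) simp_all
  also have "\<dots> = mdom (M \<times>\<^sub>m N) p"
    using assms(1,2) by (simp add: composable_def)
  moreover have "q \<in> mar (M \<times>\<^sub>m N)" if "q \<in> set qs" for q
    using assms(1,2) assms(4)[OF that] that by (auto simp: composable_def)
  ultimately show ?thesis
    using assms(1-3) by (simp add: composable_def subset_iff del: smcat_prod_simps(3,4))
qed

text \<open>Links two conventions: \<open>pairing\<close> takes the factor
  \<open>C\<^sub>\<triangleright>\<close> first, whereas \<open>evaluation\<close> takes it
  second.\<close>

lemma swap_functor_in:
  assumes "symmetric_multicategory M" "symmetric_multicategory N"
  shows "\<lparr>fob = restrict prod.swap (mob (M \<times>\<^sub>m N)), far = restrict prod.swap (mar (M \<times>\<^sub>m N))\<rparr>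
    \<in> symmetric_functors (M \<times>\<^sub>m N) (N \<times>\<^sub>m M)" (is "?F \<in> _")
proof -
  interpret MN: symmetric_multicategory "M \<times>\<^sub>m N"
    using assms by (rule symmetric_multicategory_smcat_prod)
  show ?thesis
  proof (rule symmetric_functorsI)
    fix p assume p: "p \<in> mar (M \<times>\<^sub>m N)"
    have "map (fob ?F) (mdom (M \<times>\<^sub>m N) p) = map prod.swap (mdom (M \<times>\<^sub>m N) p)"
      using MN.dom_ob[OF p] by (intro map_cong) auto
    also have "\<dots> = mdom (N \<times>\<^sub>m M) (far ?F p)"
      using p by (auto intro!: nth_equalityI)
    finally show "mdom (N \<times>\<^sub>m M) (far ?F p) = map (fob ?F) (mdom (M \<times>\<^sub>m N) p)" ..
    show "mcod (N \<times>\<^sub>m M) (far ?F p) = fob ?F (mcod (M \<times>\<^sub>m N) p)"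
      using p MN.cod_ob[OF p] by auto
    fix s assume "s permutes {..<arity (M \<times>\<^sub>m N) p}"
    then show "far ?F (mact (M \<times>\<^sub>m N) s p) = mact (N \<times>\<^sub>m M) s (far ?F p)"
      using p MN.act_mar[OF p] by auto
  next
    fix p qs assume pqs: "composable (M \<times>\<^sub>m N) p qs"
    then have swap: "map (far ?F) qs = map prod.swap qs"
      by (intro map_cong) (auto simp: composable_def)
    show "far ?F (mcomp (M \<times>\<^sub>m N) p qs) = mcomp (N \<times>\<^sub>m M) (far ?F p) (map (far ?F) qs)"
      unfolding swap using composable_arD[OF pqs] MN.comp_mar[OF pqs] by (auto simp: comp_def)
  next
    fix A assume "A \<in> mob (M \<times>\<^sub>m N)"
    then show "far ?F (mid (M \<times>\<^sub>m N) A) = mid (N \<times>\<^sub>m M) (fob ?F A)"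
      using MN.id_mar[of A] by auto
  qed auto
qed

text \<open>A functor out of \<open>C\<^sup>- \<otimes> N\<close> in unbundled form: functorial in both arguments, subject to the
  interchange law, which for a unary \<open>f\<close> involves no permutation.\<close>

locale bimorphism =
  C: category C + N: symmetric_multicategory N + P: symmetric_multicategory P
  for C :: "('c, 'ca) cat" and N :: "('o, 'a) smcat" and P :: "('p, 'b) smcat" +
  fixes ob :: "'c \<Rightarrow> 'o \<Rightarrow> 'p" and l :: "'ca \<Rightarrow> 'o \<Rightarrow> 'b" and r :: "'a \<Rightarrow> 'c \<Rightarrow> 'b"
  assumes ob: "\<lbrakk>X \<in> cob C; A \<in> mob N\<rbrakk> \<Longrightarrow> ob X A \<in> mob P"
    and left_ar: "\<lbrakk>f \<in> car C; A \<in> mob N\<rbrakk> \<Longrightarrow>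
      l f A \<in> mar P \<and> mdom P (l f A) = [ob (cdom C f) A] \<and> mcod P (l f A) = ob (ccod C f) A"
    and left_id: "\<lbrakk>X \<in> cob C; A \<in> mob N\<rbrakk> \<Longrightarrow> l (cid C X) A = mid P (ob X A)"
    and left_comp: "\<lbrakk>f \<in> car C; g \<in> car C; ccod C g = cdom C f; A \<in> mob N\<rbrakk> \<Longrightarrow>
      l (ccomp C f g) A = mcomp P (l f A) [l g A]"
    and right_ar: "\<lbrakk>h \<in> mar N; X \<in> cob C\<rbrakk> \<Longrightarrow>
      r h X \<in> mar P \<and> mdom P (r h X) = map (ob X) (mdom N h) \<and> mcod P (r h X) = ob X (mcod N h)"
    and right_id: "\<lbrakk>X \<in> cob C; A \<in> mob N\<rbrakk> \<Longrightarrow> r (mid N A) X = mid P (ob X A)"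
    and right_comp: "\<lbrakk>composable N h ks; X \<in> cob C\<rbrakk> \<Longrightarrow>
      r (mcomp N h ks) X = mcomp P (r h X) (map (\<lambda>k. r k X) ks)"
    and right_act: "\<lbrakk>h \<in> mar N; s permutes {..<arity N h}; X \<in> cob C\<rbrakk> \<Longrightarrow>
      r (mact N s h) X = mact P s (r h X)"
    and interchange: "\<lbrakk>f \<in> car C; h \<in> mar N\<rbrakk> \<Longrightarrow>
      mcomp P (l f (mcod N h)) [r h (cdom C f)] = mcomp P (r h (ccod C f)) (map (l f) (mdom N h))"
begin

definition pairing :: "('c \<times> 'ca list) \<times> 'a \<Rightarrow> 'b" where
  "pairing p = mcomp P (r (snd p) (fst (fst p))) (map2 l (snd (fst p)) (mdom N (snd p)))"

definition pairing_functor :: "('c \<times> 'o, ('c \<times> 'ca list) \<times> 'a, 'p, 'b) mfunctor" where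
  "pairing_functor =
    \<lparr>fob = restrict (\<lambda>(X, A). ob X A) (mob (C\<^sub>\<triangleright> \<times>\<^sub>m N)), far = restrict pairing (mar (C\<^sub>\<triangleright> \<times>\<^sub>m N))\<rparr>"

section \<open>The functor induced by a bimorphism\<close>

lemma far_pairing_functor: "p \<in> mar (C\<^sub>\<triangleright> \<times>\<^sub>m N) \<Longrightarrow> far pairing_functor p = pairing p"
  by (simp only: pairing_functor_def mfunctor.simps restrict_apply if_True)

lemma left_nth:
  assumes "p \<in> mar (C\<^sub>\<triangleright> \<times>\<^sub>m N)" "i < length (snd (fst p))"
  shows "snd (fst p) ! i \<in> car C" "ccod C (snd (fst p) ! i) = fst (fst p)" "mdom N (snd p) ! i \<in> mob N"
  using assms N.dom_nth_ob[of "snd p" i] by auto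

lemma composable_pairing:
  assumes p: "p \<in> mar (C\<^sub>\<triangleright> \<times>\<^sub>m N)"
  shows "composable P (r (snd p) (fst (fst p))) (map2 l (snd (fst p)) (mdom N (snd p)))"
proof -
  have len: "length (mdom N (snd p)) = length (snd (fst p))" using p by simp
  note nth = left_nth[OF p]
  have "map (mcod P) (map2 l (snd (fst p)) (mdom N (snd p))) = map (ob (fst (fst p))) (mdom N (snd p))"
    by (rule nth_equalityI) (simp_all add: len nth left_ar)
  moreover have "set (map2 l (snd (fst p)) (mdom N (snd p))) \<subseteq> mar P"
    by (auto simp: set_zip len nth left_ar)
  ultimately show ?thesis
    using p by (simp add: composable_def right_ar)
qed

lemma pairing_ar:
  assumes p: "p \<in> mar (C\<^sub>\<triangleright> \<times>\<^sub>m N)"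
  shows "pairing p \<in> mar P"
    and "mdom P (pairing p) = map (\<lambda>(X, A). ob X A) (mdom (C\<^sub>\<triangleright> \<times>\<^sub>m N) p)"
    and "mcod P (pairing p) = ob (fst (fst p)) (mcod N (snd p))"
proof -
  have len: "length (mdom N (snd p)) = length (snd (fst p))" using p by simp
  have "map (mdom P) (map2 l (snd (fst p)) (mdom N (snd p))) =
      map (\<lambda>x. [x]) (map (\<lambda>(X, A). ob X A) (mdom (C\<^sub>\<triangleright> \<times>\<^sub>m N) p))"
    by (rule nth_equalityI) (simp_all add: len left_nth[OF p] left_ar)
  then show "mdom P (pairing p) = map (\<lambda>(X, A). ob X A) (mdom (C\<^sub>\<triangleright> \<times>\<^sub>m N) p)"
    unfolding pairing_def P.comp_mdom[OF composable_pairing[OF p]]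
    by (simp only: concat_map_singleton map_ident)
  show "pairing p \<in> mar P" "mcod P (pairing p) = ob (fst (fst p)) (mcod N (snd p))"
    unfolding pairing_def using P.comp_ar[OF composable_pairing[OF p]] p by (simp_all add: right_ar)
qed

text \<open>An arrow \<open>f\<close> of \<open>C\<close> applied after a pairing is absorbed into
  its sequence: interchange moves \<open>f\<close> past \<open>r k\<close>, which produces one copy
  of \<open>l f\<close> on each input, and each copy merges with the corresponding entry of
  \<open>gs\<close> by \<open>left_comp\<close>.\<close>

lemma left_comp_pairing:
  assumes q: "((Y, gs), k) \<in> mar (C\<^sub>\<triangleright> \<times>\<^sub>m N)" and f: "f \<in> car C" "cdom C f = Y"
  shows "mcomp P (l f (mcod N k)) [pairing ((Y, gs), k)] = pairing ((ccod C f, map (ccomp C f) gs), k)"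
    and "composable P (l f (mcod N k)) [pairing ((Y, gs), k)]"
proof -
  have k: "k \<in> mar N" and len: "length (mdom N k) = length gs" using q by simp_all
  note nth = left_nth[OF q, simplified]
  note q_comp = composable_pairing[OF q, simplified]
  have cf: "ccod C f \<in> cob C" using f by (simp add: C.cod_ob)
  show "composable P (l f (mcod N k)) [pairing ((Y, gs), k)]"
    using pairing_ar[OF q] f k by (simp add: composable_unary left_ar N.cod_ob)
  have lr: "composable P (l f (mcod N k)) [r k Y]"
    using right_ar[OF k] q f k by (simp add: composable_unary left_ar N.cod_ob)
  have rl: "composable P (r k (ccod C f)) (map (l f) (mdom N k))"
    using right_ar[OF k cf] left_ar[OF f(1)] N.dom_ob[OF k] by (auto simp: composable_def subset_iff)
  have "mcomp P (l f (mcod N k)) [pairing ((Y, gs), k)] =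
      mcomp P (mcomp P (l f (mcod N k)) [r k Y]) (map2 l gs (mdom N k))"
    using P.unary_comp_comp[OF lr q_comp] by (simp add: pairing_def)
  also have "\<dots> = mcomp P (mcomp P (r k (ccod C f)) (map (l f) (mdom N k))) (map2 l gs (mdom N k))"
    using interchange[OF f(1) k] f by simp
  also have "\<dots> = mcomp P (r k (ccod C f))
      (map2 (\<lambda>g h. mcomp P g [h]) (map (l f) (mdom N k)) (map2 l gs (mdom N k)))"
    by (rule P.comp_comp_unary[OF rl])
      (simp add: list_all2_conv_all_nth len composable_unary left_ar nth f)
  also have "map2 (\<lambda>g h. mcomp P g [h]) (map (l f) (mdom N k)) (map2 l gs (mdom N k)) =
      map2 l (map (ccomp C f) gs) (mdom N k)"
    by (rule nth_equalityI) (simp_all add: len left_comp nth f)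
  finally show "mcomp P (l f (mcod N k)) [pairing ((Y, gs), k)] = pairing ((ccod C f, map (ccomp C f) gs), k)"
    by (simp add: pairing_def)
qed

text \<open>In the composite of pairings each entry of \<open>fs\<close> is applied to a whole
  pairing and is absorbed there by \<open>left_comp_pairing\<close>. Afterwards all arrows of
  \<open>N\<close> sit at the single object \<open>X\<close>, so associativity brings them together
  for \<open>right_comp\<close>, while the remaining arrows of \<open>C\<close> are
  concatenated.\<close>

lemma pairing_comp:
  assumes pqs: "composable (C\<^sub>\<triangleright> \<times>\<^sub>m N) p qs"
  shows "pairing (mcomp (C\<^sub>\<triangleright> \<times>\<^sub>m N) p qs) = mcomp P (pairing p) (map pairing qs)"
proof -
  obtain X fs h where p_eq: "p = ((X, fs), h)" by (metis prod.collapse)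
  have p: "((X, fs), h) \<in> mar (C\<^sub>\<triangleright> \<times>\<^sub>m N)" using composable_arD[OF pqs] p_eq by simp
  note CN = composable_smcat_prodD(1,2)[OF pqs, unfolded p_eq fst_conv snd_conv]
  have len: "length qs = length fs" "length (mdom N h) = length fs"
    using composable_length[OF CN(1)] p by simp_all
  note p_nth = left_nth[OF p, simplified]
  have q: "qs ! i \<in> mar (C\<^sub>\<triangleright> \<times>\<^sub>m N)" "fst (fst (qs ! i)) = cdom C (fs ! i)"
    "mcod N (snd (qs ! i)) = mdom N h ! i" if "i < length fs" for i
    using composable_ar_nthD[OF pqs, of i] composable_cod_nthD[OF CN(1), of i]
      composable_cod_nthD[OF CN(2), of i] that len by simp_all
  have lq: "mcomp P (l (fs ! i) (mdom N h ! i)) [pairing (qs ! i)] =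
      pairing ((X, map (ccomp C (fs ! i)) (snd (fst (qs ! i)))), snd (qs ! i))"
    "composable P (l (fs ! i) (mdom N h ! i)) [pairing (qs ! i)]" if "i < length fs" for i
  proof -
    have "((fst (fst (qs ! i)), snd (fst (qs ! i))), snd (qs ! i)) \<in> mar (C\<^sub>\<triangleright> \<times>\<^sub>m N)"
      using q(1)[OF that] by (simp only: prod.collapse)
    note left_comp_pairing[OF this p_nth(1)[OF that] q(2)[OF that, symmetric]]
    then show "mcomp P (l (fs ! i) (mdom N h ! i)) [pairing (qs ! i)] =
        pairing ((X, map (ccomp C (fs ! i)) (snd (fst (qs ! i)))), snd (qs ! i))"
      "composable P (l (fs ! i) (mdom N h ! i)) [pairing (qs ! i)]"
      by (simp_all only: prod.collapse q(3)[OF that] p_nth(2)[OF that])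
  qed
  let ?gss = "map2 (\<lambda>f q. map (ccomp C f) (snd q)) fs (map fst qs)"
  let ?ks = "map snd qs"
  have q': "((X, ?gss ! i), ?ks ! i) \<in> mar (C\<^sub>\<triangleright> \<times>\<^sub>m N)" if "i < length fs" for i
    using q[OF that] p_nth[OF that] p that len by (auto simp: C.comp_ar subset_iff)
  have "mcomp P (pairing p) (map pairing qs) =
      mcomp P (r h X) (map2 (\<lambda>g h. mcomp P g [h]) (map2 l fs (mdom N h)) (map pairing qs))"
    unfolding p_eq pairing_def[of "((X, fs), h)"] fst_conv snd_conv
    by (rule P.comp_comp_unary[OF composable_pairing[OF p, unfolded fst_conv snd_conv]])
      (simp add: list_all2_conv_all_nth len lq)
  \<comment> \<open>After the absorption each entry is unfolded again as a pairing at
    \<open>X\<close>; this exposes the layer of arrows \<open>r k X\<close> that is to be composed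
    with \<open>r h X\<close>.\<close>
  also have "map2 (\<lambda>g h. mcomp P g [h]) (map2 l fs (mdom N h)) (map pairing qs) =
      map2 (mcomp P) (map (\<lambda>k. r k X) ?ks) (map2 (map2 l) ?gss (map (mdom N) ?ks))"
    by (rule nth_equalityI) (simp_all add: len lq pairing_def[of "((X, _), _)"])
  also have "mcomp P (r h X) \<dots> =
      mcomp P (mcomp P (r h X) (map (\<lambda>k. r k X) ?ks)) (concat (map2 (map2 l) ?gss (map (mdom N) ?ks)))"
  proof (rule P.assoc[symmetric])
    show "composable P (r h X) (map (\<lambda>k. r k X) ?ks)"
    proof -
      have ks: "\<And>k. k \<in> set ?ks \<Longrightarrow> k \<in> mar N" and X: "X \<in> cob C"
        using CN(2) p by (auto simp: composable_def)
      then have "map (mcod P) (map (\<lambda>k. r k X) ?ks) = map (ob X) (map (mcod N) ?ks)"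
        by (auto simp: right_ar)
      also have "\<dots> = mdom P (r h X)"
        using CN(2) X by (simp add: composable_def right_ar)
      finally have "map (mcod P) (map (\<lambda>k. r k X) ?ks) = mdom P (r h X)" .
      moreover have "set (map (\<lambda>k. r k X) ?ks) \<subseteq> mar P"
        using right_ar[OF ks X] by (simp only: set_map image_subset_iff) blast
      ultimately show ?thesis
        using X composable_arD[OF CN(2)] unfolding composable_def by (simp add: right_ar del: map_map)
    qed
    show "list_all2 (composable P) (map (\<lambda>k. r k X) ?ks) (map2 (map2 l) ?gss (map (mdom N) ?ks))"
      using composable_pairing[OF q'] by (simp add: list_all2_conv_all_nth len)
  qed
  \<comment> \<open>The rows of \<open>?gss\<close> match the domains of \<open>?ks\<close> in
    length because the two components of each member of \<open>qs\<close> have equal arity.\<close>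
  also have "concat (map2 (map2 l) ?gss (map (mdom N) ?ks)) = map2 l (concat ?gss) (concat (map (mdom N) ?ks))"
    by (rule map2_concat[symmetric]) (use q(1) in \<open>simp add: list_all2_conv_all_nth len\<close>)
  finally show ?thesis
    using right_comp[OF CN(2)] N.comp_mdom[OF CN(2)] p
    by (simp add: pairing_def[of "((X, _), _)"] p_eq)
qed

text \<open>The arrows \<open>l f A\<close> are unary, so permuting the inputs of the
  \<open>r\<close>-arrow does not inflate to a block permutation of the composite.\<close>

lemma pairing_act:
  assumes p: "p \<in> mar (C\<^sub>\<triangleright> \<times>\<^sub>m N)" and s: "s permutes {..<arity (C\<^sub>\<triangleright> \<times>\<^sub>m N) p}"
  shows "pairing (mact (C\<^sub>\<triangleright> \<times>\<^sub>m N) s p) = mact P s (pairing p)"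
proof -
  have len: "length (mdom N (snd p)) = length (snd (fst p))" using p by simp
  have s': "s permutes {..<length (snd (fst p))}" using s len by simp
  have unary: "\<forall>g \<in> set (map2 l (snd (fst p)) (mdom N (snd p))). arity P g = 1"
    by (auto simp: set_zip len left_nth[OF p] left_ar)
  have "pairing (mact (C\<^sub>\<triangleright> \<times>\<^sub>m N) s p) =
      mcomp P (mact P s (r (snd p) (fst (fst p)))) (permute_list s (map2 l (snd (fst p)) (mdom N (snd p))))"
    using p s' len by (simp add: pairing_def right_act N.act_mdom permute_list_map2)
  also have "\<dots> = mact P s (pairing p)"
    unfolding pairing_def
    by (rule P.act_comp_unary[OF composable_pairing[OF p] _ unary]) (simp add: len s')
  finally show ?thesis .
qed

lemma pairing_id:
  assumes "X \<in> cob C" "A \<in> mob N"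
  shows "pairing (mid (C\<^sub>\<triangleright> \<times>\<^sub>m N) (X, A)) = mid P (ob X A)"
  using assms P.id_left[of "mid P (ob X A)"]
  by (simp add: pairing_def right_id left_id N.id_mdom P.id_ar ob)

lemma pairing_functor_in: "pairing_functor \<in> symmetric_functors (C\<^sub>\<triangleright> \<times>\<^sub>m N) P"
proof -
  interpret CN: symmetric_multicategory "C\<^sub>\<triangleright> \<times>\<^sub>m N"
    by (intro symmetric_multicategory_smcat_prod symmetric_multicategory_sequence_mcat
        C.category_axioms N.symmetric_multicategory_axioms)
  show ?thesis
  proof (rule symmetric_functorsI)
    fix p assume p: "p \<in> mar (C\<^sub>\<triangleright> \<times>\<^sub>m N)"
    have "map (fob pairing_functor) (mdom (C\<^sub>\<triangleright> \<times>\<^sub>m N) p) = map (\<lambda>(X, A). ob X A) (mdom (C\<^sub>\<triangleright> \<times>\<^sub>m N) p)"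
      using CN.dom_ob[OF p] by (intro map_cong) (auto simp: pairing_functor_def)
    then show "mdom P (far pairing_functor p) = map (fob pairing_functor) (mdom (C\<^sub>\<triangleright> \<times>\<^sub>m N) p)"
      using p pairing_ar(2)[OF p] by (simp add: pairing_functor_def)
    show "far pairing_functor p \<in> mar P"
      "mcod P (far pairing_functor p) = fob pairing_functor (mcod (C\<^sub>\<triangleright> \<times>\<^sub>m N) p)"
      using p pairing_ar[OF p] CN.cod_ob[OF p] by (simp_all add: pairing_functor_def)
    fix s assume "s permutes {..<arity (C\<^sub>\<triangleright> \<times>\<^sub>m N) p}"
    then show "far pairing_functor (mact (C\<^sub>\<triangleright> \<times>\<^sub>m N) s p) = mact P s (far pairing_functor p)"
      using p pairing_act[OF p] CN.act_mar[OF p] by (simp only: far_pairing_functor)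
  next
    fix p qs assume pqs: "composable (C\<^sub>\<triangleright> \<times>\<^sub>m N) p qs"
    then have "map (far pairing_functor) qs = map pairing qs"
      by (intro map_cong HOL.refl far_pairing_functor) (auto simp only: composable_def)
    then show "far pairing_functor (mcomp (C\<^sub>\<triangleright> \<times>\<^sub>m N) p qs) =
        mcomp P (far pairing_functor p) (map (far pairing_functor) qs)"
      using pairing_comp[OF pqs] CN.comp_mar[OF pqs] composable_arD[OF pqs]
      by (simp only: far_pairing_functor)
  next
    fix A assume A: "A \<in> mob (C\<^sub>\<triangleright> \<times>\<^sub>m N)"
    then show "far pairing_functor (mid (C\<^sub>\<triangleright> \<times>\<^sub>m N) A) = mid P (fob pairing_functor A)"
      using pairing_id[of "fst A" "snd A"] CN.id_mar[OF A]
      by (auto simp: pairing_functor_def)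
    show "fob pairing_functor A \<in> mob P"
      using A ob by (auto simp: pairing_functor_def)
  qed (simp_all add: pairing_functor_def)
qed

end

section \<open>Evaluation on the internal hom\<close>

context hom_from_category
begin

text \<open>The left laws are functoriality of each \<open>F\<close>, the right laws are the
  pointwise structure of the hom, and interchange is the naturality square.\<close>

lemma bimorphism_evaluation:
  "bimorphism C H N (\<lambda>X F. fob F X) (\<lambda>f F. far F f) (\<lambda>p X. snd (snd p) X)"
proof -
  interpret H: symmetric_multicategory H by (rule symmetric_multicategory_hom)
  show ?thesis
    by unfold_locales
      (auto simp: internal_hom_simps functor_simps component naturality)
qed

lemma far_evaluation:
  assumes "p \<in> mar H" "q \<in> mar (C\<^sub>\<triangleright>)" "length (snd q) = length (fst p)"
  shows "far (evaluation C N) (p, q) = mcomp N (snd (snd p) (fst q)) (map2 far (fst p) (snd q))"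
  using assms by (simp add: evaluation_def internal_hom_simps case_prod_unfold)

lemma fob_evaluation:
  "F \<in> symmetric_functors (C\<^sup>-) N \<Longrightarrow> X \<in> cob C \<Longrightarrow> fob (evaluation C N) (F, X) = fob F X"
  by (simp add: evaluation_def internal_hom_simps)

lemma evaluation_in: "evaluation C N \<in> symmetric_functors (H \<times>\<^sub>m C\<^sub>\<triangleright>) N"
proof -
  interpret bimorphism C H N "\<lambda>X F. fob F X" "\<lambda>f F. far F f" "\<lambda>p X. snd (snd p) X"
    by (rule bimorphism_evaluation)
  have mcats: "symmetric_multicategory H" "symmetric_multicategory (C\<^sub>\<triangleright>)"
    using symmetric_multicategory_hom symmetric_multicategory_sequence_mcat[OF C.category_axioms] by auto
  let ?swap = "\<lparr>fob = restrict prod.swap (mob (H \<times>\<^sub>m C\<^sub>\<triangleright>)), far = restrict prod.swap (mar (H \<times>\<^sub>m C\<^sub>\<triangleright>))\<rparr>"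
  have "functor_comp (H \<times>\<^sub>m C\<^sub>\<triangleright>) pairing_functor ?swap \<in> symmetric_functors (H \<times>\<^sub>m C\<^sub>\<triangleright>) N"
    by (intro functor_comp_in[OF _ swap_functor_in pairing_functor_in]
        symmetric_multicategory_smcat_prod mcats)
  moreover have "functor_comp (H \<times>\<^sub>m C\<^sub>\<triangleright>) pairing_functor ?swap = evaluation C N"
  proof -
    \<comment> \<open>\<open>pairing\<close> zips the sequence with the functors,
      \<open>evaluation\<close> the functors with the sequence.\<close>
    have "map2 (\<lambda>f F. far F f) fs Fs = map2 far Fs fs" for fs and Fs :: "('c, 'ca, 'o, 'a) mfunctor list"
      by (subst zip_commute) (simp add: case_prod_unfold comp_def)
    then show ?thesis
      by (auto simp: functor_comp_def pairing_functor_def pairing_def evaluation_def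
          internal_hom_simps case_prod_unfold intro!: restrict_ext)
  qed
  ultimately show ?thesis by simp
qed

end


section \<open>The exponential\<close>

text \<open>Identity sequences pair an object \<open>X\<close> of \<open>C\<close> with an
  \<open>n\<close>-ary arrow of another multicategory, where arities have to agree; for
  \<open>n = 0\<close> this is the empty sequence over \<open>X\<close>.\<close>

definition id_seq :: "('o, 'a) cat \<Rightarrow> 'o \<Rightarrow> nat \<Rightarrow> 'o \<times> 'a list" where
  "id_seq C X n = (X, replicate n (cid C X))"

context category
begin

section \<open>Composition with identity sequences\<close>

lemma id_seq_mar: "X \<in> cob C \<Longrightarrow> id_seq C X n \<in> mar (C\<^sub>\<triangleright>)"
  by (auto simp: id_seq_def id_ar)

lemma composable_id_seq:
  assumes "X \<in> cob C" "\<And>q. q \<in> set qs \<Longrightarrow> q \<in> mar (C\<^sub>\<triangleright>) \<and> fst q = X" "length qs = n"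
  shows "composable (C\<^sub>\<triangleright>) (id_seq C X n) qs"
proof -
  have "map (mcod (C\<^sub>\<triangleright>)) qs = mdom (C\<^sub>\<triangleright>) (id_seq C X n)"
    using assms by (intro nth_equalityI) (simp_all add: id_seq_def id_ar)
  then show ?thesis
    using assms id_seq_mar unfolding composable_def by blast
qed

text \<open>The left unit law of \<open>C\<close> leaves every entry alone, so composing with
  identities is plain concatenation.\<close>

lemma comp_id_seq:
  assumes "X \<in> cob C" "\<And>q. q \<in> set qs \<Longrightarrow> q \<in> mar (C\<^sub>\<triangleright>) \<and> fst q = X" "length qs = n"
  shows "mcomp (C\<^sub>\<triangleright>) (id_seq C X n) qs = (X, concat (map snd qs))"
proof -
  have "map (ccomp C (cid C X)) (snd q) = snd q" if "q \<in> set qs" for q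
    using assms(2)[OF that] id_left by (force intro: map_idI)
  then have "map2 (\<lambda>f q. map (ccomp C f) (snd q)) (replicate n (cid C X)) qs = map snd qs"
    using assms(3) by (intro nth_equalityI) simp_all
  then show ?thesis by (simp add: id_seq_def)
qed

text \<open>Lengths of identity sequences add up in the same way as arities do in a composite. This
  is the reason why transposing a functor preserves composites.\<close>

lemma comp_id_seq_id_seq:
  assumes "X \<in> cob C"
  shows "mcomp (C\<^sub>\<triangleright>) (id_seq C X (length ns)) (map (id_seq C X) ns) = id_seq C X (sum_list ns)"
proof -
  have replicate: "concat (map (\<lambda>n. replicate n x) ns) = replicate (sum_list ns) x" for x :: 'a
    by (induction ns) (simp_all add: replicate_add)
  have id_seqs: "q \<in> mar (C\<^sub>\<triangleright>) \<and> fst q = X" if "q \<in> set (map (id_seq C X) ns)" for q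
    using that assms by (auto simp: id_seq_def id_ar)
  have "mcomp (C\<^sub>\<triangleright>) (id_seq C X (length ns)) (map (id_seq C X) ns) =
      (X, concat (map snd (map (id_seq C X) ns)))"
    by (rule comp_id_seq[OF assms id_seqs]) simp_all
  also have "\<dots> = id_seq C X (sum_list ns)"
    by (simp add: id_seq_def comp_def replicate)
  finally show ?thesis .
qed

lemma comp_unary_id_seq:
  assumes "f \<in> car C"
  shows "mcomp (C\<^sub>\<triangleright>) (ccod C f, [f]) [id_seq C (cdom C f) n] = (ccod C f, replicate n f)"
  using assms by (simp add: id_seq_def id_right)

end

locale exponential_transpose =
  hom_from_category C N + L: symmetric_multicategory L
  for C :: "('c, 'ca) cat" and N :: "('o, 'a) smcat" and L :: "('l, 'k) smcat" +
  fixes G :: "('l \<times> 'c, 'k \<times> ('c \<times> 'ca list), 'o, 'a) mfunctor"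
  assumes G: "G \<in> symmetric_functors (L \<times>\<^sub>m C\<^sub>\<triangleright>) N"
begin

text \<open>The formulas for the transpose are dictated by evaluation: the identity of
  \<open>A\<close> paired with \<open>[f]\<close> must evaluate to the functor at \<open>A\<close>
  applied to \<open>f\<close>, and an arrow \<open>p\<close> paired with identities of
  \<open>X\<close> must evaluate to its component at \<open>X\<close>.\<close>

definition transpose_ob :: "'l \<Rightarrow> ('c, 'ca, 'o, 'a) mfunctor" where
  "transpose_ob A = \<lparr>fob = (\<lambda>X \<in> cob C. fob G (A, X)),
    far = (\<lambda>f \<in> car C. far G (mid L A, (ccod C f, [f])))\<rparr>"

definition transpose_ar :: "'k \<Rightarrow> ('c, 'ca, 'o, 'a) hom_arrow" where
  "transpose_ar p = (map transpose_ob (mdom L p), transpose_ob (mcod L p),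
    \<lambda>X \<in> cob C. far G (p, id_seq C X (arity L p)))"

definition transpose :: "('l, 'k, ('c, 'ca, 'o, 'a) mfunctor, ('c, 'ca, 'o, 'a) hom_arrow) mfunctor" where
  "transpose = \<lparr>fob = restrict transpose_ob (mob L), far = restrict transpose_ar (mar L)\<rparr>"

section \<open>Currying a functor out of
  \<open>L \<times>\<^sub>m C\<^sub>\<triangleright>\<close>\<close>

lemma G_ar:
  assumes "p \<in> mar L" "q \<in> mar (C\<^sub>\<triangleright>)" "length (snd q) = arity L p"
  shows "far G (p, q) \<in> mar N"
    and "mdom N (far G (p, q)) = map (fob G) (zip (mdom L p) (map (cdom C) (snd q)))"
    and "mcod N (far G (p, q)) = fob G (mcod L p, fst q)"
  using assms functor_mar[OF G, of "(p, q)"] functor_mdom[OF G, of "(p, q)"] functor_mcod[OF G, of "(p, q)"]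
  by auto

lemma G_ob: "A \<in> mob L \<Longrightarrow> X \<in> cob C \<Longrightarrow> fob G (A, X) \<in> mob N"
  using functor_ob[OF G, of "(A, X)"] by simp

lemma G_id: "A \<in> mob L \<Longrightarrow> X \<in> cob C \<Longrightarrow> far G (mid L A, (X, [cid C X])) = mid N (fob G (A, X))"
  using functor_mid[OF G, of "(A, X)"] by simp

lemma G_comp:
  assumes "composable L p (map fst qs)" "composable (C\<^sub>\<triangleright>) r (map snd qs)" "arity L p = length (snd r)"
    and "\<And>q. q \<in> set qs \<Longrightarrow> arity L (fst q) = length (snd (snd q))"
  shows "far G (mcomp L p (map fst qs), mcomp (C\<^sub>\<triangleright>) r (map snd qs)) =
      mcomp N (far G (p, r)) (map (far G) qs)"
    and "composable N (far G (p, r)) (map (far G) qs)"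
proof -
  have "composable (L \<times>\<^sub>m C\<^sub>\<triangleright>) (p, r) qs"
    using assms by (intro composable_smcat_prodI) simp_all
  from functor_mcomp[OF G this] functor_composable[OF G this]
  show "far G (mcomp L p (map fst qs), mcomp (C\<^sub>\<triangleright>) r (map snd qs)) =
      mcomp N (far G (p, r)) (map (far G) qs)"
    and "composable N (far G (p, r)) (map (far G) qs)"
    by (simp_all only: smcat_prod_simps fst_conv snd_conv)
qed

text \<open>The partner of \<open>f\<close> in \<open>L\<close> is an identity, so postcomposition
  changes only the sequence and leaves \<open>p\<close> alone.\<close>

lemma G_unary_comp:
  assumes p: "p \<in> mar L" and q: "(Y, gs) \<in> mar (C\<^sub>\<triangleright>)" "length gs = arity L p"
    and f: "f \<in> car C" "cdom C f = Y"
  shows "mcomp N (far G (mid L (mcod L p), (ccod C f, [f]))) [far G (p, (Y, gs))] =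
    far G (p, (ccod C f, map (ccomp C f) gs))"
proof -
  have "composable (C\<^sub>\<triangleright>) (ccod C f, [f]) [(Y, gs)]"
    using q f by (simp add: composable_unary C.cod_ob)
  then show ?thesis
    using G_comp(1)[of "mid L (mcod L p)" "[(p, (Y, gs))]" "(ccod C f, [f])"] p q
    by (simp add: L.composable_id L.id_left L.id_mdom L.cod_ob)
qed

text \<open>The decomposition is the right unit law in \<open>L\<close> and
  \<open>comp_id_seq\<close> in \<open>C\<^sub>\<triangleright>\<close>; each inner factor pairs an
  identity with a one-element sequence, so its arities agree.\<close>

lemma G_decompose:
  assumes p: "p \<in> mar L" and q: "(X, fs) \<in> mar (C\<^sub>\<triangleright>)" "length fs = arity L p"
  shows "far G (p, (X, fs)) = mcomp N (far G (p, id_seq C X (arity L p)))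
    (map2 (\<lambda>A f. far G (mid L A, (X, [f]))) (mdom L p) fs)"
proof -
  let ?qs = "map2 (\<lambda>A f. (mid L A, (X, [f]))) (mdom L p) fs"
  have X: "X \<in> cob C" using q by simp
  have fst_qs: "map fst ?qs = map (mid L) (mdom L p)"
    using q(2) by (intro nth_equalityI) simp_all
  have snd_qs: "map snd ?qs = map (\<lambda>f. (X, [f])) fs"
    using q(2) by (intro nth_equalityI) simp_all
  have fs: "r \<in> mar (C\<^sub>\<triangleright>) \<and> fst r = X" if "r \<in> set (map snd ?qs)" for r
    using that q unfolding snd_qs by auto
  have len: "length (map snd ?qs) = arity L p"
    using q(2) by simp
  have "concat (map snd (map snd ?qs)) = fs"
    unfolding snd_qs by (simp add: comp_def)
  then have "mcomp (C\<^sub>\<triangleright>) (id_seq C X (arity L p)) (map snd ?qs) = (X, fs)"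
    by (simp only: C.comp_id_seq[OF X fs len])
  moreover have "composable (C\<^sub>\<triangleright>) (id_seq C X (arity L p)) (map snd ?qs)"
    using q(2) by (intro C.composable_id_seq[OF X fs]) simp_all
  moreover have "composable L p (map fst ?qs)" "mcomp L p (map fst ?qs) = p"
    unfolding fst_qs using L.composable_ids[OF p] L.id_right[OF p] .
  moreover have "arity L (fst q) = length (snd (snd q))" if "q \<in> set ?qs" for q
    using that q(2) L.dom_nth_ob[OF p] by (auto simp: set_zip L.id_mdom)
  ultimately have "far G (p, (X, fs)) = mcomp N (far G (p, id_seq C X (arity L p))) (map (far G) ?qs)"
    using G_comp(1)[of p ?qs "id_seq C X (arity L p)"] by (simp add: id_seq_def)
  also have "map (far G) ?qs = map2 (\<lambda>A f. far G (mid L A, (X, [f]))) (mdom L p) fs"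
    by (simp add: case_prod_unfold comp_def)
  finally show ?thesis .
qed

lemma transpose_ob_simps:
  "X \<in> cob C \<Longrightarrow> fob (transpose_ob A) X = fob G (A, X)"
  "f \<in> car C \<Longrightarrow> far (transpose_ob A) f = far G (mid L A, (ccod C f, [f]))"
  by (simp_all add: transpose_ob_def)

lemma transpose_ob_in:
  assumes A: "A \<in> mob L"
  shows "transpose_ob A \<in> symmetric_functors (C\<^sup>-) N"
proof (rule symmetric_functorsI)
  fix f gs assume "composable (C\<^sup>-) f gs"
  then obtain g where g: "gs = [g]" "f \<in> car C" "g \<in> car C" "ccod C g = cdom C f"
    by (auto simp: composable_unary_mcat)
  then show "far (transpose_ob A) (mcomp (C\<^sup>-) f gs) =
      mcomp N (far (transpose_ob A) f) (map (far (transpose_ob A)) gs)"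
    using G_unary_comp[of "mid L A" "cdom C f" "[g]" f] A
    by (simp add: transpose_ob_simps C.comp_ar L.id_ar C.dom_ob)
next
  fix f s assume f: "f \<in> mar (C\<^sup>-)" and s: "s permutes {..<arity (C\<^sup>-) f}"
  have "far G (mid L A, (ccod C f, [f])) \<in> mar N"
    using G_ar(1)[of "mid L A" "(ccod C f, [f])"] f A by (simp add: L.id_ar C.cod_ob)
  then show "far (transpose_ob A) (mact (C\<^sup>-) s f) = mact N s (far (transpose_ob A) f)"
    using f s by (simp add: transpose_ob_simps N.act_id)
next
  fix f assume f: "f \<in> mar (C\<^sup>-)"
  then show "far (transpose_ob A) f \<in> mar N"
    "mdom N (far (transpose_ob A) f) = map (fob (transpose_ob A)) (mdom (C\<^sup>-) f)"
    "mcod N (far (transpose_ob A) f) = fob (transpose_ob A) (mcod (C\<^sup>-) f)"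
    using G_ar[of "mid L A" "(ccod C f, [f])"] A
    by (simp_all add: transpose_ob_simps L.id_ar C.cod_ob C.dom_ob)
qed (simp_all add: transpose_ob_simps G_ob G_id A C.id_ar, simp_all add: transpose_ob_def)

text \<open>Both sides of the naturality square for \<open>f\<close> equal \<open>G\<close> at
  \<open>p\<close> paired with the constant sequence \<open>[f, ..., f]\<close>: one by
  \<open>G_unary_comp\<close> applied to identities, the other by
  \<open>G_decompose\<close>.\<close>

lemma transpose_ar_mar:
  assumes p: "p \<in> mar L"
  shows "transpose_ar p \<in> mar H"
proof -
  have id_seq: "id_seq C X (arity L p) \<in> mar (C\<^sub>\<triangleright>)" "length (snd (id_seq C X (arity L p))) = arity L p"
    "map (cdom C) (snd (id_seq C X (arity L p))) = replicate (arity L p) X"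
    "fst (id_seq C X (arity L p)) = X" if "X \<in> cob C" for X
    using that by (auto simp: id_seq_def C.id_ar)
  have dom: "mdom N (far G (p, id_seq C X (arity L p))) = map (\<lambda>A. fob G (A, X)) (mdom L p)" if "X \<in> cob C" for X
    using G_ar(2)[OF p id_seq(1,2)] id_seq(3) that by (intro nth_equalityI) simp_all
  have "mcomp N (far G (mid L (mcod L p), ccod C f, [f])) [far G (p, id_seq C (cdom C f) (arity L p))] =
      mcomp N (far G (p, id_seq C (ccod C f) (arity L p))) (map (\<lambda>A. far G (mid L A, ccod C f, [f])) (mdom L p))"
    if f: "f \<in> car C" for f
  proof -
    have "map2 (\<lambda>A g. far G (mid L A, ccod C f, [g])) (mdom L p) (replicate (arity L p) f) =
        map (\<lambda>A. far G (mid L A, ccod C f, [f])) (mdom L p)"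
      by (rule nth_equalityI) simp_all
    then show ?thesis
      using G_unary_comp[OF p id_seq(1)[OF C.dom_ob[OF f], unfolded id_seq_def] _ f]
        G_decompose[OF p, of "ccod C f" "replicate (arity L p) f"] f
      by (simp add: id_seq_def C.id_right C.cod_ob set_replicate_conv_if)
  qed
  then show ?thesis
    unfolding mar_iff
    using p L.dom_ob[OF p] L.cod_ob[OF p] G_ar[OF p id_seq(1,2)] dom id_seq(4)
    by (auto simp: transpose_ar_def transpose_ob_in transpose_ob_simps C.dom_ob C.cod_ob comp_def)
qed

text \<open>Composites are preserved because identity sequences compose to identity sequences, and
  the action is preserved because a constant sequence is fixed by every permutation.\<close>

lemma transpose_in: "transpose \<in> symmetric_functors L H"
proof (rule symmetric_functorsI)
  fix p assume p: "p \<in> mar L"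
  show "far transpose p \<in> mar H"
    using p transpose_ar_mar by (simp add: transpose_def)
  show "mdom H (far transpose p) = map (fob transpose) (mdom L p)"
    using p L.dom_ob[OF p] by (auto simp: transpose_def transpose_ar_def internal_hom_simps)
  show "mcod H (far transpose p) = fob transpose (mcod L p)"
    using p L.cod_ob[OF p] by (simp add: transpose_def transpose_ar_def internal_hom_simps)
  fix s assume s: "s permutes {..<arity L p}"
  have "far G (mact L s p, id_seq C X (arity L p)) = mact N s (far G (p, id_seq C X (arity L p)))"
    if "X \<in> cob C" for X
    using functor_mact[OF G, of "(p, id_seq C X (arity L p))" s] p s that
    by (simp add: id_seq_def C.id_ar permute_list_replicate set_replicate_conv_if)
  then show "far transpose (mact L s p) = mact H s (far transpose p)"
    using p s
    by (auto simp: transpose_def transpose_ar_def internal_hom_simps L.act_ar permute_list_map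
        intro!: restrict_ext)
next
  fix p qs assume pqs: "composable L p qs"
  have qs: "q \<in> mar L" if "q \<in> set qs" for q using pqs that by (auto simp: composable_def)
  have "far G (mcomp L p qs, id_seq C X (arity L (mcomp L p qs))) =
      mcomp N (far G (p, id_seq C X (arity L p))) (map (\<lambda>q. far G (q, id_seq C X (arity L q))) qs)"
    if X: "X \<in> cob C" for X
  proof -
    let ?qs = "map (\<lambda>q. (q, id_seq C X (arity L q))) qs"
    have fst_qs: "map fst ?qs = qs" by (simp add: comp_def)
    have snd_qs: "map snd ?qs = map (id_seq C X) (map (arity L) qs)" by simp
    have "composable (C\<^sub>\<triangleright>) (id_seq C X (arity L p)) (map snd ?qs)"
      using composable_length[OF pqs]
      by (intro C.composable_id_seq[OF X]) (auto simp: id_seq_def C.id_ar X)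
    then have "far G (mcomp L p (map fst ?qs), mcomp (C\<^sub>\<triangleright>) (id_seq C X (arity L p)) (map snd ?qs)) =
        mcomp N (far G (p, id_seq C X (arity L p))) (map (far G) ?qs)"
      by (intro G_comp(1)) (use pqs in \<open>auto simp: id_seq_def comp_def\<close>)
    moreover have "mcomp (C\<^sub>\<triangleright>) (id_seq C X (arity L p)) (map snd ?qs) = id_seq C X (arity L (mcomp L p qs))"
      using C.comp_id_seq_id_seq[OF X, of "map (arity L) qs"] composable_length[OF pqs]
      unfolding snd_qs by (simp only: length_map L.comp_mdom[OF pqs] length_concat map_map comp_def)
    ultimately show ?thesis
      unfolding fst_qs by (simp add: comp_def)
  qed
  moreover have "map fst (map (far transpose) qs) = map (map transpose_ob) (map (mdom L) qs)"
    using qs by (simp add: transpose_def transpose_ar_def)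
  moreover have "map (\<lambda>q. snd (snd q) X) (map (far transpose) qs) =
      map (\<lambda>q. far G (q, id_seq C X (arity L q))) qs" if "X \<in> cob C" for X
    using qs that by (simp add: transpose_def transpose_ar_def)
  ultimately show "far transpose (mcomp L p qs) = mcomp H (far transpose p) (map (far transpose) qs)"
    unfolding internal_hom_simps
    using composable_arD[OF pqs] L.comp_ar[OF pqs]
    by (auto simp: transpose_def transpose_ar_def map_concat simp del: map_map intro!: restrict_ext)
next
  fix A assume A: "A \<in> mob L"
  then show "fob transpose A \<in> mob H"
    by (simp add: transpose_def transpose_ob_in internal_hom_simps)
  have "far G (mid L A, id_seq C X (Suc 0)) = mid N (fob G (A, X))" if "X \<in> cob C" for X
    using G_id[OF A that] by (simp add: id_seq_def)
  then show "far transpose (mid L A) = mid H (fob transpose A)"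
    using A by (auto simp: transpose_def transpose_ar_def internal_hom_simps L.id_ar transpose_ob_simps
        intro!: restrict_ext)
qed (simp_all add: transpose_def)

text \<open>On arrows this is \<open>G_decompose\<close> read from right to left.\<close>

lemma evaluation_transpose:
  "functor_comp (L \<times>\<^sub>m C\<^sub>\<triangleright>) (evaluation C N) (functor_prod L (C\<^sub>\<triangleright>) transpose (functor_id (C\<^sub>\<triangleright>))) = G"
proof -
  have ob: "fob (evaluation C N) (fob transpose A, X) = fob G (A, X)" if "A \<in> mob L" "X \<in> cob C" for A X
    using that by (simp add: transpose_def transpose_ob_in fob_evaluation transpose_ob_simps)
  have ar: "far (evaluation C N) (far transpose p, q) = far G (p, q)"
    if p: "p \<in> mar L" and q: "q \<in> mar (C\<^sub>\<triangleright>)" "length (snd q) = arity L p" for p q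
  proof -
    have X: "fst q \<in> cob C" using q by simp
    have "map2 far (map transpose_ob (mdom L p)) (snd q) =
        map2 (\<lambda>A f. far G (mid L A, (fst q, [f]))) (mdom L p) (snd q)"
      using q by (intro nth_equalityI) (auto simp: transpose_ob_simps subset_iff)
    then show ?thesis
      using far_evaluation[OF transpose_ar_mar[OF p] q(1)] G_decompose[OF p, of "fst q" "snd q"] p q X
      by (simp add: transpose_def transpose_ar_def)
  qed
  show ?thesis
    using functor_fob_ext[OF G] functor_far_ext[OF G] ob ar
    by (auto simp: functor_comp_def functor_prod_def fun_eq_iff extensional_def
        intro!: mfunctor.equality)
qed

text \<open>Evaluation detects everything: identities of \<open>L\<close> paired with one-element
  sequences determine the functors \<open>fob K A\<close>, and arrows of \<open>L\<close> paired
  with identity sequences determine the components of \<open>far K p\<close>.\<close>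

lemma transpose_unique:
  assumes K: "K \<in> symmetric_functors L H"
    and eq: "functor_comp (L \<times>\<^sub>m C\<^sub>\<triangleright>) (evaluation C N) (functor_prod L (C\<^sub>\<triangleright>) K (functor_id (C\<^sub>\<triangleright>))) = G"
  shows "K = transpose"
proof -
  have K_ob: "fob K A \<in> symmetric_functors (C\<^sup>-) N" if "A \<in> mob L" for A
    using functor_ob[OF K that] by (simp add: internal_hom_simps)
  have ev_ob: "fob (evaluation C N) (fob K A, X) = fob G (A, X)" if "A \<in> mob L" "X \<in> cob C" for A X
    using arg_cong[OF eq, of "\<lambda>F. fob F (A, X)"] that by (simp add: functor_comp_def functor_prod_def)
  have ev_ar: "far (evaluation C N) (far K p, q) = far G (p, q)"
    if "p \<in> mar L" "q \<in> mar (C\<^sub>\<triangleright>)" "length (snd q) = arity L p" for p q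
    using arg_cong[OF eq, of "\<lambda>F. far F (p, q)"] that by (simp add: functor_comp_def functor_prod_def)
  have ob: "fob K A = transpose_ob A" if A: "A \<in> mob L" for A
  proof (rule functor_eqI[OF K_ob[OF A] transpose_ob_in[OF A]])
    fix X assume "X \<in> mob (C\<^sup>-)"
    then show "fob (fob K A) X = fob (transpose_ob A) X"
      using ev_ob[OF A, of X] A by (simp add: fob_evaluation K_ob transpose_ob_simps)
  next
    fix f assume f: "f \<in> mar (C\<^sup>-)"
    \<comment> \<open>Since \<open>K\<close> preserves identities, the components of
      \<open>far K (mid L A)\<close> are identities of \<open>N\<close>, and evaluation at
      \<open>[f]\<close> leaves only \<open>far (fob K A) f\<close>.\<close>
    have KA: "far K (mid L A) = mid H (fob K A)" "mid H (fob K A) \<in> mar H"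
      using functor_mid[OF K A] id_mar K_ob[OF A] by auto
    have "far G (mid L A, (ccod C f, [f])) = far (evaluation C N) (mid H (fob K A), (ccod C f, [f]))"
      using ev_ar[of "mid L A" "(ccod C f, [f])"] A f KA by (simp add: L.id_ar C.cod_ob)
    also have "\<dots> = mcomp N (mid N (fob (fob K A) (ccod C f))) [far (fob K A) f]"
      using f KA(2) far_evaluation[of "mid H (fob K A)" "(ccod C f, [f])"]
      by (simp add: C.cod_ob internal_hom_simps)
    also have "\<dots> = far (fob K A) f"
      using N.id_left[of "far (fob K A) f"] f functor_simps(2,4)[OF K_ob[OF A]] by simp
    finally show "far (fob K A) f = far (transpose_ob A) f"
      using f by (simp add: transpose_ob_simps)
  qed
  have ar: "far K p = transpose_ar p" if p: "p \<in> mar L" for p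
  proof (rule mar_eqI)
    show Kp: "far K p \<in> mar H" by (rule functor_mar[OF K p])
    show "transpose_ar p \<in> mar H" by (rule transpose_ar_mar[OF p])
    show dom: "fst (far K p) = fst (transpose_ar p)"
      using functor_mdom[OF K p] L.dom_ob[OF p] ob by (auto simp: internal_hom_simps transpose_ar_def)
    show "fst (snd (far K p)) = fst (snd (transpose_ar p))"
      using functor_mcod[OF K p] L.cod_ob[OF p] ob by (simp add: internal_hom_simps transpose_ar_def)
    fix X assume X: "X \<in> cob C"
    have len: "length (fst (far K p)) = arity L p"
      unfolding dom by (simp add: transpose_ar_def)
    have Fs: "F \<in> symmetric_functors (C\<^sup>-) N" if "F \<in> set (fst (far K p))" for F
      using Kp that by (auto simp: mar_iff)
    have "far (evaluation C N) (far K p, id_seq C X (arity L p)) =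
        mcomp N (snd (snd (far K p)) X) (map2 far (fst (far K p)) (replicate (arity L p) (cid C X)))"
      using far_evaluation[OF Kp C.id_seq_mar[OF X, of "arity L p"]] len by (simp add: id_seq_def)
    \<comment> \<open>The functors send identities to identities, which prepares the right unit law
      in \<open>N\<close>.\<close>
    also have "map2 far (fst (far K p)) (replicate (arity L p) (cid C X)) =
        map (mid N) (mdom N (snd (snd (far K p)) X))"
      unfolding component(2)[OF Kp X]
      using X len by (intro nth_equalityI) (simp_all add: functor_simps(5)[OF Fs])
    also have "mcomp N (snd (snd (far K p)) X) \<dots> = snd (snd (far K p)) X"
      by (rule N.id_right[OF component(1)[OF Kp X]])
    finally show "snd (snd (far K p)) X = snd (snd (transpose_ar p)) X"
      using ev_ar[OF p C.id_seq_mar[OF X]] X by (simp add: transpose_ar_def id_seq_def)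
  qed
  show ?thesis
    by (rule functor_eqI[OF K transpose_in]) (simp_all add: ob ar transpose_def)
qed

end

theorem internal_hom_is_exponential:
  assumes "category C" "symmetric_multicategory N"
  shows "is_exponential TYPE('l \<times> 'k) (C\<^sub>\<triangleright>) N (internal_hom (C\<^sup>-) N) (evaluation C N)"
proof -
  interpret hom_from_category C N
    using assms by (simp add: hom_from_category_def)
  show ?thesis
    unfolding is_exponential_def
  proof (intro conjI allI impI ballI symmetric_multicategory_hom evaluation_in)
    fix L :: "('l, 'k) smcat" and G
    assume "symmetric_multicategory L" "G \<in> symmetric_functors (L \<times>\<^sub>m C\<^sub>\<triangleright>) N"
    then interpret exponential_transpose C N L G
      by (intro exponential_transpose.intro exponential_transpose_axioms.intro hom_from_category_axioms)
    show "\<exists>!K. K \<in> symmetric_functors L H \<and>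
        functor_comp (L \<times>\<^sub>m C\<^sub>\<triangleright>) (evaluation C N) (functor_prod L (C\<^sub>\<triangleright>) K (functor_id (C\<^sub>\<triangleright>))) = G"
      using transpose_in evaluation_transpose transpose_unique by blast
  qed
qed

section \<open>Products of functors and uniqueness of exponentials\<close>

lemma functor_prod_in:
  assumes "symmetric_multicategory L" "symmetric_multicategory M"
    and "F \<in> symmetric_functors L L'" "G \<in> symmetric_functors M M'"
  shows "functor_prod L M F G \<in> symmetric_functors (L \<times>\<^sub>m M) (L' \<times>\<^sub>m M')"
proof -
  interpret L: symmetric_multicategory L by fact
  interpret M: symmetric_multicategory M by fact
  interpret LM: symmetric_multicategory "L \<times>\<^sub>m M"
    using assms(1,2) by (rule symmetric_multicategory_smcat_prod)
  note F = functor_ob[OF assms(3)] functor_mar[OF assms(3)] functor_mdom[OF assms(3)]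
    functor_mcod[OF assms(3)] functor_mid[OF assms(3)] functor_mcomp[OF assms(3)] functor_mact[OF assms(3)]
  note G = functor_ob[OF assms(4)] functor_mar[OF assms(4)] functor_mdom[OF assms(4)]
    functor_mcod[OF assms(4)] functor_mid[OF assms(4)] functor_mcomp[OF assms(4)] functor_mact[OF assms(4)]
  have far: "far (functor_prod L M F G) p = (far F (fst p), far G (snd p))" if "p \<in> mar (L \<times>\<^sub>m M)" for p
    using that by (auto simp: functor_prod_def map_prod_def case_prod_unfold)
  have fob: "fob (functor_prod L M F G) A = (fob F (fst A), fob G (snd A))" if "A \<in> mob (L \<times>\<^sub>m M)" for A
    using that by (auto simp: functor_prod_def)
  show ?thesis
  proof (rule symmetric_functorsI)
    fix p assume p: "p \<in> mar (L \<times>\<^sub>m M)"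
    then show "far (functor_prod L M F G) p \<in> mar (L' \<times>\<^sub>m M')"
      by (simp add: far F G)
    have "map (fob (functor_prod L M F G)) (mdom (L \<times>\<^sub>m M) p) =
        map (\<lambda>A. (fob F (fst A), fob G (snd A))) (mdom (L \<times>\<^sub>m M) p)"
      by (rule map_cong[OF HOL.refl]) (rule fob[OF subsetD[OF LM.dom_ob[OF p]]])
    also have "\<dots> = mdom (L' \<times>\<^sub>m M') (far (functor_prod L M F G) p)"
      using p by (intro nth_equalityI) (simp_all add: far F G)
    finally show "mdom (L' \<times>\<^sub>m M') (far (functor_prod L M F G) p) =
        map (fob (functor_prod L M F G)) (mdom (L \<times>\<^sub>m M) p)" ..
    show "mcod (L' \<times>\<^sub>m M') (far (functor_prod L M F G) p) = fob (functor_prod L M F G) (mcod (L \<times>\<^sub>m M) p)"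
      using p LM.cod_ob[OF p] by (simp add: far fob F G)
    fix s assume s: "s permutes {..<arity (L \<times>\<^sub>m M) p}"
    then show "far (functor_prod L M F G) (mact (L \<times>\<^sub>m M) s p) =
        mact (L' \<times>\<^sub>m M') s (far (functor_prod L M F G) p)"
      using p far[OF LM.act_mar[OF p s]] by (simp add: far F G)
  next
    fix p qs assume pqs: "composable (L \<times>\<^sub>m M) p qs"
    have far_qs: "map (far (functor_prod L M F G)) qs = map (\<lambda>q. (far F (fst q), far G (snd q))) qs"
      using pqs by (intro map_cong HOL.refl far) (auto simp only: composable_def)
    show "far (functor_prod L M F G) (mcomp (L \<times>\<^sub>m M) p qs) =
        mcomp (L' \<times>\<^sub>m M') (far (functor_prod L M F G) p) (map (far (functor_prod L M F G)) qs)"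
      unfolding far_qs using far[OF LM.comp_mar[OF pqs]] far[OF composable_arD[OF pqs]] composable_smcat_prodD(1,2)[OF pqs]
      by (simp add: F G comp_def)
  next
    fix A assume A: "A \<in> mob (L \<times>\<^sub>m M)"
    then show "fob (functor_prod L M F G) A \<in> mob (L' \<times>\<^sub>m M')"
      by (simp add: fob F G mem_Times_iff)
    show "far (functor_prod L M F G) (mid (L \<times>\<^sub>m M) A) = mid (L' \<times>\<^sub>m M') (fob (functor_prod L M F G) A)"
      using A far[OF LM.id_mar[OF A]] by (simp add: fob F G mem_Times_iff)
  qed (simp_all add: functor_prod_def)
qed

lemma functor_prod_comp_id:
  assumes M: "symmetric_multicategory M" and F: "F \<in> symmetric_functors L L'"
  shows "functor_comp (L \<times>\<^sub>m M) (functor_prod L' M G (functor_id M)) (functor_prod L M F (functor_id M)) =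
    functor_prod L M (functor_comp L G F) (functor_id M)"
  by (auto simp: functor_comp_def functor_prod_def functor_id_def functor_ob[OF F] functor_mar[OF F]
      functor_mdom[OF F] intro!: restrict_ext)

text \<open>The usual argument from the universal property. Each exponential is assumed at the types
  of both: at the types of the other one to obtain a comparison functor, and at its own types to
  identify a composite with the identity.\<close>

lemma exponential_unique:
  fixes E :: "('e, 'f) smcat" and E' :: "('g, 'h) smcat"
  assumes M: "symmetric_multicategory M"
    and E: "is_exponential TYPE('e \<times> 'f) M N E ev" "is_exponential TYPE('g \<times> 'h) M N E ev"
    and E': "is_exponential TYPE('e \<times> 'f) M N E' ev'" "is_exponential TYPE('g \<times> 'h) M N E' ev'"
  shows "E' \<cong>\<^sub>m E"
proof -
  have E_mcat: "symmetric_multicategory E" and ev: "ev \<in> symmetric_functors (E \<times>\<^sub>m M) N"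
    using E(1) by (simp_all add: is_exponential_def)
  have E'_mcat: "symmetric_multicategory E'" and ev': "ev' \<in> symmetric_functors (E' \<times>\<^sub>m M) N"
    using E'(1) by (simp_all add: is_exponential_def)
  obtain F where F: "F \<in> symmetric_functors E' E"
    "functor_comp (E' \<times>\<^sub>m M) ev (functor_prod E' M F (functor_id M)) = ev'"
    using E(2) E'_mcat ev' unfolding is_exponential_def by blast
  obtain G where G: "G \<in> symmetric_functors E E'"
    "functor_comp (E \<times>\<^sub>m M) ev' (functor_prod E M G (functor_id M)) = ev"
    using E'(1) E_mcat ev unfolding is_exponential_def by blast
  have id_prod: "functor_prod K M (functor_id K) (functor_id M) = functor_id (K \<times>\<^sub>m M)" for K :: "('x, 'y) smcat"
    by (auto simp: functor_prod_def functor_id_def intro!: restrict_ext)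
  have "functor_comp E F G = functor_id E"
  proof -
    have "functor_comp (E \<times>\<^sub>m M) ev (functor_prod E M (functor_comp E F G) (functor_id M)) = ev"
      using functor_comp_assoc[OF functor_prod_in[OF E_mcat M G(1) functor_id_in[OF M]],
          of ev "functor_prod E' M F (functor_id M)"] functor_prod_comp_id[OF M G(1), of F] F(2) G(2)
      by simp
    moreover have "functor_comp (E \<times>\<^sub>m M) ev (functor_prod E M (functor_id E) (functor_id M)) = ev"
      by (simp add: id_prod functor_comp_id(1)[OF ev])
    ultimately show ?thesis
      using E(1) E_mcat ev functor_comp_in[OF E_mcat G(1) F(1)] functor_id_in[OF E_mcat]
      unfolding is_exponential_def by blast
  qed
  moreover have "functor_comp E' G F = functor_id E'"
  proof -
    have "functor_comp (E' \<times>\<^sub>m M) ev' (functor_prod E' M (functor_comp E' G F) (functor_id M)) = ev'"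
      using functor_comp_assoc[OF functor_prod_in[OF E'_mcat M F(1) functor_id_in[OF M]],
          of ev' "functor_prod E M G (functor_id M)"] functor_prod_comp_id[OF M F(1), of G] F(2) G(2)
      by simp
    moreover have "functor_comp (E' \<times>\<^sub>m M) ev' (functor_prod E' M (functor_id E') (functor_id M)) = ev'"
      by (simp add: id_prod functor_comp_id(1)[OF ev'])
    ultimately show ?thesis
      using E'(2) E'_mcat ev' functor_comp_in[OF E'_mcat F(1) G(1)] functor_id_in[OF E'_mcat]
      unfolding is_exponential_def by blast
  qed
  ultimately show ?thesis
    using E_mcat E'_mcat F(1) G(1) unfolding isomorphic_def by blast
qed


section \<open>The tensor product with a category\<close>

lemma bv_graph_simps [simp]:
  "gob (bv_graph M N) = mob M \<times> mob N"
  "Lgen f A \<in> gar (bv_graph M N) \<longleftrightarrow> f \<in> mar M \<and> A \<in> mob N"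
  "Rgen h X \<in> gar (bv_graph M N) \<longleftrightarrow> h \<in> mar N \<and> X \<in> mob M"
  "gdom (bv_graph M N) (Lgen f A) = map (\<lambda>X. (X, A)) (mdom M f)"
  "gdom (bv_graph M N) (Rgen h X) = map (\<lambda>A. (X, A)) (mdom N h)"
  "gcod (bv_graph M N) (Lgen f A) = (mcod M f, A)"
  "gcod (bv_graph M N) (Rgen h X) = (X, mcod N h)"
  by (simp_all add: bv_graph_def)

lemma multigraph_bv_graph:
  assumes "symmetric_multicategory M" "symmetric_multicategory N"
  shows "multigraph (bv_graph M N)"
proof -
  interpret M: symmetric_multicategory M by fact
  interpret N: symmetric_multicategory N by fact
  show ?thesis
  proof
    fix g assume g: "g \<in> gar (bv_graph M N)"
    show "set (gdom (bv_graph M N) g) \<subseteq> gob (bv_graph M N)"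
      using g M.dom_ob N.dom_ob by (cases g) fastforce+
    show "gcod (bv_graph M N) g \<in> gob (bv_graph M N)"
      using g M.cod_ob N.cod_ob by (cases g) auto
  qed
qed

locale tensor_with_category = C: category C + N: symmetric_multicategory N
  for C :: "('c, 'ca) cat" and N :: "('o, 'a) smcat"
begin

abbreviation S where "S \<equiv> bv_graph (C\<^sup>-) N"
abbreviation R where "R \<equiv> bv_rel (C\<^sup>-) N"

sublocale G: multigraph S R
  by (intro multigraph_bv_graph symmetric_multicategory_unary_mcat
      C.category_axioms N.symmetric_multicategory_axioms)

sublocale P: symmetric_multicategory G.P
  by (rule G.symmetric_multicategory_presented)

sublocale CN: symmetric_multicategory "C\<^sub>\<triangleright> \<times>\<^sub>m N"
  by (intro symmetric_multicategory_smcat_prod symmetric_multicategory_sequence_mcat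
      C.category_axioms N.symmetric_multicategory_axioms)

definition lgen :: "'ca \<Rightarrow> 'o \<Rightarrow> ('c \<times> 'o, ('c, 'ca, 'o, 'a) bv_gen) mterm set" where
  "lgen f A = G.cls (Gen (Lgen f A))"

definition rgen :: "'a \<Rightarrow> 'c \<Rightarrow> ('c \<times> 'o, ('c, 'ca, 'o, 'a) bv_gen) mterm set" where
  "rgen h X = G.cls (Gen (Rgen h X))"

lemma gen_mterms:
  "f \<in> car C \<Longrightarrow> A \<in> mob N \<Longrightarrow> Gen (Lgen f A) \<in> mterms S"
  "h \<in> mar N \<Longrightarrow> X \<in> cob C \<Longrightarrow> Gen (Rgen h X) \<in> mterms S"
  "X \<in> cob C \<Longrightarrow> A \<in> mob N \<Longrightarrow> Ident (X, A) \<in> mterms S"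
  by (auto intro!: mterms.Gen mterms.Ident)

lemma cls_relI:
  assumes "(t, u) \<in> R" "t \<in> mterms S" "u \<in> mterms S" "tdom S t = tdom S u" "tcod S t = tcod S u"
  shows "G.cls t = G.cls u"
  by (rule G.cls_eqI[OF term_eq.rel[OF assms]])

text \<open>The equational laws are clauses of \<open>bv_rel\<close> passed to classes, once both
  sides have been seen to be well-formed and parallel. Interchange arrives with a
  \<open>Perm id\<close>, which \<open>act_id\<close> removes.\<close>

lemma bimorphism_tensor: "bimorphism C N G.P Pair lgen rgen"
proof unfold_locales
  fix X A assume "X \<in> cob C" "A \<in> mob N"
  then show "(X, A) \<in> mob G.P" by simp
next
  fix f A assume fA: "f \<in> car C" "A \<in> mob N"
  then show "lgen f A \<in> mar G.P \<and> mdom G.P (lgen f A) = [(cdom C f, A)] \<and> mcod G.P (lgen f A) = (ccod C f, A)"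
    by (simp add: lgen_def gen_mterms G.cls_mar G.mdom_cls G.mcod_cls)
next
  fix X A assume XA: "X \<in> cob C" "A \<in> mob N"
  show "lgen (cid C X) A = mid G.P (X, A)"
    unfolding lgen_def G.mid_P using XA bv_rel.left_id[of X "C\<^sup>-" A N]
    by (intro cls_relI) (simp_all add: gen_mterms C.id_ar)
  show "rgen (mid N A) X = mid G.P (X, A)"
    unfolding rgen_def G.mid_P using XA bv_rel.right_id[of X "C\<^sup>-" A N]
    by (intro cls_relI) (simp_all add: gen_mterms N.id_ar)
next
  fix f g A assume fg: "f \<in> car C" "g \<in> car C" "ccod C g = cdom C f" "A \<in> mob N"
  have comp: "Comp (Gen (Lgen f A)) [Gen (Lgen g A)] \<in> mterms S"
    using fg by (simp add: G.Comp_in_mterms_iff gen_mterms)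
  have "composable (C\<^sup>-) f [g]" using fg by (simp add: composable_unary)
  from bv_rel.left_comp[OF this fg(4)]
  have "lgen (ccomp C f g) A = G.cls (Comp (Gen (Lgen f A)) [Gen (Lgen g A)])"
    unfolding lgen_def using fg comp by (intro cls_relI) (simp_all add: gen_mterms C.comp_ar)
  then show "lgen (ccomp C f g) A = mcomp G.P (lgen f A) [lgen g A]"
    using G.mcomp_cls[OF comp] by (simp add: lgen_def)
next
  fix h X assume hX: "h \<in> mar N" "X \<in> cob C"
  then show "rgen h X \<in> mar G.P \<and> mdom G.P (rgen h X) = map (Pair X) (mdom N h) \<and>
      mcod G.P (rgen h X) = (X, mcod N h)"
    by (simp add: rgen_def gen_mterms G.cls_mar G.mdom_cls G.mcod_cls)
next
  fix h ks X assume hks: "composable N h ks" and X: "X \<in> cob C"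
  let ?u = "Comp (Gen (Rgen h X)) (map (\<lambda>k. Gen (Rgen k X)) ks)"
  have ks: "set ks \<subseteq> mar N" "h \<in> mar N" "map (mcod N) ks = mdom N h"
    using hks by (simp_all add: composable_def)
  have "map (tcod S) (map (\<lambda>k. Gen (Rgen k X)) ks) = map (Pair X) (map (mcod N) ks)"
    by simp
  then have comp: "?u \<in> mterms S"
    using ks X by (auto simp: G.Comp_in_mterms_iff gen_mterms simp del: map_map)
  have "rgen (mcomp N h ks) X = G.cls ?u"
    unfolding rgen_def using bv_rel.right_comp[OF hks, of X "C\<^sup>-"] X ks comp
    by (intro cls_relI) (simp_all add: gen_mterms N.comp_ar[OF hks] map_concat comp_def)
  then show "rgen (mcomp N h ks) X = mcomp G.P (rgen h X) (map (\<lambda>k. rgen k X) ks)"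
    using G.mcomp_cls[OF comp] by (simp add: rgen_def comp_def)
next
  fix h s X assume hs: "h \<in> mar N" "s permutes {..<arity N h}" "X \<in> cob C"
  have perm: "Perm s (Gen (Rgen h X)) \<in> mterms S"
    using hs by (simp add: G.Perm_in_mterms_iff gen_mterms)
  have "rgen (mact N s h) X = G.cls (Perm s (Gen (Rgen h X)))"
    unfolding rgen_def using bv_rel.right_act[OF hs(1,2), of X "C\<^sup>-"] hs perm
    by (intro cls_relI) (simp_all add: gen_mterms N.act_ar permute_list_map)
  then show "rgen (mact N s h) X = mact G.P s (rgen h X)"
    using G.mact_cls[OF perm] by (simp add: rgen_def)
next
  fix f h assume f: "f \<in> car C" and h: "h \<in> mar N"
  let ?t = "Comp (Gen (Lgen f (mcod N h))) [Gen (Rgen h (cdom C f))]"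
  let ?u = "Comp (Gen (Rgen h (ccod C f))) (map (\<lambda>A. Gen (Lgen f A)) (mdom N h))"
  have t: "?t \<in> mterms S"
    using f h by (simp add: G.Comp_in_mterms_iff gen_mterms C.dom_ob N.cod_ob)
  have u: "?u \<in> mterms S"
    using f h N.dom_ob[OF h] by (auto simp: G.Comp_in_mterms_iff gen_mterms C.cod_ob comp_def)
  then have pu: "Perm id ?u \<in> mterms S"
    by (simp add: G.Perm_in_mterms_iff permutes_id)
  \<comment> \<open>The domain of \<open>?u\<close> arises as a concatenation of one-element lists;
    this identifies it with the domain of \<open>?t\<close>, as \<open>term_eq.rel\<close>
    demands.\<close>
  have "concat (map (\<lambda>A. [(cdom C f, A)]) As) = map (Pair (cdom C f)) As" for As :: "'o list"
    by (induction As) simp_all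
  then have "G.cls ?t = G.cls (Perm id ?u)"
    using bv_rel.interchange[of f "C\<^sup>-" h N] f h t pu
    by (intro cls_relI) (simp_all add: comp_def)
  also have "\<dots> = G.cls ?u"
    by (rule G.cls_eqI[OF term_eq.act_id[OF u]])
  finally have "G.cls ?t = G.cls ?u" .
  moreover have lgens: "map (lgen f) (mdom N h) = map G.cls (map (\<lambda>A. Gen (Lgen f A)) (mdom N h))"
    by (simp add: lgen_def)
  ultimately show "mcomp G.P (lgen f (mcod N h)) [rgen h (cdom C f)] =
      mcomp G.P (rgen h (ccod C f)) (map (lgen f) (mdom N h))"
    unfolding lgens lgen_def rgen_def using G.mcomp_cls[OF t] G.mcomp_cls[OF u] by (simp del: map_map)
qed

sublocale B: bimorphism C N G.P Pair lgen rgen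
  by (rule bimorphism_tensor)

text \<open>The missing partner of a generator is filled with identities: one at \<open>A\<close>
  for an arrow of \<open>C\<close>, and as many identities of \<open>X\<close> as \<open>h\<close>
  has inputs, since arities in the product must agree.\<close>

fun gen_pair :: "('c, 'ca, 'o, 'a) bv_gen \<Rightarrow> ('c \<times> 'ca list) \<times> 'a" where
  "gen_pair (Lgen f A) = ((ccod C f, [f]), mid N A)"
| "gen_pair (Rgen h X) = (id_seq C X (arity N h), h)"

section \<open>The comparison with
  \<open>C\<^sub>\<triangleright> \<times>\<^sub>m N\<close>\<close>

lemma gen_pair_ar:
  "g \<in> gar S \<Longrightarrow> gen_pair g \<in> mar (C\<^sub>\<triangleright> \<times>\<^sub>m N) \<and> mdom (C\<^sub>\<triangleright> \<times>\<^sub>m N) (gen_pair g) = gdom S g \<and>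
    mcod (C\<^sub>\<triangleright> \<times>\<^sub>m N) (gen_pair g) = gcod S g"
  by (cases g) (auto simp: N.id_ar C.id_ar C.cod_ob id_seq_def intro!: nth_equalityI)

abbreviation "interpret_pair \<equiv> interpret_term (C\<^sub>\<triangleright> \<times>\<^sub>m N) (\<lambda>A. A) gen_pair"

text \<open>For interchange both composites have the value
  \<open>((ccod C f, [f, ..., f]), h)\<close>, with one \<open>f\<close> per input of
  \<open>h\<close>. The composition clauses rest on the unit law in \<open>N\<close> and on
  \<open>comp_id_seq_id_seq\<close>.\<close>

lemma interpret_relations:
  assumes "(t, u) \<in> R"
  shows "interpret_pair t = interpret_pair u"
  using assms
proof cases
  case (left_id X A)
  then show ?thesis by (simp add: C.id_ar)
next
  case (left_comp f gs A)
  then show ?thesis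
    using N.id_left[of "mid N A"] by (auto simp: composable_unary_mcat C.comp_ar N.id_ar)
next
  case (left_act f s A)
  then show ?thesis by (simp add: N.act_id N.id_ar)
next
  case (right_id X A)
  then show ?thesis by (simp add: N.id_ar id_seq_def)
next
  case (right_comp h ks X)
  have "id_seq C X (arity N (mcomp N h ks)) =
      mcomp (C\<^sub>\<triangleright>) (id_seq C X (arity N h)) (map (id_seq C X) (map (arity N) ks))"
    using C.comp_id_seq_id_seq[of X "map (arity N) ks"] right_comp composable_length[OF right_comp(3)]
    by (simp only: length_map N.comp_mdom length_concat map_map comp_def unary_mcat_simps)
  then show ?thesis
    using right_comp by (simp add: comp_def)
next
  case (right_act h s X)
  then show ?thesis by (simp add: N.act_ar id_seq_def permute_list_replicate)
next
  case (interchange f h)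
  have h: "h \<in> mar N" and f: "f \<in> car C" using interchange by simp_all
  let ?qs = "map (\<lambda>A. (ccod C f, [f])) (mdom N h)"
  have "mcomp (C\<^sub>\<triangleright>) (id_seq C (ccod C f) (arity N h)) ?qs = (ccod C f, concat (map snd ?qs))"
    using f by (intro C.comp_id_seq) (auto simp: C.cod_ob)
  also have "concat (map snd ?qs) = replicate (arity N h) f"
    by (induction "mdom N h") (simp_all add: comp_def map_replicate_const)
  also have "(ccod C f, replicate (arity N h) f) =
      mcomp (C\<^sub>\<triangleright>) (ccod C f, [f]) [id_seq C (cdom C f) (arity N h)]"
    using f by (simp only: C.comp_unary_id_seq)
  finally have "mcomp (C\<^sub>\<triangleright>) (ccod C f, [f]) [id_seq C (cdom C f) (arity N h)] =
      mcomp (C\<^sub>\<triangleright>) (id_seq C (ccod C f) (arity N h)) ?qs" ..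
  then show ?thesis
    using interchange h N.id_left[OF h] N.id_right[OF h] by (simp add: comp_def N.act_id)
qed

sublocale I: presentation_model S R "C\<^sub>\<triangleright> \<times>\<^sub>m N" "\<lambda>A. A" gen_pair
proof unfold_locales
  fix g assume "g \<in> gar S"
  then show "gen_pair g \<in> mar (C\<^sub>\<triangleright> \<times>\<^sub>m N) \<and> mdom (C\<^sub>\<triangleright> \<times>\<^sub>m N) (gen_pair g) = map (\<lambda>A. A) (gdom S g) \<and>
      mcod (C\<^sub>\<triangleright> \<times>\<^sub>m N) (gen_pair g) = gcod S g"
    using gen_pair_ar by (simp del: smcat_prod_simps)
qed (use interpret_relations in simp_all)

text \<open>Apart from the generator itself only identities enter the composite, so a unit law in
  the tensor product leaves the generator. By \<open>functor_eqI_generators\<close> this settles one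
  composite of the comparison functors.\<close>

lemma pairing_gen_pair: "g \<in> gar S \<Longrightarrow> B.pairing (gen_pair g) = G.cls (Gen g)"
proof (cases g)
  case (Lgen f A)
  assume "g \<in> gar S"
  with Lgen show ?thesis
    using B.left_ar[of f A] P.id_left[of "lgen f A"]
    by (simp add: B.pairing_def B.right_id N.id_ar C.cod_ob lgen_def)
next
  case (Rgen h X)
  assume "g \<in> gar S"
  with Rgen have h: "h \<in> mar N" "X \<in> cob C" by simp_all
  then have "map2 lgen (replicate (arity N h) (cid C X)) (mdom N h) = map (mid G.P) (mdom G.P (rgen h X))"
    using B.right_ar[OF h] by (intro nth_equalityI) (simp_all add: B.left_id N.dom_nth_ob)
  then show ?thesis
    using Rgen B.right_ar[OF h] P.id_right[of "rgen h X"]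
    by (simp add: B.pairing_def id_seq_def rgen_def)
qed

text \<open>Interpreting the composite that defines \<open>pairing\<close> gives an identity
  sequence together with \<open>h\<close>, composed with one-element sequences paired with
  identities. The first coordinates collect to \<open>fs\<close>, and the second coordinate reduces
  to \<open>h\<close>.\<close>

lemma interpret_pairing:
  assumes p: "p \<in> mar (C\<^sub>\<triangleright> \<times>\<^sub>m N)"
  shows "far I.induced_functor (B.pairing p) = p"
proof -
  obtain X fs h where p_eq: "p = ((X, fs), h)" by (metis prod.collapse)
  have h: "h \<in> mar N" and X: "X \<in> cob C" and len: "length fs = arity N h"
    and fs: "\<And>f. f \<in> set fs \<Longrightarrow> f \<in> car C \<and> ccod C f = X"
    using p by (auto simp: p_eq)
  have lgen: "far I.induced_functor (lgen f A) = ((ccod C f, [f]), mid N A)" if "f \<in> car C" "A \<in> mob N" for f A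
    using I.far_induced_functor[OF gen_mterms(1)[OF that]] by (simp add: lgen_def)
  have rgen: "far I.induced_functor (rgen h X) = (id_seq C X (arity N h), h)"
    using I.far_induced_functor[OF gen_mterms(2)[OF h X]] by (simp add: rgen_def)
  let ?qs = "map2 (\<lambda>f A. ((X, [f]), mid N A)) fs (mdom N h)"
  have "map (far I.induced_functor) (map2 lgen fs (mdom N h)) = ?qs"
    using len fs N.dom_nth_ob[OF h] by (intro nth_equalityI) (simp_all add: lgen)
  then have "far I.induced_functor (B.pairing p) = mcomp (C\<^sub>\<triangleright> \<times>\<^sub>m N) (id_seq C X (arity N h), h) ?qs"
    using functor_mcomp[OF I.induced_functor_in B.composable_pairing[OF p]]
    by (simp only: B.pairing_def p_eq fst_conv snd_conv rgen)
  also have "\<dots> = (mcomp (C\<^sub>\<triangleright>) (id_seq C X (arity N h)) (map (\<lambda>f. (X, [f])) fs), mcomp N h (map (mid N) (mdom N h)))"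
  proof -
    have "map fst ?qs = map (\<lambda>f. (X, [f])) fs" "map snd ?qs = map (mid N) (mdom N h)"
      using len by (auto intro!: nth_equalityI)
    then show ?thesis by (simp only: smcat_prod_simps fst_conv snd_conv)
  qed
  also have "mcomp (C\<^sub>\<triangleright>) (id_seq C X (arity N h)) (map (\<lambda>f. (X, [f])) fs) = (X, fs)"
    using fs X len by (subst C.comp_id_seq) (auto simp: comp_def)
  also have "mcomp N h (map (mid N) (mdom N h)) = h"
    by (rule N.id_right[OF h])
  finally show ?thesis by (simp only: p_eq)
qed

lemma tensor_isomorphic: "C\<^sup>- \<otimes>\<^sub>m N \<cong>\<^sub>m C\<^sub>\<triangleright> \<times>\<^sub>m N"
proof -
  have "functor_comp G.P B.pairing_functor I.induced_functor = functor_id G.P"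
  proof (rule G.functor_eqI_generators)
    show "functor_comp G.P B.pairing_functor I.induced_functor \<in> symmetric_functors G.P G.P"
      by (rule functor_comp_in[OF P.symmetric_multicategory_axioms I.induced_functor_in B.pairing_functor_in])
    show "functor_id G.P \<in> symmetric_functors G.P G.P"
      by (rule functor_id_in[OF P.symmetric_multicategory_axioms])
  next
    fix A assume "A \<in> gob S"
    then show "fob (functor_comp G.P B.pairing_functor I.induced_functor) A = fob (functor_id G.P) A"
      by (auto simp: I.induced_functor_def B.pairing_functor_def)
  next
    fix g assume g: "g \<in> gar S"
    then have "Gen g \<in> mterms S" by (rule mterms.Gen)
    then show "far (functor_comp G.P B.pairing_functor I.induced_functor) (G.cls (Gen g)) =
        far (functor_id G.P) (G.cls (Gen g))"
      using g gen_pair_ar[OF g]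
      by (simp add: G.cls_mar I.far_induced_functor B.far_pairing_functor pairing_gen_pair
          del: smcat_prod_simps)
  qed
  moreover have "functor_comp (C\<^sub>\<triangleright> \<times>\<^sub>m N) I.induced_functor B.pairing_functor = functor_id (C\<^sub>\<triangleright> \<times>\<^sub>m N)"
  proof (rule functor_eqI)
    show "functor_comp (C\<^sub>\<triangleright> \<times>\<^sub>m N) I.induced_functor B.pairing_functor \<in> symmetric_functors (C\<^sub>\<triangleright> \<times>\<^sub>m N) (C\<^sub>\<triangleright> \<times>\<^sub>m N)"
      by (rule functor_comp_in[OF CN.symmetric_multicategory_axioms B.pairing_functor_in I.induced_functor_in])
    show "functor_id (C\<^sub>\<triangleright> \<times>\<^sub>m N) \<in> symmetric_functors (C\<^sub>\<triangleright> \<times>\<^sub>m N) (C\<^sub>\<triangleright> \<times>\<^sub>m N)"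
      by (rule functor_id_in[OF CN.symmetric_multicategory_axioms])
  next
    fix A assume "A \<in> mob (C\<^sub>\<triangleright> \<times>\<^sub>m N)"
    then show "fob (functor_comp (C\<^sub>\<triangleright> \<times>\<^sub>m N) I.induced_functor B.pairing_functor) A = fob (functor_id (C\<^sub>\<triangleright> \<times>\<^sub>m N)) A"
      by (auto simp: I.induced_functor_def B.pairing_functor_def)
  next
    fix p assume "p \<in> mar (C\<^sub>\<triangleright> \<times>\<^sub>m N)"
    then show "far (functor_comp (C\<^sub>\<triangleright> \<times>\<^sub>m N) I.induced_functor B.pairing_functor) p = far (functor_id (C\<^sub>\<triangleright> \<times>\<^sub>m N)) p"
      by (simp only: functor_comp_simps functor_id_simps B.far_pairing_functor interpret_pairing)
  qed
  ultimately show ?thesis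
    unfolding isomorphic_def bv_tensor_def
    using P.symmetric_multicategory_axioms CN.symmetric_multicategory_axioms
      I.induced_functor_in B.pairing_functor_in by blast
qed

end

section \<open>The two special cases\<close>

lemma prod_terminal_isomorphic:
  assumes M: "symmetric_multicategory M"
  shows "M \<times>\<^sub>m terminal_cat\<^sub>\<triangleright> \<cong>\<^sub>m M"
proof (rule isomorphicI_bij)
  interpret M: symmetric_multicategory M by fact
  let ?T = "terminal_cat\<^sub>\<triangleright>"
  show MT: "symmetric_multicategory (M \<times>\<^sub>m ?T)"
    by (intro symmetric_multicategory_smcat_prod M symmetric_multicategory_sequence_mcat category_terminal_cat)
  interpret MT: symmetric_multicategory "M \<times>\<^sub>m ?T" by (rule MT)
  let ?F = "\<lparr>fob = restrict fst (mob (M \<times>\<^sub>m ?T)), far = restrict fst (mar (M \<times>\<^sub>m ?T))\<rparr>"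
  have T: "cob terminal_cat = UNIV" "car terminal_cat = UNIV"
    by (simp_all add: terminal_cat_def)
  have far: "far ?F p = fst p" if "p \<in> mar (M \<times>\<^sub>m ?T)" for p
    using that by (simp only: mfunctor.simps restrict_apply if_True)
  show "?F \<in> symmetric_functors (M \<times>\<^sub>m ?T) M"
  proof (rule symmetric_functorsI)
    fix p assume p: "p \<in> mar (M \<times>\<^sub>m ?T)"
    have "map (fob ?F) (mdom (M \<times>\<^sub>m ?T) p) = map fst (mdom (M \<times>\<^sub>m ?T) p)"
      using MT.dom_ob[OF p] by (intro map_cong) auto
    also have "\<dots> = mdom M (far ?F p)"
      using p by simp
    finally show "mdom M (far ?F p) = map (fob ?F) (mdom (M \<times>\<^sub>m ?T) p)" ..
    fix s assume "s permutes {..<arity (M \<times>\<^sub>m ?T) p}"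
    then show "far ?F (mact (M \<times>\<^sub>m ?T) s p) = mact M s (far ?F p)"
      using p MT.act_mar[OF p] by simp
  next
    fix p qs assume pqs: "composable (M \<times>\<^sub>m ?T) p qs"
    have qs: "map (far ?F) qs = map fst qs"
      using pqs by (intro map_cong) (auto simp: composable_def T)
    show "far ?F (mcomp (M \<times>\<^sub>m ?T) p qs) = mcomp M (far ?F p) (map (far ?F) qs)"
      unfolding qs far[OF MT.comp_mar[OF pqs]] far[OF composable_arD[OF pqs]] by simp
  qed (auto simp: M.cod_ob T M.id_ar)
  show "bij_betw (fob ?F) (mob (M \<times>\<^sub>m ?T)) (mob M)"
    by (rule bij_betwI[of _ _ _ "\<lambda>A. (A, ())"]) (auto simp: T)
  show "bij_betw (far ?F) (mar (M \<times>\<^sub>m ?T)) (mar M)"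
  \<comment> \<open>\<open>terminal_cat\<^sub>\<triangleright>\<close> has exactly one arrow of each
    arity, so the second component of a pair is determined by the arity of the first.\<close>
  proof (rule bij_betwI[of _ _ _ "\<lambda>f. (f, ((), replicate (arity M f) ()))"])
    fix p assume "p \<in> mar (M \<times>\<^sub>m ?T)"
    then show "(far ?F p, ((), replicate (arity M (far ?F p)) ())) = p"
      by (auto intro!: prod_eqI replicate_eqI[symmetric])
  qed (auto simp: T)
qed fact

text \<open>Arrows of \<open>D\<^sup>-\<close> are unary, so a partner in
  \<open>C\<^sub>\<triangleright>\<close> is a one-element sequence, that is, an arrow of
  \<open>C\<close>.\<close>

lemma unary_mcat_cat_prod_isomorphic:
  assumes C: "category C" and D: "category D"
  shows "(cat_prod C D)\<^sup>- \<cong>\<^sub>m C\<^sub>\<triangleright> \<times>\<^sub>m D\<^sup>-"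
proof (rule isomorphicI_bij)
  interpret C: category C by fact
  interpret D: category D by fact
  show "symmetric_multicategory ((cat_prod C D)\<^sup>-)"
    by (intro symmetric_multicategory_unary_mcat category_cat_prod C D)
  show "symmetric_multicategory (C\<^sub>\<triangleright> \<times>\<^sub>m D\<^sup>-)"
    by (intro symmetric_multicategory_smcat_prod symmetric_multicategory_sequence_mcat
        symmetric_multicategory_unary_mcat C D)
  let ?F = "\<lparr>fob = restrict (\<lambda>A. A) (cob C \<times> cob D),
    far = restrict (\<lambda>(f, g). ((ccod C f, [f]), g)) (car C \<times> car D)\<rparr>"
  have CD: "cob (cat_prod C D) = cob C \<times> cob D" "car (cat_prod C D) = car C \<times> car D"
    "\<And>f g. cdom (cat_prod C D) (f, g) = (cdom C f, cdom D g)"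
    "\<And>f g. ccod (cat_prod C D) (f, g) = (ccod C f, ccod D g)"
    "\<And>X Y. cid (cat_prod C D) (X, Y) = (cid C X, cid D Y)"
    "\<And>f g f' g'. ccomp (cat_prod C D) (f, g) (f', g') = (ccomp C f f', ccomp D g g')"
    by (simp_all add: cat_prod_def)
  show "?F \<in> symmetric_functors ((cat_prod C D)\<^sup>-) (C\<^sub>\<triangleright> \<times>\<^sub>m D\<^sup>-)"
    by (rule symmetric_functorsI)
      (auto simp: CD C.dom_ob C.cod_ob D.dom_ob D.cod_ob C.id_ar D.id_ar C.comp_ar D.comp_ar
        composable_unary_mcat)
  show "bij_betw (fob ?F) (mob ((cat_prod C D)\<^sup>-)) (mob (C\<^sub>\<triangleright> \<times>\<^sub>m D\<^sup>-))"
    by (rule bij_betwI[of _ _ _ "\<lambda>A. A"]) (auto simp: CD)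
  show "bij_betw (far ?F) (mar ((cat_prod C D)\<^sup>-)) (mar (C\<^sub>\<triangleright> \<times>\<^sub>m D\<^sup>-))"
    by (rule bij_betwI[of _ _ _ "\<lambda>p. (hd (snd (fst p)), snd p)"])
      (auto simp: CD C.cod_ob length_Suc_conv)
qed

text \<open>The exponential is expressed by its universal property with arbitrary test types, and
  any other exponential is then isomorphic to the internal hom. The last two isomorphisms take
  \<open>terminal_cat\<^sub>\<triangleright>\<close> and \<open>D\<^sup>-\<close> for the second
  factor of the tensor product and simplify the resulting cartesian product.\<close>

theorem proposition3p3:
  fixes C :: "('c, 'ca) cat" and D :: "('d, 'da) cat" and N :: "('o, 'a) smcat"
  assumes "category C" and "category D" and "symmetric_multicategory N"
  shows "is_exponential TYPE('l \<times> 'k) (C\<^sub>\<triangleright>) N (internal_hom (C\<^sup>-) N) (evaluation C N) \<and>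
    (\<forall>(E :: ('e, 'f) smcat) ev.
        is_exponential TYPE('e \<times> 'f) (C\<^sub>\<triangleright>) N E ev \<longrightarrow>
        is_exponential TYPE(('c, 'ca, 'o, 'a) mfunctor \<times> ('c, 'ca, 'o, 'a) hom_arrow) (C\<^sub>\<triangleright>) N E ev \<longrightarrow>
        internal_hom (C\<^sup>-) N \<cong>\<^sub>m E) \<and>
    C\<^sup>- \<otimes>\<^sub>m N \<cong>\<^sub>m C\<^sub>\<triangleright> \<times>\<^sub>m N \<and>
    C\<^sup>- \<otimes>\<^sub>m terminal_cat\<^sub>\<triangleright> \<cong>\<^sub>m C\<^sub>\<triangleright> \<and>
    C\<^sup>- \<otimes>\<^sub>m D\<^sup>- \<cong>\<^sub>m (cat_prod C D)\<^sup>-"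
proof (intro conjI allI impI)
  have C_seq: "symmetric_multicategory (C\<^sub>\<triangleright>)"
    using assms(1) by (rule symmetric_multicategory_sequence_mcat)
  show "is_exponential TYPE('l \<times> 'k) (C\<^sub>\<triangleright>) N (internal_hom (C\<^sup>-) N) (evaluation C N)"
    using assms(1,3) by (rule internal_hom_is_exponential)
  show "internal_hom (C\<^sup>-) N \<cong>\<^sub>m E"
    if "is_exponential TYPE('e \<times> 'f) (C\<^sub>\<triangleright>) N E ev"
      "is_exponential TYPE(('c, 'ca, 'o, 'a) mfunctor \<times> ('c, 'ca, 'o, 'a) hom_arrow) (C\<^sub>\<triangleright>) N E ev"
    for E :: "('e, 'f) smcat" and ev
    by (rule exponential_unique[OF C_seq that]) (rule internal_hom_is_exponential[OF assms(1,3)])+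
  show "C\<^sup>- \<otimes>\<^sub>m N \<cong>\<^sub>m C\<^sub>\<triangleright> \<times>\<^sub>m N"
    by (rule tensor_with_category.tensor_isomorphic)
      (simp add: tensor_with_category_def assms)
  show "C\<^sup>- \<otimes>\<^sub>m terminal_cat\<^sub>\<triangleright> \<cong>\<^sub>m C\<^sub>\<triangleright>"
    by (rule isomorphic_trans[OF tensor_with_category.tensor_isomorphic prod_terminal_isomorphic[OF C_seq]])
      (simp add: tensor_with_category_def assms symmetric_multicategory_sequence_mcat category_terminal_cat)
  show "C\<^sup>- \<otimes>\<^sub>m D\<^sup>- \<cong>\<^sub>m (cat_prod C D)\<^sup>-"
    by (rule isomorphic_trans[OF tensor_with_category.tensor_isomorphic
          isomorphic_sym[OF unary_mcat_cat_prod_isomorphic[OF assms(1,2)]]])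
      (simp add: tensor_with_category_def assms symmetric_multicategory_unary_mcat)
qed

end
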